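(* Assume the asymptotic setting below together with conditions (A1)–(A3). Then $$\frac{|\hat a_S-a^*|}{n}\to0\quad\text{almost surely as }n\to\infty.$$
   Context: Asymptotic setting. For each $n$, let $p=p_n$ and let $\Psi=\Psi_n$ be a $p\times p$ positive definite matrix. Let $Y$ be a $p\times(n-1)$ random matrix with i.i.d. columns distributed as $\mathcal N_p(0,\Psi)$, and $W=YY^\top$. (This arises from the Bayesian model $x_i\mid\theta_i\sim\mathcal N_p(\theta_i,I_p)$, $\theta_i\mid\mu\sim\mathcal N_p(\mu,\Lambda)$, $\mu$ flat on $\mathbb R^p$, with $\Psi=I_p+\Lambda$ and $W=(X-\bar X)(X-\bar X)^\top$.) Let $\hat\alpha\ge0$ be a scalar statistic (function of $W$), $c_0\ge0$ a fixed constant, $V=(W+\hat\alpha I_p)^{-1}$, and define $$\hat a_S=\frac{(n-p-1)\mathrm{tr}(V)+\hat\alpha(\mathrm{tr}V)^2}{\mathrm{tr}(V^2W)}-(2c_0+1),\qquad a^*=\frac{\mathrm{tr}(\Psi^{-1})-\hat\alpha\,\mathrm{tr}(V\Psi^{-1})}{\mathrm{tr}(V^2W)}.$$ ($a^*$ minimizes over $a$ the loss $\frac1{np}\mathrm{tr}\{(aV-\Psi^{-1})^2W\}$.) Conditions: (A1) $n/p\to\gamma$ as $n\to\infty$, where $0<\gamma<\infty$ and $\gamma\ne1$. (A2) There are constants $0<c_1\le c_2$ such that all eigenvalues $\tau_1,\dots,\tau_p$ of $\Psi$ lie in $[c_1,c_2]$ for all $n$, and the empirical spectral distribution $H_p(\tau)=p^{-1}\sum_{j=1}^p1_{[\tau_j,\infty)}(\tau)$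 converges to a nonrandom probability distribution $H$. (A3) $\hat\alpha/n\to\alpha$ almost surely as $n\to\infty$, for some constant $\alpha>0$. *)

theory Defs
  imports "HOL-Probability.Probability" "Jordan_Normal_Form.Char_Poly"
    "Jordan_Normal_Form.Gauss_Jordan_Elimination"
begin

definition mtrace :: "real mat \<Rightarrow> real" where
  "mtrace A = (\<Sum>i<dim_row A. A $$ (i, i))"

text \<open>Matrix inverse, made total: the zero matrix if the matrix is singular
  (only relevant on events where the inverse does not exist).\<close>
definition minv :: "real mat \<Rightarrow> real mat" where
  "minv A = (case mat_inverse A of Some B \<Rightarrow> B | None \<Rightarrow> 0\<^sub>m (dim_row A) (dim_col A))"

definition pos_def_mat :: "nat \<Rightarrow> real mat \<Rightarrow> bool" where
  "pos_def_mat p A \<longleftrightarrow> A \<in> carrier_mat p p \<and> transpose_mat A = A \<and>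
     (\<forall>v \<in> carrier_vec p. v \<noteq> 0\<^sub>v p \<longrightarrow> v \<bullet> (A *\<^sub>v v) > 0)"

definition eigenvalues_of :: "nat \<Rightarrow> real mat \<Rightarrow> (nat \<Rightarrow> real) \<Rightarrow> bool" where
  "eigenvalues_of p A tau \<longleftrightarrow> A \<in> carrier_mat p p \<and>
     char_poly A = (\<Prod>j<p. [:- tau j, 1:])"

text \<open>Multivariate normal N_p(0, Psi) for a random vector X (coordinates 0..p-1),
  defined (Cramer--Wold) by: every nonzero linear combination a^T X is
  univariate normal with mean 0 and variance a^T Psi a.\<close>
definition mvnormal :: "'a measure \<Rightarrow> nat \<Rightarrow> real mat \<Rightarrow> ('a \<Rightarrow> nat \<Rightarrow> real) \<Rightarrow> bool" where
  "mvnormal M p Psi X \<longleftrightarrow>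
     X \<in> measurable M (PiM {..<p} (\<lambda>_. borel)) \<and>
     (\<forall>a :: nat \<Rightarrow> real. (\<exists>i<p. a i \<noteq> 0) \<longrightarrow>
        distributed M lborel (\<lambda>\<omega>. \<Sum>i<p. a i * X \<omega> i)
          (\<lambda>x. ennreal (normal_density 0
             (sqrt (\<Sum>i<p. \<Sum>j<p. a i * Psi $$ (i, j) * a j)) x)))"

definition iid_normal_columns ::
  "'a measure \<Rightarrow> nat \<Rightarrow> nat \<Rightarrow> real mat \<Rightarrow> ('a \<Rightarrow> real mat) \<Rightarrow> bool" where
  "iid_normal_columns M p m Psi Y \<longleftrightarrow>
     (\<forall>\<omega> \<in> space M. Y \<omega> \<in> carrier_mat p m) \<and>
     (\<forall>j<m. mvnormal M p Psi (\<lambda>\<omega>. restrict (\<lambda>i. Y \<omega> $$ (i, j)) {..<p})) \<and>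
     prob_space.indep_vars M (\<lambda>_. PiM {..<p} (\<lambda>_. borel))
        (\<lambda>j \<omega>. restrict (\<lambda>i. Y \<omega> $$ (i, j)) {..<p}) {..<m}"

end

theory Submission
  imports Defs "HOL-Real_Asymp.Real_Asymp"
begin

text \<open>Write \<open>m = n - 1\<close>, \<open>W = (\<Sum>j<m. y j * (y j)\<^sup>T)\<close>, \<open>V = (W + a)\<^sup>-\<^sup>1\<close>, \<open>T = \<Psi>\<^sup>-\<^sup>1\<close>, \<open>D = tr (V * V * W)\<close> and let
  \<open>V' j\<close> be the resolvent with column \<open>j\<close> left out. The Sherman--Morrison formula turns the gap
  \<open>(m - p) * tr V + a * (tr V)\<^sup>2 - (tr T - a * tr (V * T))\<close> into
  \<open>\<Sum>j<m. (tr V - (V' j y j) \<bullet> (T y j)) / (1 + y j \<bullet> V' j y j)\<close>. As \<open>y j\<close> is independent of \<open>V' j\<close> and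
  has covariance \<open>\<Psi>\<close>, the quadratic form in the numerator has conditional mean \<open>tr (V' j)\<close> and variance
  \<open>O(1/n)\<close>, so the expected gap is \<open>o(n)\<close>: no limiting spectral law is needed.

  Replacing one column changes the gap only by \<open>O(1)\<close>, hence McDiarmid's inequality and the
  Borel--Cantelli lemma give almost sure convergence for the deterministic \<open>a = n * \<alpha>\<close>; a deterministic
  Lipschitz bound in \<open>a\<close> transfers it to the random \<open>a\<close>, whatever its dependence on \<open>W\<close>.

  The denominator \<open>D\<close> stays away from \<open>0\<close> because, by Cauchy--Schwarz, \<open>p - a * tr V\<close> and
  \<open>tr T - a * tr (V * T)\<close> are both \<open>O(sqrt (D * tr W))\<close>, \<open>tr W = O(n\<^sup>2)\<close>, and a small gap does not allow
  both of them to be \<open>o(n)\<close>.\<close>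

unbundle no inner_syntax
unbundle no vec_syntax

section \<open>Positive semidefinite matrices\<close>

text \<open>With \<open>a\<close> of order \<open>n\<close> the resolvent has norm at most
  \<open>1 / a\<close>, so \<open>tr V = O(1)\<close> while the gap is a priori \<open>O(n)\<close>;
  only a cancellation in its mean brings it down to \<open>o(n)\<close>. The random shift depends on
  every column and would destroy the independence of \<open>y j\<close> and \<open>V' j\<close>,
  hence all probability is done at a deterministic shift. The gap is Lipschitz in the shift with
  constant \<open>O(1)\<close>, so an \<open>o(n)\<close> change of shift costs \<open>o(n)\<close>.
  Gaussian columns are unbounded, yet bounded differences hold: adding \<open>y y^T\<close> changes
  \<open>tr (V T)\<close> by \<open>w . T w / (1 + y . w)\<close>, where \<open>w = V y\<close> for
  the resolvent before the addition, and \<open>a (w . w) \<le> y . w\<close> bounds this by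
  \<open>||T|| / a\<close> whatever the length of \<open>y\<close>. For the denominator put
  \<open>P = p - a tr V\<close> and \<open>Q = tr T - a tr (V T)\<close>. Then gap
  \<open>+ Q = (m - P) (p - P) / a\<close>, so if gap, \<open>P\<close> and \<open>Q\<close> were
  all \<open>o(n)\<close>, then \<open>m p / a\<close>, which has exact order \<open>n\<close>,
  would be too. Matrices are handled through quadratic forms; the eigenvalue bounds enter as bounds
  on the form of \<open>Psi\<close>.\<close>

definition psd :: "nat \<Rightarrow> real mat \<Rightarrow> bool" where
  "psd p A \<longleftrightarrow> A \<in> carrier_mat p p \<and> transpose_mat A = A \<and>
     (\<forall>v \<in> carrier_vec p. 0 \<le> v \<bullet> (A *\<^sub>v v))"

lemma sprod_self_nonneg: "0 \<le> (v :: real vec) \<bullet> v"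
  by (simp add: scalar_prod_def sum_nonneg)

lemma sprod_self_eq_0: "v \<in> carrier_vec p \<Longrightarrow> (v :: real vec) \<bullet> v = 0 \<longleftrightarrow> v = 0\<^sub>v p"
  by (auto simp: scalar_prod_def sum_nonneg_eq_0_iff intro!: eq_vecI)

lemma sym_sprod:
  assumes "A \<in> carrier_mat p p" "transpose_mat A = A" "u \<in> carrier_vec p" "v \<in> carrier_vec p"
  shows "u \<bullet> (A *\<^sub>v v) = (A *\<^sub>v u) \<bullet> (v :: real vec)"
  using transpose_vec_mult_scalar[of A p p v u] assms by simp

lemma sym_sprod_commute:
  assumes "A \<in> carrier_mat p p" "transpose_mat A = A" "u \<in> carrier_vec p" "v \<in> carrier_vec p"
  shows "u \<bullet> (A *\<^sub>v v) = v \<bullet> (A *\<^sub>v (u :: real vec))"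
  using sym_sprod[OF assms] assms by (metis comm_scalar_prod mult_mat_vec_carrier)

text \<open>The leading coefficient may vanish or, a priori, be negative: \<open>c = 0\<close>
  forces \<open>b = 0\<close> because a nonconstant affine function is unbounded below, a negative
  \<open>c\<close> is refuted at one large \<open>t\<close>, and for \<open>c > 0\<close> the vertex
  \<open>t = - b / c\<close> gives the bound.\<close>

lemma quadratic_discriminant_le:
  fixes a b c :: real
  assumes "\<And>t. 0 \<le> a + 2 * t * b + t\<^sup>2 * c"
  shows "b\<^sup>2 \<le> a * c"
proof (cases "c = 0")
  case True
  have "b = 0"
  proof (rule ccontr)
    assume "b \<noteq> 0"
    then have "2 * (- (\<bar>a\<bar> + 1) / (2 * b)) * b = - (\<bar>a\<bar> + 1)" by simp
    with assms[of "- (\<bar>a\<bar> + 1) / (2 * b)"] \<open>c = 0\<close> show False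
      unfolding \<open>c = 0\<close> by linarith
  qed
  then show ?thesis using True by simp
next
  case False
  have "0 \<le> c"
  proof (rule ccontr)
    assume c: "\<not> 0 \<le> c"
    \<comment> \<open>\<open>t\<close> is chosen so that \<open>t^2\<close> exceeds
      \<open>|a / c| + 2 t |b / c|\<close>; after division by the negative \<open>c\<close> the
      quadratic would have to be both nonpositive and at least \<open>t\<close>.\<close>
    define t where "t = 1 + \<bar>a / c\<bar> + 2 * \<bar>b / c\<bar>"
    have t1: "t \<ge> 1" by (simp add: t_def)
    have "0 \<le> (a + 2 * t * b + t\<^sup>2 * c)" by (rule assms)
    then have "(a + 2 * t * b + t\<^sup>2 * c) / c \<le> 0" using c by (simp add: divide_nonneg_neg)
    moreover have "(a + 2 * t * b + t\<^sup>2 * c) / c = a / c + 2 * t * (b / c) + t\<^sup>2"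
      using c by (simp add: field_simps)
    moreover have "t\<^sup>2 = t + t * \<bar>a / c\<bar> + 2 * t * \<bar>b / c\<bar>"
      unfolding power2_eq_square by (subst (2) t_def) (simp add: algebra_simps)
    moreover have "t * \<bar>a / c\<bar> \<ge> \<bar>a / c\<bar>" using mult_right_mono[OF t1, of "\<bar>a / c\<bar>"] by simp
    moreover have "2 * t * \<bar>b / c\<bar> \<ge> - (2 * t * (b / c))"
      using t1 abs_ge_minus_self[of "b / c"] mult_left_mono[of "- (b/c)" "\<bar>b/c\<bar>" "2*t"] by simp
    ultimately show False using t1 by linarith
  qed
  with False have c: "c > 0" by simp
  have "0 \<le> a + 2 * (- b / c) * b + (- b / c)\<^sup>2 * c" by (rule assms)
  also have "\<dots> = a - b\<^sup>2 / c" using c by (simp add: field_simps power2_eq_square)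
  finally show ?thesis using c by (simp add: field_simps)
qed

lemma psd_cauchy_schwarz:
  assumes A: "psd p A" and u: "u \<in> carrier_vec p" and v: "v \<in> carrier_vec p"
  shows "(u \<bullet> (A *\<^sub>v v))\<^sup>2 \<le> (u \<bullet> (A *\<^sub>v u)) * (v \<bullet> (A *\<^sub>v v))"
proof (rule quadratic_discriminant_le)
  fix t :: real
  have Ac: "A \<in> carrier_mat p p" and At: "transpose_mat A = A" using A by (auto simp: psd_def)
  have *: "A *\<^sub>v (t \<cdot>\<^sub>v v) = t \<cdot>\<^sub>v (A *\<^sub>v v)" by (rule mult_mat_vec[OF Ac v])
  have "0 \<le> (u + t \<cdot>\<^sub>v v) \<bullet> (A *\<^sub>v (u + t \<cdot>\<^sub>v v))"
    using A u v by (auto simp: psd_def)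
  also have "\<dots> = (u + t \<cdot>\<^sub>v v) \<bullet> (A *\<^sub>v u + t \<cdot>\<^sub>v (A *\<^sub>v v))"
    using Ac u v * by (simp add: mult_add_distrib_mat_vec[of _ p p])
  also have "\<dots> = u \<bullet> (A *\<^sub>v u) + t * (u \<bullet> (A *\<^sub>v v)) + (t * (v \<bullet> (A *\<^sub>v u)) + t * (t * (v \<bullet> (A *\<^sub>v v))))"
    using Ac u v by (simp add: add_scalar_prod_distrib[of _ p] scalar_prod_add_distrib[of _ p]
       smult_scalar_prod_distrib[of _ p] scalar_prod_smult_distrib[of _ p] algebra_simps)
  also have "v \<bullet> (A *\<^sub>v u) = u \<bullet> (A *\<^sub>v v)" by (rule sym_sprod_commute[OF Ac At v u])
  finally show "0 \<le> u \<bullet> (A *\<^sub>v u) + 2 * t * (u \<bullet> (A *\<^sub>v v)) + t\<^sup>2 * (v \<bullet> (A *\<^sub>v v))"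
    by (simp add: power2_eq_square algebra_simps)
qed

lemma psd_one: "psd p (1\<^sub>m p)"
  by (auto simp: psd_def sprod_self_nonneg)

lemma sprod_cauchy_schwarz:
  assumes "u \<in> carrier_vec p" "v \<in> carrier_vec p"
  shows "((u :: real vec) \<bullet> v)\<^sup>2 \<le> (u \<bullet> u) * (v \<bullet> v)"
  using psd_cauchy_schwarz[OF psd_one assms] assms by simp

section \<open>Inverses and the total function \<open>minv\<close>\<close>

lemma minv_unique:
  assumes A: "A \<in> carrier_mat n n" and B: "B \<in> carrier_mat n n" and AB: "A * B = 1\<^sub>m n"
  shows "minv A = B"
proof -
  have BA: "B * A = 1\<^sub>m n" by (rule mat_mult_left_right_inverse[OF A B AB])
  have "A \<in> Units (ring_mat TYPE(real) n n)"
    unfolding Units_def ring_mat_def using A B AB BA by auto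
  \<comment> \<open>Being a unit excludes the \<open>None\<close> branch, in which
    \<open>minv\<close> returns the zero matrix.\<close>
  then obtain C where C: "mat_inverse A = Some C"
    using mat_inverse(1)[OF A, of n] by (cases "mat_inverse A") auto
  from mat_inverse(2)[OF A C] have "C * A = 1\<^sub>m n" "C \<in> carrier_mat n n" by auto
  then have "C = B" using A B AB by (metis assoc_mult_mat left_mult_one_mat right_mult_one_mat)
  then show ?thesis by (simp add: minv_def C)
qed

text \<open>The adjugate formula is recorded alongside the inverse laws because it makes every entry
  of an inverse a rational function of the entries of \<open>A\<close>, which later yields
  measurability.\<close>

lemma minv_nonsingular:
  assumes A: "A \<in> carrier_mat n n" and d: "det A \<noteq> 0"
  shows minv_adj: "minv A = (1 / det A) \<cdot>\<^sub>m adj_mat A"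
    and minv_carrier: "minv A \<in> carrier_mat n n"
    and minv_right: "A * minv A = 1\<^sub>m n"
    and minv_left: "minv A * A = 1\<^sub>m n"
proof -
  have B: "(1 / det A) \<cdot>\<^sub>m adj_mat A \<in> carrier_mat n n" using adj_mat(1)[OF A] by simp
  have "A * ((1 / det A) \<cdot>\<^sub>m adj_mat A) = (1 / det A) \<cdot>\<^sub>m (A * adj_mat A)"
    by (rule mult_smult_distrib[OF A adj_mat(1)[OF A]])
  also have "\<dots> = 1\<^sub>m n" using d by (auto simp: adj_mat(2)[OF A])
  finally have AB: "A * ((1 / det A) \<cdot>\<^sub>m adj_mat A) = 1\<^sub>m n" .
  show eq: "minv A = (1 / det A) \<cdot>\<^sub>m adj_mat A" by (rule minv_unique[OF A B AB])
  show "minv A \<in> carrier_mat n n" "A * minv A = 1\<^sub>m n" "minv A * A = 1\<^sub>m n"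
    unfolding eq using B AB mat_mult_left_right_inverse[OF A B AB] by auto
qed

lemma minv_transpose:
  assumes A: "A \<in> carrier_mat n n" and d: "det A \<noteq> 0" and s: "transpose_mat A = A"
  shows "transpose_mat (minv A) = minv A"
proof -
  note m = minv_nonsingular(2-4)[OF A d]
  have "A * transpose_mat (minv A) = transpose_mat (minv A * A)"
    using transpose_mult[OF m(1) A] s by simp
  also have "\<dots> = 1\<^sub>m n" using m by simp
  finally show ?thesis using minv_unique[OF A, of "transpose_mat (minv A)"] m(1) by simp
qed

section \<open>Nonsingularity and definiteness\<close>

lemma det_nonzeroI:
  assumes A: "(A :: real mat) \<in> carrier_mat n n"
    and "\<And>v. v \<in> carrier_vec n \<Longrightarrow> A *\<^sub>v v = 0\<^sub>v n \<Longrightarrow> v = 0\<^sub>v n"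
  shows "det A \<noteq> 0"
  using det_0_iff_vec_prod_zero[OF A] assms(2) by blast

lemma pos_def_det:
  assumes "pos_def_mat p A" shows "det A \<noteq> 0"
proof (rule det_nonzeroI)
  show A: "A \<in> carrier_mat p p" using assms by (simp add: pos_def_mat_def)
  fix v assume v: "v \<in> carrier_vec p" "A *\<^sub>v v = 0\<^sub>v p"
  then have "v \<bullet> (A *\<^sub>v v) = 0" by simp
  then show "v = 0\<^sub>v p" using assms v(1) by (force simp: pos_def_mat_def)
qed

text \<open>A crude entrywise constant is enough: it only guarantees some finite shift at which
  \<open>S + t\<close> is psd, and some positive lower bound once an inverse is available.\<close>

lemma quadratic_form_bounded:
  assumes A: "(A :: real mat) \<in> carrier_mat p p"
  obtains K where "K > 0" "\<And>v. v \<in> carrier_vec p \<Longrightarrow> \<bar>v \<bullet> (A *\<^sub>v v)\<bar> \<le> K * (v \<bullet> v)"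
proof
  define K where "K = 1 + (\<Sum>i<p. \<Sum>j<p. \<bar>A $$ (i, j)\<bar>)"
  show "K > 0" unfolding K_def by (intro add_pos_nonneg sum_nonneg) auto
  fix v :: "real vec" assume v: "v \<in> carrier_vec p"
  have vv: "v $ i * v $ i \<le> v \<bullet> v" if "i < p" for i
    using v that unfolding scalar_prod_def by (intro member_le_sum) auto
  have vij: "\<bar>v $ i * v $ j\<bar> \<le> v \<bullet> v" if "i < p" "j < p" for i j
  proof -
    have "2 * \<bar>v $ i * v $ j\<bar> \<le> v $ i * v $ i + v $ j * v $ j"
      using sum_squares_bound[of "\<bar>v $ i\<bar>" "\<bar>v $ j\<bar>"]
      by (simp add: abs_mult power2_eq_square)
    then show ?thesis using vv[OF that(1)] vv[OF that(2)] by linarith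
  qed
  have "v \<bullet> (A *\<^sub>v v) = (\<Sum>i<p. v $ i * (\<Sum>j<p. A $$ (i, j) * v $ j))"
    using A v by (simp add: scalar_prod_def atLeast0LessThan)
  also have "\<dots> = (\<Sum>i<p. \<Sum>j<p. A $$ (i, j) * (v $ i * v $ j))"
    by (simp add: sum_distrib_left mult_ac)
  also have "\<bar>\<dots>\<bar> \<le> (\<Sum>i<p. \<bar>\<Sum>j<p. A $$ (i, j) * (v $ i * v $ j)\<bar>)" by (rule sum_abs)
  also have "\<dots> \<le> (\<Sum>i<p. \<Sum>j<p. \<bar>A $$ (i, j) * (v $ i * v $ j)\<bar>)"
    by (intro sum_mono sum_abs)
  also have "\<dots> \<le> (\<Sum>i<p. \<Sum>j<p. \<bar>A $$ (i, j)\<bar> * (v \<bullet> v))"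
    using vij by (intro sum_mono) (auto simp: abs_mult[of "A $$ _"] intro!: mult_left_mono)
  also have "\<dots> \<le> K * (v \<bullet> v)"
    using sprod_self_nonneg[of v] by (simp add: K_def sum_distrib_right distrib_right)
  finally show "\<bar>v \<bullet> (A *\<^sub>v v)\<bar> \<le> K * (v \<bullet> v)" .
qed

lemma shift_mult_vec:
  assumes "(A :: real mat) \<in> carrier_mat p p" "v \<in> carrier_vec p"
  shows "(A + t \<cdot>\<^sub>m 1\<^sub>m p) *\<^sub>v v = A *\<^sub>v v + t \<cdot>\<^sub>v v"
  using assms by (intro eq_vecI) (auto simp: add_scalar_prod_distrib[of _ p] row_add
    smult_scalar_prod_distrib[of _ p])

lemma shift_sprod:
  assumes "(A :: real mat) \<in> carrier_mat p p" "u \<in> carrier_vec p" "v \<in> carrier_vec p"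
  shows "u \<bullet> ((A + t \<cdot>\<^sub>m 1\<^sub>m p) *\<^sub>v v) = u \<bullet> (A *\<^sub>v v) + t * (u \<bullet> v)"
  using assms by (simp add: shift_mult_vec scalar_prod_add_distrib[of _ p] scalar_prod_smult_distrib[of _ p])

lemma transpose_smult: "transpose_mat (c \<cdot>\<^sub>m A) = c \<cdot>\<^sub>m transpose_mat A"
  by (intro eq_matI) auto

lemma shift_transpose:
  assumes "(A :: real mat) \<in> carrier_mat p p" "transpose_mat A = A"
  shows "transpose_mat (A + t \<cdot>\<^sub>m 1\<^sub>m p) = A + t \<cdot>\<^sub>m 1\<^sub>m p"
  using assms by (simp add: transpose_add[of _ p p] transpose_smult)

text \<open>Continuity method: as \<open>t\<close> decreases from infinity, \<open>S + t\<close> can lose definiteness only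
  at a singular value of \<open>t\<close>.\<close>

lemma psdI_nonsingular_shifts:
  assumes S: "S \<in> carrier_mat p p" and sym: "transpose_mat S = S"
    and det: "\<And>t. t > 0 \<Longrightarrow> det (S + t \<cdot>\<^sub>m 1\<^sub>m p) \<noteq> 0"
  shows "psd p S"
proof -
  define T where "T = {t. 0 \<le> t \<and> (\<forall>v\<in>carrier_vec p. 0 \<le> v \<bullet> (S *\<^sub>v v) + t * (v \<bullet> v))}"
  obtain K where K: "K > 0" "\<And>v. v \<in> carrier_vec p \<Longrightarrow> \<bar>v \<bullet> (S *\<^sub>v v)\<bar> \<le> K * (v \<bullet> v)"
    using quadratic_form_bounded[OF S] by blast
  have "K \<in> T" using K by (force simp: T_def abs_le_iff)
  then have ne: "T \<noteq> {}" by auto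
  have bdd: "bdd_below T" by (auto simp: T_def bdd_below_def)
  define s where "s = Inf T"
  have s0: "0 \<le> s" unfolding s_def using ne by (intro cInf_greatest) (auto simp: T_def)
  \<comment> \<open>The infimum is attained: each nonzero vector imposes the closed condition
    \<open>t \<ge> - (v . S v) / (v . v)\<close>.\<close>
  have sT: "s \<in> T"
    unfolding T_def
  proof (intro CollectI conjI ballI s0)
    fix v :: "real vec" assume v: "v \<in> carrier_vec p"
    show "0 \<le> v \<bullet> (S *\<^sub>v v) + s * (v \<bullet> v)"
    proof (cases "v \<bullet> v = 0")
      case True
      then show ?thesis using K(2)[OF v] by simp
    next
      case False
      then have vv: "v \<bullet> v > 0" using sprod_self_nonneg[of v] by linarith
      have "- (v \<bullet> (S *\<^sub>v v)) / (v \<bullet> v) \<le> s"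
        unfolding s_def
      proof (rule cInf_greatest[OF ne])
        fix t assume "t \<in> T"
        then have "0 \<le> v \<bullet> (S *\<^sub>v v) + t * (v \<bullet> v)" using v by (auto simp: T_def)
        then show "- (v \<bullet> (S *\<^sub>v v)) / (v \<bullet> v) \<le> t" using vv by (simp add: divide_simps)
      qed
      then show ?thesis using vv by (simp add: divide_simps)
    qed
  qed
  have "s = 0"
  proof (rule ccontr)
    assume "s \<noteq> 0"
    with s0 have s: "s > 0" by simp
    define B where "B = S + s \<cdot>\<^sub>m 1\<^sub>m p"
    have Bc: "B \<in> carrier_mat p p" using S by (simp add: B_def)
    have Bt: "transpose_mat B = B" unfolding B_def by (rule shift_transpose[OF S sym])
    have Bf: "v \<bullet> (B *\<^sub>v v) = v \<bullet> (S *\<^sub>v v) + s * (v \<bullet> v)" if "v \<in> carrier_vec p" for v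
      unfolding B_def using shift_sprod[OF S that that] .
    have Bpsd: "psd p B" using sT Bc Bt Bf by (auto simp: psd_def T_def)
    have dB: "det B \<noteq> 0" using det[OF s] by (simp add: B_def)
    define R where "R = minv B"
    note R = minv_nonsingular(2-4)[OF Bc dB, folded R_def]
    obtain L where L: "L > 0" "\<And>v. v \<in> carrier_vec p \<Longrightarrow> \<bar>v \<bullet> (R *\<^sub>v v)\<bar> \<le> L * (v \<bullet> v)"
      using quadratic_form_bounded[OF R(1)] by blast
    \<comment> \<open>Cauchy-Schwarz for the form of \<open>B\<close> applied to \<open>v\<close>
      and \<open>R v\<close>, where \<open>B (R v) = v\<close>: an invertible psd form is bounded
      below, here by \<open>1 / L\<close>.\<close>
    have low: "v \<bullet> v \<le> L * (v \<bullet> (B *\<^sub>v v))" if v: "v \<in> carrier_vec p" for v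
    proof (cases "v \<bullet> v = 0")
      case True
      then show ?thesis using Bpsd v L(1) by (simp add: psd_def)
    next
      case False
      then have vv: "v \<bullet> v > 0" using sprod_self_nonneg[of v] by linarith
      have Rv: "R *\<^sub>v v \<in> carrier_vec p" using R(1) v by simp
      have BRv: "B *\<^sub>v (R *\<^sub>v v) = v"
        using assoc_mult_mat_vec[OF Bc R(1) v] R(2) v by simp
      have "(v \<bullet> v)\<^sup>2 \<le> (v \<bullet> (B *\<^sub>v v)) * ((R *\<^sub>v v) \<bullet> v)"
        using psd_cauchy_schwarz[OF Bpsd v Rv] BRv by simp
      also have "(R *\<^sub>v v) \<bullet> v = v \<bullet> (R *\<^sub>v v)" by (rule comm_scalar_prod[OF Rv v])
      also have "(v \<bullet> (B *\<^sub>v v)) * (v \<bullet> (R *\<^sub>v v)) \<le> (v \<bullet> (B *\<^sub>v v)) * (L * (v \<bullet> v))"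
        using Bpsd v L(2)[OF v] by (intro mult_left_mono) (auto simp: psd_def)
      finally have "(v \<bullet> v) * (v \<bullet> v) \<le> (L * (v \<bullet> (B *\<^sub>v v))) * (v \<bullet> v)"
        by (simp add: power2_eq_square mult_ac)
      then show ?thesis using vv by simp
    qed
    \<comment> \<open>The lower bound \<open>1 / L\<close> of \<open>B = S + s\<close> is room to
      lower the shift by that amount; \<open>min\<close> keeps it nonnegative, and
      \<open>r < s\<close> contradicts minimality.\<close>
    define r where "r = s - min s (1 / L)"
    have "r \<in> T"
      unfolding T_def
    proof (intro CollectI conjI ballI)
      show "0 \<le> r" by (simp add: r_def)
      fix v :: "real vec" assume v: "v \<in> carrier_vec p"
      have "min s (1 / L) * (v \<bullet> v) \<le> 1 / L * (v \<bullet> v)"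
        by (intro mult_right_mono sprod_self_nonneg) simp
      also have "\<dots> \<le> v \<bullet> (B *\<^sub>v v)" using low[OF v] L(1) by (simp add: divide_simps mult_ac)
      also have "\<dots> = v \<bullet> (S *\<^sub>v v) + s * (v \<bullet> v)" by (rule Bf[OF v])
      finally show "0 \<le> v \<bullet> (S *\<^sub>v v) + r * (v \<bullet> v)" by (simp add: r_def algebra_simps)
    qed
    then have "s \<le> r" unfolding s_def by (intro cInf_lower bdd)
    moreover have "r < s" using s L(1) by (simp add: r_def)
    ultimately show False by simp
  qed
  then show ?thesis using sT S sym by (auto simp: psd_def T_def)
qed

lemma eigenvalues_of_trivial_kernel:
  assumes ev: "eigenvalues_of p A tau" and k: "\<And>j. j < p \<Longrightarrow> tau j \<noteq> k"
    and v: "v \<in> carrier_vec p" "A *\<^sub>v v = k \<cdot>\<^sub>v v"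
  shows "v = 0\<^sub>v p"
proof (rule ccontr)
  assume "v \<noteq> 0\<^sub>v p"
  have A: "A \<in> carrier_mat p p" using ev by (simp add: eigenvalues_of_def)
  have "eigenvalue A k"
    unfolding eigenvalue_def eigenvector_def using A v \<open>v \<noteq> 0\<^sub>v p\<close> by auto
  then have "poly (\<Prod>j<p. [:- tau j, 1:]) k = 0"
    using eigenvalue_root_char_poly[OF A] ev by (simp add: eigenvalues_of_def)
  then show False using k by (auto simp: poly_prod)
qed

text \<open>No diagonalization takes place: for \<open>t > 0\<close> neither \<open>c1 - t\<close>
  nor \<open>c2 + t\<close> is an eigenvalue, so the shifts \<open>A - c1 + t\<close> and
  \<open>- A + c2 + t\<close> are nonsingular and the continuity method makes \<open>A - c1\<close>
  and \<open>c2 - A\<close> psd.\<close>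

lemma quadratic_form_bounds:
  assumes ev: "eigenvalues_of p A tau" and sym: "transpose_mat A = A"
    and bd: "\<And>j. j < p \<Longrightarrow> tau j \<in> {c1..c2}" and v: "v \<in> carrier_vec p"
  shows "c1 * (v \<bullet> v) \<le> v \<bullet> (A *\<^sub>v v)" "v \<bullet> (A *\<^sub>v v) \<le> c2 * (v \<bullet> v)"
proof -
  have A: "A \<in> carrier_mat p p" using ev by (simp add: eigenvalues_of_def)
  have neg: "(- 1 \<cdot>\<^sub>m A) *\<^sub>v u = - (A *\<^sub>v u)" if "u \<in> carrier_vec p" for u
    using A that by (intro eq_vecI) (auto simp: smult_scalar_prod_distrib[of _ p])
  have "psd p (A + (- c1) \<cdot>\<^sub>m 1\<^sub>m p)"
  proof (rule psdI_nonsingular_shifts)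
    show "A + (- c1) \<cdot>\<^sub>m 1\<^sub>m p \<in> carrier_mat p p" using A by simp
    show "transpose_mat (A + (- c1) \<cdot>\<^sub>m 1\<^sub>m p) = A + (- c1) \<cdot>\<^sub>m 1\<^sub>m p" by (rule shift_transpose[OF A sym])
    fix t :: real assume t: "t > 0"
    have eq: "A + (- c1) \<cdot>\<^sub>m 1\<^sub>m p + t \<cdot>\<^sub>m 1\<^sub>m p = A + (t - c1) \<cdot>\<^sub>m 1\<^sub>m p"
      using A by (intro eq_matI) auto
    show "det (A + (- c1) \<cdot>\<^sub>m 1\<^sub>m p + t \<cdot>\<^sub>m 1\<^sub>m p) \<noteq> 0"
      unfolding eq
    proof (rule det_nonzeroI[where n = p])
      show "A + (t - c1) \<cdot>\<^sub>m 1\<^sub>m p \<in> carrier_mat p p" using A by simp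
      fix u :: "real vec" assume u: "u \<in> carrier_vec p" "(A + (t - c1) \<cdot>\<^sub>m 1\<^sub>m p) *\<^sub>v u = 0\<^sub>v p"
      have "A *\<^sub>v u + (t - c1) \<cdot>\<^sub>v u = 0\<^sub>v p" using u shift_mult_vec[OF A u(1)] by simp
      then have "A *\<^sub>v u = (c1 - t) \<cdot>\<^sub>v u"
        using A u(1) by (intro eq_vecI) (auto simp: vec_eq_iff algebra_simps)
      then show "u = 0\<^sub>v p" using bd t by (intro eigenvalues_of_trivial_kernel[OF ev _ u(1), of "c1 - t"]) force+
    qed
  qed
  then have "0 \<le> v \<bullet> ((A + (- c1) \<cdot>\<^sub>m 1\<^sub>m p) *\<^sub>v v)" using v by (auto simp: psd_def)
  then show "c1 * (v \<bullet> v) \<le> v \<bullet> (A *\<^sub>v v)" using shift_sprod[OF A v v] by simp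
  define N where "N = - 1 \<cdot>\<^sub>m A"
  have N: "N \<in> carrier_mat p p" using A by (simp add: N_def)
  have Nt: "transpose_mat N = N" using A sym by (simp add: N_def transpose_smult)
  have "psd p (N + c2 \<cdot>\<^sub>m 1\<^sub>m p)"
  proof (rule psdI_nonsingular_shifts)
    show "N + c2 \<cdot>\<^sub>m 1\<^sub>m p \<in> carrier_mat p p" using N by simp
    show "transpose_mat (N + c2 \<cdot>\<^sub>m 1\<^sub>m p) = N + c2 \<cdot>\<^sub>m 1\<^sub>m p" by (rule shift_transpose[OF N Nt])
    fix t :: real assume t: "t > 0"
    have eq: "N + c2 \<cdot>\<^sub>m 1\<^sub>m p + t \<cdot>\<^sub>m 1\<^sub>m p = N + (t + c2) \<cdot>\<^sub>m 1\<^sub>m p"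
      using N by (intro eq_matI) auto
    show "det (N + c2 \<cdot>\<^sub>m 1\<^sub>m p + t \<cdot>\<^sub>m 1\<^sub>m p) \<noteq> 0"
      unfolding eq
    proof (rule det_nonzeroI[where n = p])
      show "N + (t + c2) \<cdot>\<^sub>m 1\<^sub>m p \<in> carrier_mat p p" using N by simp
      fix u :: "real vec" assume u: "u \<in> carrier_vec p" "(N + (t + c2) \<cdot>\<^sub>m 1\<^sub>m p) *\<^sub>v u = 0\<^sub>v p"
      have "- (A *\<^sub>v u) + (t + c2) \<cdot>\<^sub>v u = 0\<^sub>v p" using u shift_mult_vec[OF N u(1)] neg by (simp add: N_def)
      then have "A *\<^sub>v u = (c2 + t) \<cdot>\<^sub>v u"
        using A u(1) by (intro eq_vecI) (auto simp: vec_eq_iff algebra_simps)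
      then show "u = 0\<^sub>v p" using bd t by (intro eigenvalues_of_trivial_kernel[OF ev _ u(1), of "c2 + t"]) force+
    qed
  qed
  then have "0 \<le> v \<bullet> ((N + c2 \<cdot>\<^sub>m 1\<^sub>m p) *\<^sub>v v)" using v by (auto simp: psd_def)
  moreover have "v \<bullet> (N *\<^sub>v v) = - (v \<bullet> (A *\<^sub>v v))"
    using neg[OF v] A v by (simp add: N_def)
  ultimately show "v \<bullet> (A *\<^sub>v v) \<le> c2 * (v \<bullet> v)" using shift_sprod[OF N v v] by simp
qed

section \<open>Resolvents and rank-one updates\<close>

lemma abs_sprod_le:
  assumes "u \<in> carrier_vec p" "v \<in> carrier_vec p" "0 \<le> r" "0 \<le> s"
    and "(u :: real vec) \<bullet> u \<le> r\<^sup>2" "v \<bullet> v \<le> s\<^sup>2"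
  shows "\<bar>u \<bullet> v\<bar> \<le> r * s"
proof (rule power2_le_imp_le)
  have "\<bar>u \<bullet> v\<bar>\<^sup>2 \<le> (u \<bullet> u) * (v \<bullet> v)" using sprod_cauchy_schwarz[OF assms(1,2)] by simp
  also have "\<dots> \<le> r\<^sup>2 * s\<^sup>2" using assms by (intro mult_mono) (auto simp: sprod_self_nonneg)
  finally show "\<bar>u \<bullet> v\<bar>\<^sup>2 \<le> (r * s)\<^sup>2" by (simp add: power_mult_distrib)
  show "0 \<le> r * s" using assms by simp
qed

text \<open>Cauchy-Schwarz for the form of \<open>A\<close> with the vectors \<open>A v\<close> and
  \<open>v\<close> bounds \<open>|A v|^4\<close> by \<open>(A v . A (A v)) (v . A v)\<close>, and
  the hypothesis bounds both factors; one factor \<open>|A v|^2\<close> cancels.\<close>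

lemma operator_norm_bound:
  assumes A: "psd p A" and up: "\<And>v. v \<in> carrier_vec p \<Longrightarrow> v \<bullet> (A *\<^sub>v v) \<le> c * (v \<bullet> v)"
    and v: "v \<in> carrier_vec p"
  shows "(A *\<^sub>v v) \<bullet> (A *\<^sub>v v) \<le> c\<^sup>2 * (v \<bullet> v)"
proof -
  define w where "w = A *\<^sub>v v"
  have Ac: "A \<in> carrier_mat p p" and At: "transpose_mat A = A" using A by (auto simp: psd_def)
  have w: "w \<in> carrier_vec p" using Ac v by (simp add: w_def)
  have nn: "0 \<le> v \<bullet> (A *\<^sub>v v)" "0 \<le> w \<bullet> (A *\<^sub>v w)" using A v w by (auto simp: psd_def)
  show ?thesis
  proof (cases "w \<bullet> w = 0")
    case True
    then show ?thesis using sprod_self_nonneg[of v] by (simp add: w_def)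
  next
    case False
    then have ww: "w \<bullet> w > 0" using sprod_self_nonneg[of w] by linarith
    have "(w \<bullet> w)\<^sup>2 \<le> (w \<bullet> (A *\<^sub>v w)) * (v \<bullet> (A *\<^sub>v v))"
      using psd_cauchy_schwarz[OF A w v] by (simp add: w_def)
    also have "\<dots> \<le> (c * (w \<bullet> w)) * (c * (v \<bullet> v))"
      using up[OF w] up[OF v] nn by (intro mult_mono) auto
    finally have "(w \<bullet> w) * (w \<bullet> w) \<le> (c\<^sup>2 * (v \<bullet> v)) * (w \<bullet> w)"
      by (simp add: power2_eq_square mult_ac)
    then show ?thesis using ww by (simp add: w_def)
  qed
qed

text \<open>For \<open>w = T v\<close> one has \<open>A w = v\<close>, hence
  \<open>c |w|^2 \<le> w . v \<le> |w| |v|\<close>. It serves both the resolvent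
  (\<open>c = a\<close>) and \<open>minv Psi\<close> (\<open>c = c1\<close>).\<close>

lemma inverse_norm_bound:
  fixes A :: "real mat"
  assumes A: "A \<in> carrier_mat p p" and c: "c > 0"
    and low: "\<And>v. v \<in> carrier_vec p \<Longrightarrow> c * (v \<bullet> v) \<le> v \<bullet> (A *\<^sub>v v)"
    and T: "T \<in> carrier_mat p p" "A * T = 1\<^sub>m p" and v: "v \<in> carrier_vec p"
  shows "(T *\<^sub>v v) \<bullet> (T *\<^sub>v v) \<le> (1 / c)\<^sup>2 * (v \<bullet> v)"
proof -
  define w where "w = T *\<^sub>v v"
  have w: "w \<in> carrier_vec p" using T v by (simp add: w_def)
  have Aw: "A *\<^sub>v w = v" using assoc_mult_mat_vec[OF A T(1) v] T(2) v by (simp add: w_def)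
  show ?thesis
  proof (cases "w \<bullet> w = 0")
    case True
    then show ?thesis using sprod_self_nonneg[of v] by (simp add: w_def)
  next
    case False
    then have ww: "w \<bullet> w > 0" using sprod_self_nonneg[of w] by linarith
    have "c * (w \<bullet> w) \<le> w \<bullet> v" using low[OF w] Aw by simp
    then have "(c * (w \<bullet> w))\<^sup>2 \<le> (w \<bullet> v)\<^sup>2" using c ww by (intro power_mono) auto
    also have "\<dots> \<le> (w \<bullet> w) * (v \<bullet> v)" by (rule sprod_cauchy_schwarz[OF w v])
    finally have "c\<^sup>2 * (w \<bullet> w) * (w \<bullet> w) \<le> (v \<bullet> v) * (w \<bullet> w)"
      by (simp add: power2_eq_square mult_ac)
    then have "c\<^sup>2 * (w \<bullet> w) \<le> v \<bullet> v" using ww by simp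
    then show ?thesis using c by (simp add: w_def field_simps)
  qed
qed

section \<open>Traces and resolvents of psd matrices\<close>

lemma mtrace_unit:
  assumes "B \<in> carrier_mat p p"
  shows "mtrace B = (\<Sum>i<p. unit_vec p i \<bullet> (B *\<^sub>v unit_vec p i))"
  using assms unfolding mtrace_def by (intro sum.cong) auto

definition resolvent :: "nat \<Rightarrow> real mat \<Rightarrow> real \<Rightarrow> real mat" where
  "resolvent p A a = minv (A + a \<cdot>\<^sub>m 1\<^sub>m p)"

lemma psd_shift_det:
  assumes A: "psd p A" and a: "a > 0"
  shows "det (A + a \<cdot>\<^sub>m 1\<^sub>m p) \<noteq> 0"
proof (rule det_nonzeroI[where n = p])
  have Ac: "A \<in> carrier_mat p p" using A by (simp add: psd_def)
  then show "A + a \<cdot>\<^sub>m 1\<^sub>m p \<in> carrier_mat p p" by simp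
  fix v assume v: "v \<in> carrier_vec p" "(A + a \<cdot>\<^sub>m 1\<^sub>m p) *\<^sub>v v = 0\<^sub>v p"
  have "v \<bullet> ((A + a \<cdot>\<^sub>m 1\<^sub>m p) *\<^sub>v v) = 0" using v by simp
  then have "v \<bullet> (A *\<^sub>v v) + a * (v \<bullet> v) = 0" using shift_sprod[OF Ac v(1) v(1)] by simp
  moreover have "0 \<le> v \<bullet> (A *\<^sub>v v)" using A v by (simp add: psd_def)
  moreover have "0 \<le> a * (v \<bullet> v)" using a by (simp add: sprod_self_nonneg)
  ultimately have "a * (v \<bullet> v) = 0" by linarith
  then show "v = 0\<^sub>v p" using sprod_self_eq_0[OF v(1)] a by simp
qed

locale psd_resolvent =
  fixes p :: nat and A :: "real mat" and a :: real
  assumes A: "psd p A" and a: "a > 0"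
begin

abbreviation "R \<equiv> resolvent p A a"

lemma Ac: "A \<in> carrier_mat p p" and At: "transpose_mat A = A"
  using A by (auto simp: psd_def)

lemma R_carrier [simp, intro]: "R \<in> carrier_mat p p"
  and R_right: "(A + a \<cdot>\<^sub>m 1\<^sub>m p) * R = 1\<^sub>m p"
  and R_left: "R * (A + a \<cdot>\<^sub>m 1\<^sub>m p) = 1\<^sub>m p"
  unfolding resolvent_def using minv_nonsingular(2-4)[OF _ psd_shift_det[OF A a]] Ac by auto

lemma R_vec [simp]: "v \<in> carrier_vec p \<Longrightarrow> R *\<^sub>v v \<in> carrier_vec p"
  by (rule mult_mat_vec_carrier[OF R_carrier])

lemma R_mult [simp]: "T \<in> carrier_mat p q \<Longrightarrow> R * T \<in> carrier_mat p q"
  by (rule mult_carrier_mat[OF R_carrier])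

lemma R_sym: "transpose_mat R = R"
  unfolding resolvent_def
  by (rule minv_transpose[OF _ psd_shift_det[OF A a] shift_transpose[OF Ac At]]) (use Ac in auto)

lemma R_eq:
  assumes v: "v \<in> carrier_vec p"
  shows "A *\<^sub>v (R *\<^sub>v v) + a \<cdot>\<^sub>v (R *\<^sub>v v) = v"
proof -
  have "(A + a \<cdot>\<^sub>m 1\<^sub>m p) *\<^sub>v (R *\<^sub>v v) = v"
    using assoc_mult_mat_vec[of "A + a \<cdot>\<^sub>m 1\<^sub>m p" p p R p v] Ac v R_right by simp
  then show ?thesis using shift_mult_vec[OF Ac, of "R *\<^sub>v v"] v by simp
qed

lemma R_cancel:
  assumes v: "v \<in> carrier_vec p"
  shows "R *\<^sub>v (A *\<^sub>v v + a \<cdot>\<^sub>v v) = v"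
proof -
  have "R *\<^sub>v ((A + a \<cdot>\<^sub>m 1\<^sub>m p) *\<^sub>v v) = v"
    using assoc_mult_mat_vec[of R p p "A + a \<cdot>\<^sub>m 1\<^sub>m p" p v] Ac v R_left by simp
  then show ?thesis using shift_mult_vec[OF Ac v] by simp
qed

text \<open>With \<open>u = R v\<close>, pairing \<open>v = A u + a u\<close> with \<open>u\<close>
  leaves the nonnegative term \<open>u . A u\<close>. In operator terms this is
  \<open>a R^2 \<le> R\<close>, the inequality behind the bounds that are uniform in the added
  column.\<close>

lemma R_form_ge:
  assumes v: "v \<in> carrier_vec p"
  shows "a * ((R *\<^sub>v v) \<bullet> (R *\<^sub>v v)) \<le> v \<bullet> (R *\<^sub>v v)"
proof -
  define u where "u = R *\<^sub>v v"
  have u: "u \<in> carrier_vec p" using v by (simp add: u_def)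
  have "v \<bullet> u = (A *\<^sub>v u + a \<cdot>\<^sub>v u) \<bullet> u" using R_eq[OF v] by (simp add: u_def)
  also have "\<dots> = (A *\<^sub>v u) \<bullet> u + a * (u \<bullet> u)"
    using u Ac by (simp add: add_scalar_prod_distrib[of _ p] smult_scalar_prod_distrib[of _ p])
  also have "(A *\<^sub>v u) \<bullet> u = u \<bullet> (A *\<^sub>v u)" using u Ac by (intro comm_scalar_prod[of _ p]) auto
  finally show ?thesis using A u by (auto simp: psd_def u_def)
qed

lemma R_form_nonneg: "v \<in> carrier_vec p \<Longrightarrow> 0 \<le> v \<bullet> (R *\<^sub>v v)"
  using R_form_ge[of v] a sprod_self_nonneg[of "R *\<^sub>v v"] by (smt (verit) mult_nonneg_nonneg)

lemma R_norm:
  assumes v: "v \<in> carrier_vec p"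
  shows "(R *\<^sub>v v) \<bullet> (R *\<^sub>v v) \<le> (1 / a)\<^sup>2 * (v \<bullet> v)"
  using Ac a
proof (intro inverse_norm_bound[OF _ a _ R_carrier R_right v])
  fix u :: "real vec" assume u: "u \<in> carrier_vec p"
  show "a * (u \<bullet> u) \<le> u \<bullet> ((A + a \<cdot>\<^sub>m 1\<^sub>m p) *\<^sub>v u)"
    unfolding shift_sprod[OF Ac u u] using A u by (simp add: psd_def)
qed simp

lemma mtrace_RT_abs_le:
  assumes T: "T \<in> carrier_mat p p" and t: "0 \<le> t"
    and Tn: "\<And>v. v \<in> carrier_vec p \<Longrightarrow> (T *\<^sub>v v) \<bullet> (T *\<^sub>v v) \<le> t\<^sup>2 * (v \<bullet> v)"
  shows "\<bar>mtrace (R * T)\<bar> \<le> real p * (t / a)"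
proof -
  have "\<bar>unit_vec p i \<bullet> ((R * T) *\<^sub>v unit_vec p i)\<bar> \<le> t / a" if i: "i < p" for i
  proof -
    have "\<bar>unit_vec p i \<bullet> ((R * T) *\<^sub>v unit_vec p i)\<bar> = \<bar>(R *\<^sub>v unit_vec p i) \<bullet> (T *\<^sub>v unit_vec p i)\<bar>"
      using T sym_sprod[OF R_carrier R_sym, of "unit_vec p i" "T *\<^sub>v unit_vec p i"]
      by (simp add: assoc_mult_mat_vec[OF R_carrier T] del: scalar_prod_left_unit)
    also have "\<dots> \<le> (1 / a) * t"
      using R_norm[of "unit_vec p i"] Tn[of "unit_vec p i"] T a t i
      by (intro abs_sprod_le[of _ p]) auto
    finally show ?thesis by simp
  qed
  then have "\<bar>\<Sum>i<p. unit_vec p i \<bullet> ((R * T) *\<^sub>v unit_vec p i)\<bar> \<le> (\<Sum>i<p. t / a)"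
    by (intro order_trans[OF sum_abs] sum_mono) auto
  then show ?thesis unfolding mtrace_unit[OF R_mult[OF T]] by simp
qed

lemma mtrace_R_nonneg: "0 \<le> mtrace R"
  unfolding mtrace_unit[OF R_carrier] by (intro sum_nonneg R_form_nonneg) auto

lemma mtrace_R_le: "mtrace R \<le> real p / a"
  using mtrace_RT_abs_le[of "1\<^sub>m p" 1] right_mult_one_mat[OF R_carrier] by (auto simp: abs_le_iff)

end

text \<open>First resolvent identity in vector form: apply the resolvent at \<open>a\<close> to
  \<open>v = (A u + a u) + (b - a) u\<close>, where \<open>u\<close> is the resolvent at
  \<open>b\<close> applied to \<open>v\<close>.\<close>

lemma resolvent_identity:
  assumes A: "psd p A" and ab: "a > 0" "b > 0" and v: "v \<in> carrier_vec p"
  shows "resolvent p A a *\<^sub>v v - resolvent p A b *\<^sub>v v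
    = (b - a) \<cdot>\<^sub>v (resolvent p A a *\<^sub>v (resolvent p A b *\<^sub>v v))"
proof -
  interpret a: psd_resolvent p A a by unfold_locales fact+
  interpret b: psd_resolvent p A b by unfold_locales fact+
  define u where "u = b.R *\<^sub>v v"
  have u: "u \<in> carrier_vec p" using mult_mat_vec_carrier[OF b.R_carrier v] by (simp add: u_def)
  have Au: "A *\<^sub>v u \<in> carrier_vec p" using a.Ac u by simp
  have "v = (A *\<^sub>v u + a \<cdot>\<^sub>v u) + (b - a) \<cdot>\<^sub>v u"
    unfolding b.R_eq[OF v, folded u_def, symmetric]
    using u Au by (intro eq_vecI) (auto simp: algebra_simps)
  then have "a.R *\<^sub>v v = a.R *\<^sub>v (A *\<^sub>v u + a \<cdot>\<^sub>v u) + a.R *\<^sub>v ((b - a) \<cdot>\<^sub>v u)"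
    using u Au mult_add_distrib_mat_vec[OF a.R_carrier, of "A *\<^sub>v u + a \<cdot>\<^sub>v u" "(b - a) \<cdot>\<^sub>v u"] by simp
  also have "\<dots> = u + (b - a) \<cdot>\<^sub>v (a.R *\<^sub>v u)"
    using a.R_cancel[OF u] mult_mat_vec[OF a.R_carrier u] by simp
  finally have "a.R *\<^sub>v v = u + (b - a) \<cdot>\<^sub>v (a.R *\<^sub>v u)" .
  moreover have "x = u + y \<Longrightarrow> x - u = y" if "y \<in> carrier_vec p" for x y :: "real vec"
    using u that by (intro eq_vecI) auto
  ultimately show ?thesis unfolding u_def[symmetric] using a.R_vec[OF u] by simp
qed

text \<open>On each basis vector \<open>e\<close> the resolvent identity leaves a scalar product of
  \<open>R_a e\<close> and \<open>R_b (T e)\<close>, of sizes at most \<open>1 / a\<close> and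
  \<open>t / b\<close>. For shifts and \<open>p\<close> of order \<open>n\<close> the weighted trace
  thus has Lipschitz constant \<open>O(1/n)\<close>.\<close>

lemma resolvent_trace_lipschitz:
  assumes A: "psd p A" and ab: "a > 0" "b > 0" and T: "T \<in> carrier_mat p p" and t: "0 \<le> t"
    and Tn: "\<And>v. v \<in> carrier_vec p \<Longrightarrow> (T *\<^sub>v v) \<bullet> (T *\<^sub>v v) \<le> t\<^sup>2 * (v \<bullet> v)"
  shows "\<bar>mtrace (resolvent p A a * T) - mtrace (resolvent p A b * T)\<bar> \<le> \<bar>a - b\<bar> * (real p * t / (a * b))"
proof -
  interpret a: psd_resolvent p A a by unfold_locales fact+
  interpret b: psd_resolvent p A b by unfold_locales fact+
  have "\<bar>unit_vec p i \<bullet> ((a.R * T) *\<^sub>v unit_vec p i) - unit_vec p i \<bullet> ((b.R * T) *\<^sub>v unit_vec p i)\<bar>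
      \<le> \<bar>a - b\<bar> * (t / (a * b))" if i: "i < p" for i
  proof -
    define e :: "real vec" where "e = unit_vec p i"
    have e: "e \<in> carrier_vec p" and ee: "e \<bullet> e = 1" using i by (auto simp: e_def)
    have Te: "T *\<^sub>v e \<in> carrier_vec p" using T e by simp
    have bTe: "b.R *\<^sub>v (T *\<^sub>v e) \<in> carrier_vec p" using b.R_vec[OF Te] .
    have abTe: "a.R *\<^sub>v (b.R *\<^sub>v (T *\<^sub>v e)) \<in> carrier_vec p" using a.R_vec[OF bTe] .
    have aTe: "a.R *\<^sub>v (T *\<^sub>v e) \<in> carrier_vec p" using a.R_vec[OF Te] .
    have ae: "a.R *\<^sub>v e \<in> carrier_vec p" using a.R_vec[OF e] .
    have "e \<bullet> ((a.R * T) *\<^sub>v e) - e \<bullet> ((b.R * T) *\<^sub>v e) = e \<bullet> (a.R *\<^sub>v (T *\<^sub>v e) - b.R *\<^sub>v (T *\<^sub>v e))"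
      unfolding assoc_mult_mat_vec[OF a.R_carrier T e] assoc_mult_mat_vec[OF b.R_carrier T e]
      by (rule scalar_prod_minus_distrib[OF e aTe bTe, symmetric])
    also have "\<dots> = (b - a) * (e \<bullet> (a.R *\<^sub>v (b.R *\<^sub>v (T *\<^sub>v e))))"
      unfolding resolvent_identity[OF A ab Te] by (rule scalar_prod_smult_distrib[OF e abTe])
    also have "e \<bullet> (a.R *\<^sub>v (b.R *\<^sub>v (T *\<^sub>v e))) = (a.R *\<^sub>v e) \<bullet> (b.R *\<^sub>v (T *\<^sub>v e))"
      by (rule sym_sprod[OF a.R_carrier a.R_sym e bTe])
    finally have eq: "e \<bullet> ((a.R * T) *\<^sub>v e) - e \<bullet> ((b.R * T) *\<^sub>v e) = (b - a) * ((a.R *\<^sub>v e) \<bullet> (b.R *\<^sub>v (T *\<^sub>v e)))" .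
    have "(b.R *\<^sub>v (T *\<^sub>v e)) \<bullet> (b.R *\<^sub>v (T *\<^sub>v e)) \<le> (1 / b)\<^sup>2 * ((T *\<^sub>v e) \<bullet> (T *\<^sub>v e))"
      by (rule b.R_norm[OF Te])
    also have "\<dots> \<le> (1 / b)\<^sup>2 * t\<^sup>2" using Tn[OF e] ee by (intro mult_left_mono) auto
    finally have "(b.R *\<^sub>v (T *\<^sub>v e)) \<bullet> (b.R *\<^sub>v (T *\<^sub>v e)) \<le> (t / b)\<^sup>2" by (simp add: power_divide)
    then have "\<bar>(a.R *\<^sub>v e) \<bullet> (b.R *\<^sub>v (T *\<^sub>v e))\<bar> \<le> (1 / a) * (t / b)"
      using a.R_norm[OF e] ee ab t by (intro abs_sprod_le[OF ae bTe]) auto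
    then have "\<bar>b - a\<bar> * \<bar>(a.R *\<^sub>v e) \<bullet> (b.R *\<^sub>v (T *\<^sub>v e))\<bar> \<le> \<bar>b - a\<bar> * (t / (a * b))"
      by (intro mult_left_mono) auto
    then show ?thesis unfolding e_def[symmetric] eq by (simp add: abs_mult abs_minus_commute)
  qed
  then have "\<bar>\<Sum>i<p. unit_vec p i \<bullet> ((a.R * T) *\<^sub>v unit_vec p i) - unit_vec p i \<bullet> ((b.R * T) *\<^sub>v unit_vec p i)\<bar>
      \<le> (\<Sum>i<p. \<bar>a - b\<bar> * (t / (a * b)))"
    by (intro order_trans[OF sum_abs] sum_mono) auto
  then show ?thesis unfolding mtrace_unit[OF a.R_mult[OF T]] mtrace_unit[OF b.R_mult[OF T]]
    by (simp add: sum_subtractf mult_ac)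
qed

section \<open>Rank-one updates\<close>

definition outer :: "nat \<Rightarrow> real vec \<Rightarrow> real mat" where
  "outer p y = mat p p (\<lambda>(i, k). y $ i * y $ k)"

lemma outer_carrier [simp]: "outer p y \<in> carrier_mat p p"
  by (simp add: outer_def)

lemma outer_transpose [simp]: "transpose_mat (outer p y) = outer p y"
  by (intro eq_matI) (auto simp: outer_def)

lemma outer_mult_vec:
  assumes "y \<in> carrier_vec p" "v \<in> carrier_vec p"
  shows "outer p y *\<^sub>v v = (y \<bullet> v) \<cdot>\<^sub>v y"
  using assms by (intro eq_vecI) (auto simp: outer_def scalar_prod_def sum_distrib_left sum_distrib_right mult_ac
    intro!: sum.cong)

lemma psd_add_outer:
  assumes A: "psd p A" and y: "y \<in> carrier_vec p"
  shows "psd p (A + outer p y)"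
  unfolding psd_def
proof (intro conjI ballI)
  have Ac: "A \<in> carrier_mat p p" using A by (simp add: psd_def)
  show "A + outer p y \<in> carrier_mat p p" by simp
  show "transpose_mat (A + outer p y) = A + outer p y"
    using A transpose_add[OF Ac outer_carrier] by (simp add: psd_def)
  fix v :: "real vec" assume v: "v \<in> carrier_vec p"
  have "v \<bullet> ((A + outer p y) *\<^sub>v v) = v \<bullet> (A *\<^sub>v v) + v \<bullet> ((y \<bullet> v) \<cdot>\<^sub>v y)"
    using Ac v y by (simp add: add_mult_distrib_mat_vec[OF Ac outer_carrier v] outer_mult_vec scalar_prod_add_distrib[of _ p])
  also have "v \<bullet> ((y \<bullet> v) \<cdot>\<^sub>v y) = (y \<bullet> v)\<^sup>2"
    using v y comm_scalar_prod[OF v y] by (simp add: power2_eq_square)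
  finally show "0 \<le> v \<bullet> ((A + outer p y) *\<^sub>v v)" using A v by (simp add: psd_def)
qed

context psd_resolvent
begin

lemma rank_one_update:
  assumes y: "y \<in> carrier_vec p" and v: "v \<in> carrier_vec p"
  shows "resolvent p (A + outer p y) a *\<^sub>v v
    = R *\<^sub>v v - ((y \<bullet> (R *\<^sub>v v)) / (1 + y \<bullet> (R *\<^sub>v y))) \<cdot>\<^sub>v (R *\<^sub>v y)"
    and rank_one_update_self: "resolvent p (A + outer p y) a *\<^sub>v y
    = (1 / (1 + y \<bullet> (R *\<^sub>v y))) \<cdot>\<^sub>v (R *\<^sub>v y)"
proof -
  interpret B: psd_resolvent p "A + outer p y" a
    by unfold_locales (use psd_add_outer[OF A y] a in auto)
  have q: "1 + y \<bullet> (R *\<^sub>v y) > 0" using R_form_nonneg[OF y] by linarith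
  \<comment> \<open>The old resolvent is expressed through the new one: adding
    \<open>outer p y\<close> turns the equation for \<open>u = R x\<close> into one with right side
    \<open>x + (y . u) y\<close>. The case \<open>x = y\<close> then determines the new resolvent at
    \<open>y\<close>, and substitution gives the general formula.\<close>
  have *: "R *\<^sub>v x = B.R *\<^sub>v x + (y \<bullet> (R *\<^sub>v x)) \<cdot>\<^sub>v (B.R *\<^sub>v y)" if x: "x \<in> carrier_vec p" for x
  proof -
    define u where "u = R *\<^sub>v x"
    have u: "u \<in> carrier_vec p" using x by (simp add: u_def)
    have Au: "A *\<^sub>v u \<in> carrier_vec p" using Ac u by simp
    have "(A + outer p y) *\<^sub>v u + a \<cdot>\<^sub>v u = (A *\<^sub>v u + a \<cdot>\<^sub>v u) + (y \<bullet> u) \<cdot>\<^sub>v y"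
      unfolding add_mult_distrib_mat_vec[OF Ac outer_carrier u] outer_mult_vec[OF y u]
      using u y Au by (intro eq_vecI) auto
    also have "A *\<^sub>v u + a \<cdot>\<^sub>v u = x" unfolding u_def by (rule R_eq[OF x])
    finally have "u = B.R *\<^sub>v (x + (y \<bullet> u) \<cdot>\<^sub>v y)" using B.R_cancel[OF u] by simp
    also have "\<dots> = B.R *\<^sub>v x + (y \<bullet> u) \<cdot>\<^sub>v (B.R *\<^sub>v y)"
      using mult_add_distrib_mat_vec[OF B.R_carrier x, of "(y \<bullet> u) \<cdot>\<^sub>v y"] mult_mat_vec[OF B.R_carrier y] y by simp
    finally show ?thesis by (simp add: u_def)
  qed
  show self: "B.R *\<^sub>v y = (1 / (1 + y \<bullet> (R *\<^sub>v y))) \<cdot>\<^sub>v (R *\<^sub>v y)"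
  proof -
    have "R *\<^sub>v y = (1 + y \<bullet> (R *\<^sub>v y)) \<cdot>\<^sub>v (B.R *\<^sub>v y)"
      by (subst *[OF y]) (use B.R_vec[OF y] in \<open>auto simp: algebra_simps intro!: eq_vecI\<close>)
    then have "(1 / (1 + y \<bullet> (R *\<^sub>v y))) \<cdot>\<^sub>v (R *\<^sub>v y)
      = (1 / (1 + y \<bullet> (R *\<^sub>v y))) \<cdot>\<^sub>v ((1 + y \<bullet> (R *\<^sub>v y)) \<cdot>\<^sub>v (B.R *\<^sub>v y))" by simp
    also have "\<dots> = B.R *\<^sub>v y" unfolding smult_smult_assoc using q by simp
    finally show ?thesis by simp
  qed
  have "x = z + w \<Longrightarrow> z = x - w" if "w \<in> carrier_vec p" "z \<in> carrier_vec p" for x z w :: "real vec"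
    using that by (intro eq_vecI) auto
  from this[OF _ _ *[OF v]] show "B.R *\<^sub>v v = R *\<^sub>v v - ((y \<bullet> (R *\<^sub>v v)) / (1 + y \<bullet> (R *\<^sub>v y))) \<cdot>\<^sub>v (R *\<^sub>v y)"
    using B.R_vec[OF v] R_vec[OF y] by (simp add: self smult_smult_assoc)
qed

text \<open>Symmetry of \<open>R\<close> and \<open>T\<close> turns \<open>y . R (T e)\<close> for
  the i-th basis vector \<open>e\<close> into the i-th entry of \<open>T (R y)\<close>, so the
  diagonal corrections of Sherman-Morrison sum to a single quadratic form in
  \<open>R y\<close>.\<close>

lemma rank_one_trace:
  assumes y: "y \<in> carrier_vec p" and T: "T \<in> carrier_mat p p" "transpose_mat T = T"
  shows "mtrace (R * T) - mtrace (resolvent p (A + outer p y) a * T)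
    = ((R *\<^sub>v y) \<bullet> (T *\<^sub>v (R *\<^sub>v y))) / (1 + y \<bullet> (R *\<^sub>v y))"
proof -
  interpret B: psd_resolvent p "A + outer p y" a
    by unfold_locales (use psd_add_outer[OF A y] a in auto)
  define w where "w = R *\<^sub>v y"
  have w: "w \<in> carrier_vec p" using y by (simp add: w_def)
  have Tw: "T *\<^sub>v w \<in> carrier_vec p" using T(1) w by (rule mult_mat_vec_carrier)
  have "unit_vec p i \<bullet> ((R * T) *\<^sub>v unit_vec p i) - unit_vec p i \<bullet> ((B.R * T) *\<^sub>v unit_vec p i)
     = (w $ i * (T *\<^sub>v w) $ i) / (1 + y \<bullet> w)" if i: "i < p" for i
  proof -
    define e :: "real vec" where "e = unit_vec p i"
    have e: "e \<in> carrier_vec p" by (simp add: e_def)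
    have Te: "T *\<^sub>v e \<in> carrier_vec p" using T e by simp
    have "y \<bullet> (R *\<^sub>v (T *\<^sub>v e)) = w \<bullet> (T *\<^sub>v e)"
      unfolding w_def by (rule sym_sprod[OF R_carrier R_sym y Te])
    also have "\<dots> = (T *\<^sub>v w) \<bullet> e" by (rule sym_sprod[OF T w e])
    also have "\<dots> = (T *\<^sub>v w) $ i" using Tw i by (simp add: e_def)
    finally have 1: "y \<bullet> (R *\<^sub>v (T *\<^sub>v e)) = (T *\<^sub>v w) $ i" .
    have "e \<bullet> (B.R *\<^sub>v (T *\<^sub>v e)) = e \<bullet> (R *\<^sub>v (T *\<^sub>v e)) - e \<bullet> (((T *\<^sub>v w) $ i / (1 + y \<bullet> w)) \<cdot>\<^sub>v w)"
      unfolding rank_one_update[OF y Te] 1 w_def[symmetric]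
      using e R_vec[OF Te] w by (intro scalar_prod_minus_distrib) auto
    also have "e \<bullet> (((T *\<^sub>v w) $ i / (1 + y \<bullet> w)) \<cdot>\<^sub>v w) = ((T *\<^sub>v w) $ i / (1 + y \<bullet> w)) * w $ i"
      using scalar_prod_smult_distrib[OF e w] w i by (simp add: e_def)
    finally show ?thesis
      unfolding assoc_mult_mat_vec[OF R_carrier T(1) e] assoc_mult_mat_vec[OF B.R_carrier T(1) e] e_def[symmetric]
      by simp
  qed
  then have "(\<Sum>i<p. unit_vec p i \<bullet> ((R * T) *\<^sub>v unit_vec p i) - unit_vec p i \<bullet> ((B.R * T) *\<^sub>v unit_vec p i))
     = (\<Sum>i<p. (w $ i * (T *\<^sub>v w) $ i) / (1 + y \<bullet> w))"
    by (intro sum.cong) auto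
  also have "\<dots> = (w \<bullet> (T *\<^sub>v w)) / (1 + y \<bullet> w)"
    using carrier_vecD[OF Tw] by (simp add: scalar_prod_def sum_divide_distrib atLeast0LessThan)
  finally show ?thesis
    unfolding mtrace_unit[OF R_mult[OF T(1)]] mtrace_unit[OF B.R_mult[OF T(1)]] w_def[symmetric]
    by (simp add: sum_subtractf)
qed

text \<open>Since \<open>|w . T w| \<le> t |w|^2 \<le> (t / a) (y . w)\<close> for
  \<open>w = R y\<close>, the numerator is absorbed by the denominator \<open>1 + y . w\<close>, and
  the length of \<open>y\<close> drops out.\<close>

lemma rank_one_trace_abs_le:
  assumes y: "y \<in> carrier_vec p" and T: "T \<in> carrier_mat p p" "transpose_mat T = T" and t: "0 \<le> t"
    and Tn: "\<And>v. v \<in> carrier_vec p \<Longrightarrow> (T *\<^sub>v v) \<bullet> (T *\<^sub>v v) \<le> t\<^sup>2 * (v \<bullet> v)"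
  shows "\<bar>mtrace (R * T) - mtrace (resolvent p (A + outer p y) a * T)\<bar> \<le> t / a"
proof -
  define w where "w = R *\<^sub>v y"
  have w: "w \<in> carrier_vec p" using y by (simp add: w_def)
  have Tw: "T *\<^sub>v w \<in> carrier_vec p" using T(1) w by (rule mult_mat_vec_carrier)
  have q: "0 \<le> y \<bullet> w" unfolding w_def by (rule R_form_nonneg[OF y])
  have ww: "0 \<le> w \<bullet> w" by (rule sprod_self_nonneg)
  have "\<bar>w \<bullet> (T *\<^sub>v w)\<bar> \<le> sqrt (w \<bullet> w) * (t * sqrt (w \<bullet> w))"
    using Tn[OF w] t ww by (intro abs_sprod_le[OF w Tw]) (auto simp: power_mult_distrib)
  also have "\<dots> = t * (w \<bullet> w)" using ww by (simp add: mult.left_commute)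
  also have "\<dots> \<le> t * ((y \<bullet> w) / a)"
    using R_form_ge[OF y] a t by (intro mult_left_mono) (auto simp: w_def field_simps)
  also have "\<dots> = (t / a) * (y \<bullet> w)" by simp
  also have "\<dots> \<le> (t / a) * (1 + y \<bullet> w)" using t a by (intro mult_left_mono) auto
  finally show ?thesis
    unfolding rank_one_trace[OF y T] w_def[symmetric] using q by (simp add: abs_divide divide_le_eq)
qed

end

lemma id_norm_bound: "v \<in> carrier_vec p \<Longrightarrow> (1\<^sub>m p *\<^sub>v v) \<bullet> (1\<^sub>m p *\<^sub>v v) \<le> 1\<^sup>2 * (v \<bullet> (v :: real vec))"
  by simp

text \<open>For \<open>m = n - 1\<close>, \<open>aS - astar = stein_gap / D - (2 * c0 + 1)\<close> with \<open>D = tr (V * V * W)\<close>.\<close>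

definition stein_gap :: "nat \<Rightarrow> real \<Rightarrow> real mat \<Rightarrow> real mat \<Rightarrow> real \<Rightarrow> real" where
  "stein_gap p m T A a = (m - real p) * mtrace (resolvent p A a) + a * (mtrace (resolvent p A a))\<^sup>2
     - (mtrace T - a * mtrace (resolvent p A a * T))"

text \<open>\<open>T\<close> stands for the inverse covariance, with \<open>t = 1 / c1\<close>. The
  estimates in this locale are deterministic, so they hold on every sample path.\<close>

locale norm_bounded =
  fixes p :: nat and T :: "real mat" and t :: real
  assumes T: "T \<in> carrier_mat p p" "transpose_mat T = T" and t: "0 \<le> t"
    and Tn: "\<And>v. v \<in> carrier_vec p \<Longrightarrow> (T *\<^sub>v v) \<bullet> (T *\<^sub>v v) \<le> t\<^sup>2 * (v \<bullet> v)"
begin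

text \<open>The quadratic term factors as \<open>a (v + v') (v - v')\<close>, where
  \<open>a (v + v') \<le> 2 p\<close>; the plain trace moves by at most \<open>1 / a\<close>, the
  weighted one by at most \<open>t / a\<close>. For \<open>a\<close>, \<open>m\<close> and
  \<open>p\<close> of order \<open>n\<close> the whole bound is \<open>O(1)\<close>.\<close>

lemma stein_gap_rank_one:
  assumes A: "psd p A" and a: "a > 0" and y: "y \<in> carrier_vec p"
  shows "\<bar>stein_gap p m T A a - stein_gap p m T (A + outer p y) a\<bar> \<le> (\<bar>m - real p\<bar> + 2 * real p) / a + t"
proof -
  interpret A: psd_resolvent p A a by unfold_locales fact+
  interpret B: psd_resolvent p "A + outer p y" a
    by unfold_locales (use psd_add_outer[OF A y] a in auto)
  define v v' where "v = mtrace A.R" and "v' = mtrace B.R"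
  define w w' where "w = mtrace (A.R * T)" and "w' = mtrace (B.R * T)"
  have v: "\<bar>v - v'\<bar> \<le> 1 / a"
    using A.rank_one_trace_abs_le[OF y _ _ _ id_norm_bound[where p = p]]
      right_mult_one_mat[OF A.R_carrier] right_mult_one_mat[OF B.R_carrier] by (simp add: v_def v'_def)
  have w: "\<bar>w - w'\<bar> \<le> t / a" unfolding w_def w'_def by (rule A.rank_one_trace_abs_le[OF y T t Tn])
  have vb: "0 \<le> v" "v \<le> p / a" "0 \<le> v'" "v' \<le> p / a"
    unfolding v_def v'_def by (rule A.mtrace_R_nonneg A.mtrace_R_le B.mtrace_R_nonneg B.mtrace_R_le)+
  have "stein_gap p m T A a - stein_gap p m T (A + outer p y) a
    = (m - p) * (v - v') + a * (v + v') * (v - v') + a * (w - w')"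
    unfolding stein_gap_def v_def[symmetric] v'_def[symmetric] w_def[symmetric] w'_def[symmetric]
    by (simp add: power2_eq_square algebra_simps)
  also have "\<bar>\<dots>\<bar> \<le> \<bar>m - p\<bar> * \<bar>v - v'\<bar> + (a * (v + v')) * \<bar>v - v'\<bar> + a * \<bar>w - w'\<bar>"
    using a vb by (intro order_trans[OF abs_triangle_ineq] add_mono) (auto simp: abs_mult)
  also have "\<dots> \<le> \<bar>m - p\<bar> * (1 / a) + (2 * p) * (1 / a) + a * (t / a)"
    using a vb v w by (intro add_mono mult_mono mult_left_mono) (auto simp: field_simps)
  finally show ?thesis using a by (simp add: add_divide_distrib)
qed

text \<open>Since \<open>A\<close> is arbitrary, the bound may be used with a shift computed from
  \<open>A\<close> itself; the bracket stays bounded as long as \<open>m\<close>, \<open>p\<close>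
  and \<open>d\<close> grow at the same rate.\<close>

lemma stein_gap_lipschitz:
  assumes A: "psd p A" and d: "d > 0" and a: "d \<le> a" and b: "d \<le> b"
  shows "\<bar>stein_gap p m T A a - stein_gap p m T A b\<bar>
    \<le> \<bar>a - b\<bar> * (\<bar>m - real p\<bar> * real p / d\<^sup>2 + 3 * (real p)\<^sup>2 / d\<^sup>2 + 2 * real p * t / d)"
proof -
  have ab: "a > 0" "b > 0" using a b d by auto
  interpret a: psd_resolvent p A a by unfold_locales (use A ab in auto)
  interpret b: psd_resolvent p A b by unfold_locales (use A ab in auto)
  define v v' where "v = mtrace a.R" and "v' = mtrace b.R"
  define w w' where "w = mtrace (a.R * T)" and "w' = mtrace (b.R * T)"
  define h where "h = \<bar>a - b\<bar>"
  have h: "0 \<le> h" by (simp add: h_def)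
  have dab: "d\<^sup>2 \<le> a * b" using a b d unfolding power2_eq_square by (intro mult_mono) auto
  have v: "\<bar>v - v'\<bar> \<le> h * (p / (a * b))"
    using resolvent_trace_lipschitz[OF A ab _ _ id_norm_bound[where p = p]]
      right_mult_one_mat[OF a.R_carrier] right_mult_one_mat[OF b.R_carrier] by (simp add: v_def v'_def h_def)
  have "h * (p / (a * b)) \<le> h * (p / d\<^sup>2)"
    using h dab d ab by (intro mult_left_mono divide_left_mono) auto
  then have v1: "\<bar>v - v'\<bar> \<le> h * (p / d\<^sup>2)" using v by linarith
  \<comment> \<open>The factor \<open>b\<close> cancels against \<open>1 / (a * b)\<close>, so the
    estimate needs the shifts only from below.\<close>
  have v2: "b * \<bar>v - v'\<bar> \<le> h * (p / d)"
  proof -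
    have "b * \<bar>v - v'\<bar> \<le> b * (h * (p / (a * b)))" using v ab by (intro mult_left_mono) auto
    also have "\<dots> = h * (p / a)" using ab by simp
    also have "\<dots> \<le> h * (p / d)" using h a d ab by (intro mult_left_mono divide_left_mono) auto
    finally show ?thesis .
  qed
  have vb: "0 \<le> v" "v \<le> p / d" "0 \<le> v'" "v' \<le> p / d" "b * v' \<le> p"
  proof -
    show "0 \<le> v" "0 \<le> v'" unfolding v_def v'_def by (rule a.mtrace_R_nonneg b.mtrace_R_nonneg)+
    have "p / a \<le> p / d" "p / b \<le> p / d" using a b d by (auto intro!: divide_left_mono)
    then show "v \<le> p / d" "v' \<le> p / d" using a.mtrace_R_le b.mtrace_R_le by (auto simp: v_def v'_def)
    show "b * v' \<le> p" using b.mtrace_R_le ab by (simp add: v'_def field_simps)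
  qed
  have w: "\<bar>w - w'\<bar> \<le> h * (p * t / (a * b))"
    unfolding w_def w'_def h_def by (rule resolvent_trace_lipschitz[OF A ab T(1) t Tn])
  have w2: "b * \<bar>w - w'\<bar> \<le> h * (p * t / d)"
  proof -
    have "b * \<bar>w - w'\<bar> \<le> b * (h * (p * t / (a * b)))" using w ab by (intro mult_left_mono) auto
    also have "\<dots> = h * (p * t / a)" using ab by simp
    also have "\<dots> \<le> h * (p * t / d)" using h a d ab t by (intro mult_left_mono divide_left_mono) auto
    finally show ?thesis .
  qed
  have wb: "\<bar>w\<bar> \<le> p * t / d"
  proof -
    have "\<bar>w\<bar> \<le> p * (t / a)" unfolding w_def by (rule a.mtrace_RT_abs_le[OF T(1) t Tn])
    also have "\<dots> \<le> p * (t / d)" using a d ab t by (intro mult_left_mono divide_left_mono) auto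
    finally show ?thesis by simp
  qed
  \<comment> \<open>The products \<open>a v^2\<close> and \<open>a w\<close> are telescoped by
    changing one factor at a time.\<close>
  have "stein_gap p m T A a - stein_gap p m T A b
    = (m - p) * (v - v') + ((a - b) * v * v + b * (v - v') * v + b * v' * (v - v'))
      + ((a - b) * w + b * (w - w'))"
    unfolding stein_gap_def v_def[symmetric] v'_def[symmetric] w_def[symmetric] w'_def[symmetric]
    by (simp add: power2_eq_square algebra_simps)
  also have "\<bar>\<dots>\<bar> \<le> \<bar>m - p\<bar> * \<bar>v - v'\<bar> + (h * (v * v) + (b * \<bar>v - v'\<bar>) * v + (b * v') * \<bar>v - v'\<bar>)
      + (h * \<bar>w\<bar> + b * \<bar>w - w'\<bar>)"
    using ab vb by (intro order_trans[OF abs_triangle_ineq] add_mono) (auto simp: abs_mult h_def)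
  also have "\<dots> \<le> \<bar>m - p\<bar> * (h * (p / d\<^sup>2)) + (h * ((p / d) * (p / d)) + (h * (p / d)) * (p / d) + p * (h * (p / d\<^sup>2)))
      + (h * (p * t / d) + h * (p * t / d))"
  proof (intro add_mono)
    show "\<bar>m - p\<bar> * \<bar>v - v'\<bar> \<le> \<bar>m - p\<bar> * (h * (p / d\<^sup>2))" by (intro mult_left_mono v1) simp
    show "h * (v * v) \<le> h * ((p / d) * (p / d))"
      using vb d by (intro mult_left_mono mult_mono h) auto
    show "(b * \<bar>v - v'\<bar>) * v \<le> (h * (p / d)) * (p / d)"
      using vb d h by (intro mult_mono v2) auto
    show "(b * v') * \<bar>v - v'\<bar> \<le> p * (h * (p / d\<^sup>2))"
      by (intro mult_mono v1 vb) auto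
    show "h * \<bar>w\<bar> \<le> h * (p * t / d)" by (intro mult_left_mono wb h)
  qed (rule w2)
  also have "\<dots> = h * (\<bar>m - p\<bar> * p / d\<^sup>2 + 3 * (real p)\<^sup>2 / d\<^sup>2 + 2 * p * t / d)"
    by (simp add: power2_eq_square algebra_simps)
  finally show ?thesis by (simp add: h_def)
qed

end

section \<open>Leaving one column out of a Gram matrix\<close>

text \<open>Columns are indexed by a set and given as functions, so that leaving out column
  \<open>j\<close> is \<open>I - {j}\<close> and a point of the product space \<open>PiM I N\<close>
  can be used as the sample directly.\<close>

definition gram :: "nat \<Rightarrow> nat set \<Rightarrow> (nat \<Rightarrow> nat \<Rightarrow> real) \<Rightarrow> real mat" where
  "gram p I x = mat p p (\<lambda>(i, k). \<Sum>j\<in>I. x j i * x j k)"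

lemma gram_carrier [simp]: "gram p I x \<in> carrier_mat p p"
  by (simp add: gram_def)

lemma gram_cong: "(\<And>j i. j \<in> I \<Longrightarrow> i < p \<Longrightarrow> x j i = z j i) \<Longrightarrow> gram p I x = gram p I z"
  unfolding gram_def by (intro eq_matI) auto

lemma gram_insert:
  assumes "finite I" "j \<notin> I"
  shows "gram p (insert j I) x = gram p I x + outer p (vec p (x j))"
  using assms by (intro eq_matI) (auto simp: gram_def outer_def)

lemma gram_remove:
  assumes "finite I" "j \<in> I"
  shows "gram p I x = gram p (I - {j}) x + outer p (vec p (x j))"
  using gram_insert[of "I - {j}" j p x] assms by (simp add: insert_absorb)

lemma gram_psd: "finite I \<Longrightarrow> psd p (gram p I x)"
proof (induction I rule: finite_induct)
  case empty
  have "gram p {} x *\<^sub>v v = 0\<^sub>v p" if "v \<in> carrier_vec p" for v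
    using that by (intro eq_vecI) (auto simp: gram_def scalar_prod_def)
  moreover have "transpose_mat (gram p {} x) = gram p {} x" by (intro eq_matI) (auto simp: gram_def)
  ultimately show ?case by (auto simp: psd_def)
next
  case (insert j I)
  then show ?case unfolding gram_insert[OF insert(1,2)] by (intro psd_add_outer) auto
qed

lemma mtrace_gram_mult:
  assumes B: "B \<in> carrier_mat p p"
  shows "mtrace (gram p I x * B) = (\<Sum>j\<in>I. vec p (x j) \<bullet> (B *\<^sub>v vec p (x j)))"
proof -
  have "mtrace (gram p I x * B) = (\<Sum>i<p. \<Sum>k<p. (\<Sum>j\<in>I. x j i * x j k) * B $$ (k, i))"
    using B by (simp add: mtrace_def gram_def scalar_prod_def atLeast0LessThan)
  also have "\<dots> = (\<Sum>i<p. \<Sum>k<p. \<Sum>j\<in>I. x j k * (B $$ (k, i) * x j i))"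
    by (simp add: sum_distrib_left sum_distrib_right mult_ac)
  also have "\<dots> = (\<Sum>k<p. \<Sum>i<p. \<Sum>j\<in>I. x j k * (B $$ (k, i) * x j i))" by (rule sum.swap)
  also have "\<dots> = (\<Sum>k<p. \<Sum>j\<in>I. \<Sum>i<p. x j k * (B $$ (k, i) * x j i))"
    by (intro sum.cong refl sum.swap)
  also have "\<dots> = (\<Sum>j\<in>I. \<Sum>k<p. \<Sum>i<p. x j k * (B $$ (k, i) * x j i))" by (rule sum.swap)
  also have "\<dots> = (\<Sum>j\<in>I. vec p (x j) \<bullet> (B *\<^sub>v vec p (x j)))"
    using B by (simp add: scalar_prod_def atLeast0LessThan sum_distrib_left)
  finally show ?thesis .
qed

lemma mtrace_gram: "mtrace (gram p I x) = (\<Sum>j\<in>I. vec p (x j) \<bullet> vec p (x j))"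
  using mtrace_gram_mult[of "1\<^sub>m p" p I x] right_mult_one_mat[OF gram_carrier] by simp

lemma mtrace_mult_commute:
  assumes "A \<in> carrier_mat p q" "B \<in> carrier_mat q p"
  shows "mtrace (A * B) = mtrace (B * A)"
proof -
  have "mtrace (A * B) = (\<Sum>i<p. \<Sum>k<q. A $$ (i, k) * B $$ (k, i))"
    using assms by (simp add: mtrace_def scalar_prod_def atLeast0LessThan)
  also have "\<dots> = (\<Sum>k<q. \<Sum>i<p. B $$ (k, i) * A $$ (i, k))"
    by (subst sum.swap) (simp add: mult_ac)
  also have "\<dots> = mtrace (B * A)"
    using assms by (simp add: mtrace_def scalar_prod_def atLeast0LessThan)
  finally show ?thesis .
qed

lemma mtrace_add: "A \<in> carrier_mat p p \<Longrightarrow> B \<in> carrier_mat p p \<Longrightarrow> mtrace (A + B) = mtrace A + mtrace B"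
  by (simp add: mtrace_def sum.distrib)

lemma mtrace_smult: "A \<in> carrier_mat p p \<Longrightarrow> mtrace (c \<cdot>\<^sub>m A) = c * mtrace A"
  by (simp add: mtrace_def sum_distrib_left)

lemma mtrace_one: "mtrace (1\<^sub>m p) = real p"
  by (simp add: mtrace_def)

context psd_resolvent
begin

text \<open>From \<open>(A + a) R = 1\<close> one has \<open>A R = 1 - a R\<close>. For a Gram
  matrix this converts the deficits \<open>p - a tr V\<close> and \<open>tr T - a tr (V T)\<close>
  into sums over columns.\<close>

lemma mtrace_mult_R:
  assumes T: "T \<in> carrier_mat p p"
  shows "mtrace (A * (R * T)) = mtrace T - a * mtrace (R * T)"
proof -
  have "T = ((A + a \<cdot>\<^sub>m 1\<^sub>m p) * R) * T" using R_right T by simp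
  also have "\<dots> = (A + a \<cdot>\<^sub>m 1\<^sub>m p) * (R * T)"
    using Ac T by (intro assoc_mult_mat[of _ p p _ p _ p]) auto
  also have "\<dots> = A * (R * T) + (a \<cdot>\<^sub>m 1\<^sub>m p) * (R * T)"
    using Ac R_mult[OF T] by (intro add_mult_distrib_mat[of _ p p _ _ p]) auto
  also have "(a \<cdot>\<^sub>m 1\<^sub>m p) * (R * T) = a \<cdot>\<^sub>m (R * T)"
    using mult_smult_assoc_mat[of "1\<^sub>m p" p p "R * T" p a] R_mult[OF T]
      left_mult_one_mat[OF R_mult[OF T]] by simp
  finally have "mtrace T = mtrace (A * (R * T) + a \<cdot>\<^sub>m (R * T))" by simp
  also have "\<dots> = mtrace (A * (R * T)) + a * mtrace (R * T)"
    using Ac R_mult[OF T] by (simp add: mtrace_add[of _ p] mtrace_smult[of _ p])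
  finally show ?thesis by simp
qed

end

context norm_bounded
begin

context
  fixes I :: "nat set" and x :: "nat \<Rightarrow> nat \<Rightarrow> real" and a :: real
  assumes I: "finite I" and a: "a > 0"
begin

interpretation W: psd_resolvent p "gram p I x" a
  by unfold_locales (use gram_psd[OF I] a in auto)

abbreviation (input) "y j \<equiv> vec p (x j)"
abbreviation (input) "V \<equiv> resolvent p (gram p I x) a"
abbreviation (input) "V' j \<equiv> resolvent p (gram p (I - {j}) x) a"

lemma trace_deficit: "real p - a * mtrace V = (\<Sum>j\<in>I. y j \<bullet> (V *\<^sub>v y j))"
  using W.mtrace_mult_R[of "1\<^sub>m p"] right_mult_one_mat[OF W.R_carrier]
  by (simp add: mtrace_one mtrace_gram_mult)

lemma weighted_trace_deficit:
  "mtrace T - a * mtrace (V * T) = (\<Sum>j\<in>I. (V *\<^sub>v y j) \<bullet> (T *\<^sub>v y j))"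
proof -
  have "mtrace T - a * mtrace (V * T) = (\<Sum>j\<in>I. y j \<bullet> ((V * T) *\<^sub>v y j))"
    using W.mtrace_mult_R[OF T(1)] mtrace_gram_mult[OF W.R_mult[OF T(1)], of I x] by simp
  also have "\<dots> = (\<Sum>j\<in>I. (V *\<^sub>v y j) \<bullet> (T *\<^sub>v y j))"
  proof (intro sum.cong refl)
    fix j
    show "y j \<bullet> ((V * T) *\<^sub>v y j) = (V *\<^sub>v y j) \<bullet> (T *\<^sub>v y j)"
      using T(1) sym_sprod[OF W.R_carrier W.R_sym, of "y j" "T *\<^sub>v y j"]
      by (simp add: assoc_mult_mat_vec[OF W.R_carrier T(1)])
  qed
  finally show ?thesis .
qed

text \<open>The self-update gives \<open>y j . V y j = q j / (1 + q j)\<close>, so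
  \<open>m - (p - a tr V)\<close> is the sum of the \<open>1 / (1 + q j)\<close> and the gap becomes
  one sum over columns. Each denominator is at least \<open>1\<close>, and replacing
  \<open>tr V\<close> by \<open>tr (V' j)\<close>, which does not see column \<open>j\<close>, costs
  \<open>1 / a\<close> per column, whence \<open>card I / a\<close>.\<close>

lemma stein_gap_leave_one_out:
  "\<bar>stein_gap p (card I) T (gram p I x) a\<bar>
    \<le> card I / a + (\<Sum>j\<in>I. \<bar>mtrace (V' j) - (V' j *\<^sub>v y j) \<bullet> (T *\<^sub>v y j)\<bar>)"
proof -
  define v where "v = mtrace V"
  define q where "q j = y j \<bullet> (V' j *\<^sub>v y j)" for j
  define r where "r j = (V' j *\<^sub>v y j) \<bullet> (T *\<^sub>v y j)" for j
  have loo: "V *\<^sub>v y j = (1 / (1 + q j)) \<cdot>\<^sub>v (V' j *\<^sub>v y j)" "0 \<le> q j" "V' j *\<^sub>v y j \<in> carrier_vec p"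
    "\<bar>v - mtrace (V' j)\<bar> \<le> 1 / a" if j: "j \<in> I" for j
  proof -
    interpret Wj: psd_resolvent p "gram p (I - {j}) x" a
      by unfold_locales (use gram_psd[of "I - {j}"] I a in auto)
    have gr: "gram p I x = gram p (I - {j}) x + outer p (y j)" by (rule gram_remove[OF I j])
    show "V *\<^sub>v y j = (1 / (1 + q j)) \<cdot>\<^sub>v (V' j *\<^sub>v y j)"
      unfolding gr q_def by (rule Wj.rank_one_update_self[of "y j" "y j"]) auto
    show "0 \<le> q j" unfolding q_def by (rule Wj.R_form_nonneg[of "y j"]) auto
    show "V' j *\<^sub>v y j \<in> carrier_vec p" by simp
    show "\<bar>v - mtrace (V' j)\<bar> \<le> 1 / a"
      using Wj.rank_one_trace_abs_le[of "y j" "1\<^sub>m p" 1]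
        right_mult_one_mat[OF Wj.R_carrier] right_mult_one_mat[OF W.R_carrier]
      by (simp add: v_def gr abs_minus_commute)
  qed
  have yV: "y j \<bullet> (V *\<^sub>v y j) = q j / (1 + q j)" if j: "j \<in> I" for j
    unfolding loo(1)[OF j] using scalar_prod_smult_distrib[OF _ loo(3)[OF j], of "y j"] by (simp add: q_def)
  have VT: "(V *\<^sub>v y j) \<bullet> (T *\<^sub>v y j) = r j / (1 + q j)" if j: "j \<in> I" for j
    unfolding loo(1)[OF j] using smult_scalar_prod_distrib[OF loo(3)[OF j], of "T *\<^sub>v y j"] T(1) by (simp add: r_def)
  have "stein_gap p (card I) T (gram p I x) a = (card I - (real p - a * v)) * v - (mtrace T - a * mtrace (V * T))"
    by (simp add: stein_gap_def v_def power2_eq_square algebra_simps)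
  also have "\<dots> = (\<Sum>j\<in>I. (1 - q j / (1 + q j)) * v) - (\<Sum>j\<in>I. r j / (1 + q j))"
  proof -
    have "real p - a * v = (\<Sum>j\<in>I. q j / (1 + q j))"
      unfolding v_def trace_deficit using yV by (intro sum.cong refl)
    moreover have "mtrace T - a * mtrace (V * T) = (\<Sum>j\<in>I. r j / (1 + q j))"
      unfolding weighted_trace_deficit using VT by (intro sum.cong refl)
    ultimately show ?thesis by (simp only: sum_distrib_right[symmetric] sum_subtractf) simp
  qed
  also have "\<dots> = (\<Sum>j\<in>I. (v - r j) / (1 + q j))"
    unfolding sum_subtractf[symmetric]
  proof (intro sum.cong refl)
    fix j assume "j \<in> I"
    then have "1 + q j > 0" using loo(2) by force
    then have "1 - q j / (1 + q j) = 1 / (1 + q j)" by (simp add: divide_simps)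
    then show "(1 - q j / (1 + q j)) * v - r j / (1 + q j) = (v - r j) / (1 + q j)"
      by (simp add: diff_divide_distrib)
  qed
  also have "\<bar>\<dots>\<bar> \<le> (\<Sum>j\<in>I. \<bar>(v - r j) / (1 + q j)\<bar>)" by (rule sum_abs)
  also have "\<dots> \<le> (\<Sum>j\<in>I. 1 / a + \<bar>mtrace (V' j) - r j\<bar>)"
  proof (intro sum_mono)
    fix j assume j: "j \<in> I"
    have "\<bar>(v - r j) / (1 + q j)\<bar> \<le> \<bar>v - r j\<bar> / 1"
      using loo(2)[OF j] unfolding abs_divide by (intro divide_left_mono) auto
    then have "\<bar>(v - r j) / (1 + q j)\<bar> \<le> \<bar>v - r j\<bar>" by simp
    then show "\<bar>(v - r j) / (1 + q j)\<bar> \<le> 1 / a + \<bar>mtrace (V' j) - r j\<bar>"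
      using loo(4)[OF j] by linarith
  qed
  finally show ?thesis by (simp add: r_def sum.distrib)
qed

text \<open>The trace of \<open>V * V * W\<close> is the sum of \<open>|V y j|^2\<close> and, up to
  normalization, the coefficient of the squared multiplier in the loss, hence the name.
  Cauchy-Schwarz over the columns bounds \<open>P\<close> by \<open>S\<close> and \<open>Q\<close>
  by \<open>t S\<close>; solving gap \<open>= (m - P) (p - P) / a - Q\<close> for
  \<open>m p / a\<close> and dropping \<open>- P^2 / a\<close> gives the first claim.\<close>

lemma loss_curvature_lower:
  defines "S \<equiv> sqrt (mtrace (V * V * gram p I x) * mtrace (gram p I x))"
  shows "card I * real p / a \<le> \<bar>stein_gap p (card I) T (gram p I x) a\<bar> + S * ((card I + real p) / a + t)"
    and "0 \<le> mtrace (V * V * gram p I x)"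
proof -
  define P where "P = real p - a * mtrace V"
  define Q where "Q = mtrace T - a * mtrace (V * T)"
  have Vy: "V *\<^sub>v y j \<in> carrier_vec p" for j by simp
  have D: "mtrace (V * V * gram p I x) = (\<Sum>j\<in>I. (V *\<^sub>v y j) \<bullet> (V *\<^sub>v y j))"
  proof -
    have "mtrace (V * V * gram p I x) = mtrace (gram p I x * (V * V))"
      by (rule mtrace_mult_commute[of _ p p]) auto
    also have "\<dots> = (\<Sum>j\<in>I. y j \<bullet> ((V * V) *\<^sub>v y j))" by (rule mtrace_gram_mult) auto
    also have "\<dots> = (\<Sum>j\<in>I. (V *\<^sub>v y j) \<bullet> (V *\<^sub>v y j))"
    proof (intro sum.cong refl)
      fix j
      show "y j \<bullet> ((V * V) *\<^sub>v y j) = (V *\<^sub>v y j) \<bullet> (V *\<^sub>v y j)"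
        using sym_sprod[OF W.R_carrier W.R_sym, of "y j" "V *\<^sub>v y j"] Vy
        by (simp add: assoc_mult_mat_vec[OF W.R_carrier W.R_carrier])
    qed
    finally show ?thesis .
  qed
  show D0: "0 \<le> mtrace (V * V * gram p I x)" unfolding D by (intro sum_nonneg sprod_self_nonneg)
  have S: "S = sqrt (\<Sum>j\<in>I. (V *\<^sub>v y j) \<bullet> (V *\<^sub>v y j)) * sqrt (\<Sum>j\<in>I. y j \<bullet> y j)"
    by (simp only: S_def D mtrace_gram real_sqrt_mult)
  have cs: "(\<Sum>j\<in>I. sqrt ((V *\<^sub>v y j) \<bullet> (V *\<^sub>v y j)) * sqrt (y j \<bullet> y j)) \<le> S"
  proof (rule power2_le_imp_le)
    show "0 \<le> S" unfolding S by (intro mult_nonneg_nonneg real_sqrt_ge_zero sum_nonneg sprod_self_nonneg)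
    show "(\<Sum>j\<in>I. sqrt ((V *\<^sub>v y j) \<bullet> (V *\<^sub>v y j)) * sqrt (y j \<bullet> y j))\<^sup>2 \<le> S\<^sup>2"
      using Cauchy_Schwarz_ineq_sum[of "\<lambda>j. sqrt ((V *\<^sub>v y j) \<bullet> (V *\<^sub>v y j))" "\<lambda>j. sqrt (y j \<bullet> y j)" I]
      unfolding S by (simp add: power_mult_distrib sprod_self_nonneg sum_nonneg)
  qed
  have "P \<le> (\<Sum>j\<in>I. sqrt ((V *\<^sub>v y j) \<bullet> (V *\<^sub>v y j)) * sqrt (y j \<bullet> y j))"
    unfolding P_def trace_deficit
  proof (intro sum_mono)
    fix j
    have "y j \<bullet> (V *\<^sub>v y j) = (V *\<^sub>v y j) \<bullet> y j" by (rule comm_scalar_prod[of _ p]) auto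
    also have "\<dots> \<le> sqrt ((V *\<^sub>v y j) \<bullet> (V *\<^sub>v y j)) * sqrt (y j \<bullet> y j)"
      using abs_sprod_le[OF Vy vec_carrier, of "sqrt ((V *\<^sub>v y j) \<bullet> (V *\<^sub>v y j))" "sqrt (y j \<bullet> y j)" j "x j"]
      by (simp add: sprod_self_nonneg)
    finally show "y j \<bullet> (V *\<^sub>v y j) \<le> sqrt ((V *\<^sub>v y j) \<bullet> (V *\<^sub>v y j)) * sqrt (y j \<bullet> y j)" .
  qed
  then have PS: "P \<le> S" using cs by linarith
  have "Q \<le> (\<Sum>j\<in>I. t * (sqrt ((V *\<^sub>v y j) \<bullet> (V *\<^sub>v y j)) * sqrt (y j \<bullet> y j)))"
    unfolding Q_def weighted_trace_deficit
  proof (intro sum_mono)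
    fix j
    have "(V *\<^sub>v y j) \<bullet> (T *\<^sub>v y j) \<le> sqrt ((V *\<^sub>v y j) \<bullet> (V *\<^sub>v y j)) * (t * sqrt (y j \<bullet> y j))"
      using abs_sprod_le[OF Vy[of j], of "T *\<^sub>v y j" "sqrt ((V *\<^sub>v y j) \<bullet> (V *\<^sub>v y j))" "t * sqrt (y j \<bullet> y j)"]
        T(1) t Tn[of "y j"] by (simp add: sprod_self_nonneg power_mult_distrib)
    then show "(V *\<^sub>v y j) \<bullet> (T *\<^sub>v y j) \<le> t * (sqrt ((V *\<^sub>v y j) \<bullet> (V *\<^sub>v y j)) * sqrt (y j \<bullet> y j))"
      by (simp add: mult_ac)
  qed
  also have "\<dots> \<le> t * S" unfolding sum_distrib_left[symmetric] using t cs by (rule mult_left_mono[rotated])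
  finally have QS: "Q \<le> S * t" by (simp add: mult.commute)
  have vP: "(p - P) / a = mtrace V" using a by (simp add: P_def)
  have "stein_gap p (card I) T (gram p I x) a = (card I - P) * ((p - P) / a) - Q"
    unfolding stein_gap_def Q_def[symmetric] vP by (simp add: P_def power2_eq_square algebra_simps)
  then have "card I * real p / a = stein_gap p (card I) T (gram p I x) a + Q + P * ((card I + real p) / a) - P\<^sup>2 / a"
    using a by (simp add: power2_eq_square field_simps)
  also have "\<dots> \<le> \<bar>stein_gap p (card I) T (gram p I x) a\<bar> + S * t + S * ((card I + real p) / a) - 0"
    using a QS PS by (intro diff_mono add_mono mult_right_mono) auto
  finally show "card I * real p / a \<le> \<bar>stein_gap p (card I) T (gram p I x) a\<bar> + S * ((card I + real p) / a + t)"
    by (simp add: algebra_simps)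
qed

text \<open>This crude bound certifies the boundedness that McDiarmid's inequality requires; its
  size does not enter the tail estimate.\<close>

lemma stein_gap_bounded:
  "\<bar>stein_gap p m T (gram p I x) a\<bar> \<le> \<bar>m - real p\<bar> * (p / a) + p\<^sup>2 / a + \<bar>mtrace T\<bar> + p * t"
proof -
  define v where "v = mtrace V"
  define w where "w = mtrace (V * T)"
  have v: "0 \<le> v" "v \<le> p / a" unfolding v_def by (rule W.mtrace_R_nonneg W.mtrace_R_le)+
  have "\<bar>w\<bar> \<le> p * (t / a)" unfolding w_def by (rule W.mtrace_RT_abs_le[OF T(1) t Tn])
  then have w: "a * \<bar>w\<bar> \<le> p * t" using a by (simp add: field_simps)
  have "a * v\<^sup>2 \<le> a * (p / a)\<^sup>2" using v a by (intro mult_left_mono power_mono) auto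
  also have "\<dots> = p\<^sup>2 / a" using a by (simp add: power2_eq_square)
  finally have v2: "a * v\<^sup>2 \<le> p\<^sup>2 / a" .
  have "\<bar>m - p\<bar> * v \<le> \<bar>m - p\<bar> * (p / a)" using v by (intro mult_left_mono) auto
  moreover have "\<bar>stein_gap p m T (gram p I x) a\<bar> \<le> \<bar>(m - p) * v\<bar> + \<bar>a * v\<^sup>2\<bar> + (\<bar>mtrace T\<bar> + \<bar>a * w\<bar>)"
    unfolding stein_gap_def v_def[symmetric] w_def[symmetric] by linarith
  ultimately show ?thesis using v v2 w a by (simp add: abs_mult)
qed

end

end

section \<open>McDiarmid's inequality\<close>

text \<open>The exponent is four times the optimal one: Hoeffding's lemma is applied on an interval of length
  \<open>2 * c\<close> around one value of \<open>f\<close>, which avoids suprema.\<close>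

lemma mcdiarmid_mgf:
  fixes N :: "'i \<Rightarrow> 'b measure" and f :: "('i \<Rightarrow> 'b) \<Rightarrow> real" and c l B :: real
  assumes N: "\<And>i. prob_space (N i)" and l: "l > 0" and c: "0 \<le> c"
    and I: "finite I" and f: "f \<in> borel_measurable (PiM I N)"
    and bd: "\<And>x. x \<in> space (PiM I N) \<Longrightarrow> \<bar>f x\<bar> \<le> B"
    and diff: "\<And>x i z. x \<in> space (PiM I N) \<Longrightarrow> i \<in> I \<Longrightarrow> z \<in> space (N i) \<Longrightarrow> \<bar>f x - f (x(i := z))\<bar> \<le> c"
  shows "(\<integral>\<^sup>+x. ennreal (exp (l * (f x - (\<integral>u. f u \<partial>PiM I N)))) \<partial>PiM I N) \<le> ennreal (exp (l\<^sup>2 * c\<^sup>2 / 2 * real (card I)))"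
  using I f bd diff
proof (induction I arbitrary: f rule: finite_induct)
  case empty
  interpret E: prob_space "PiM {} N" by (intro prob_space_PiM N)
  have fu: "f x = f (\<lambda>_. undefined)" if "x \<in> space (PiM {} N)" for x
    using that by (simp add: space_PiM_empty)
  have "(\<integral>u. f u \<partial>PiM {} N) = (\<integral>u. f (\<lambda>_. undefined) \<partial>PiM {} N)"
    by (rule Bochner_Integration.integral_cong[OF refl fu])
  then have Ef: "(\<integral>u. f u \<partial>PiM {} N) = f (\<lambda>_. undefined)" by (simp add: E.prob_space)
  have "(\<integral>\<^sup>+x. ennreal (exp (l * (f x - (\<integral>u. f u \<partial>PiM {} N)))) \<partial>PiM {} N) = (\<integral>\<^sup>+x. 1 \<partial>PiM {} N)"
    unfolding Ef by (rule nn_integral_cong) (simp add: space_PiM_empty)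
  then show ?case by (simp add: E.emeasure_space_1)
next
  case (insert i I)
  note f [measurable] = insert.prems(1)
  interpret product_sigma_finite N
    by (simp add: N prob_space_imp_sigma_finite product_sigma_finite.intro)
  interpret Ni: prob_space "N i" by (rule N)
  interpret P: prob_space "PiM I N" by (intro prob_space_PiM N)
  interpret Q: prob_space "PiM (insert i I) N" by (intro prob_space_PiM N)
  have upd: "x(i := y) \<in> space (PiM (insert i I) N)" if "x \<in> space (PiM I N)" "y \<in> space (N i)" for x y
    using that insert.hyps by (auto simp: space_PiM PiE_def extensional_def)
  have fB: "\<bar>f (x(i := y))\<bar> \<le> B" if "x \<in> space (PiM I N)" "y \<in> space (N i)" for x y
    by (rule insert.prems(2)[OF upd[OF that]])
  have m2 [measurable]: "(\<lambda>(x, y). f (x(i := y))) \<in> borel_measurable (PiM I N \<Otimes>\<^sub>M N i)"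
    using measurable_comp[OF measurable_add_dim f] by (simp add: comp_def case_prod_beta)
  \<comment> \<open>Averaging out coordinate \<open>i\<close> leaves a function of the other
    coordinates with the same mean, the same bound and the same differences, to which the induction
    hypothesis applies.\<close>
  define g where "g x = (\<integral>y. f (x(i := y)) \<partial>N i)" for x
  have g [measurable]: "g \<in> borel_measurable (PiM I N)"
    unfolding g_def using m2 by (rule sigma_finite_measure.borel_measurable_lebesgue_integral[OF prob_space_imp_sigma_finite[OF N]])
  have m1: "(\<lambda>y. f (x(i := y))) \<in> borel_measurable (N i)" if "x \<in> space (PiM I N)" for x
    using measurable_compose_Pair1[OF that m2] by simp
  have int1: "integrable (N i) (\<lambda>y. f (x(i := y)))" if "x \<in> space (PiM I N)" for x
    by (intro Ni.integrable_const_bound[where B = B] AE_I2 m1[OF that]) (simp only: real_norm_def fB[OF that])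
  have gB: "\<bar>g x\<bar> \<le> B" if x: "x \<in> space (PiM I N)" for x
  proof -
    have "\<bar>g x\<bar> \<le> (\<integral>y. \<bar>f (x(i := y))\<bar> \<partial>N i)" unfolding g_def by (rule integral_abs_bound)
    also have "\<dots> \<le> (\<integral>y. B \<partial>N i)"
      using int1[OF x] by (intro integral_mono fB[OF x]) auto
    finally show ?thesis by (simp add: Ni.prob_space)
  qed
  have gd: "\<bar>g x - g (x(j := z))\<bar> \<le> c" if x: "x \<in> space (PiM I N)" and j: "j \<in> I" and z: "z \<in> space (N j)" for x j z
  proof -
    have xj: "x(j := z) \<in> space (PiM I N)" using x j z by (auto simp: space_PiM PiE_def extensional_def)
    have ij: "i \<noteq> j" using j insert.hyps by auto
    have "\<bar>g x - g (x(j := z))\<bar> = \<bar>\<integral>y. f (x(i := y)) - f ((x(j := z))(i := y)) \<partial>N i\<bar>"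
      unfolding g_def using int1[OF x] int1[OF xj] by simp
    also have "\<dots> \<le> (\<integral>y. \<bar>f (x(i := y)) - f ((x(j := z))(i := y))\<bar> \<partial>N i)" by (rule integral_abs_bound)
    also have "\<dots> \<le> (\<integral>y. c \<partial>N i)"
    proof (intro integral_mono)
      fix y assume y: "y \<in> space (N i)"
      have "(x(j := z))(i := y) = (x(i := y))(j := z)" using ij by (simp add: fun_upd_twist)
      then show "\<bar>f (x(i := y)) - f ((x(j := z))(i := y))\<bar> \<le> c"
        using insert.prems(3)[OF upd[OF x y] insertI2[OF j] z] by (simp only:)
    qed (use int1[OF x] int1[OF xj] in auto)
    finally show ?thesis by (simp add: Ni.prob_space)
  qed
  have "integrable (PiM (insert i I) N) f"
    using insert.prems(2) by (intro Q.integrable_const_bound[where B = B] AE_I2 f) auto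
  then have Ef: "(\<integral>u. f u \<partial>PiM (insert i I) N) = (\<integral>x. g x \<partial>PiM I N)"
    unfolding g_def using insert.hyps by (intro product_integral_insert) auto
  define E where "E = (\<integral>x. g x \<partial>PiM I N)"
  have inner: "(\<integral>\<^sup>+y. ennreal (exp (l * (f (x(i := y)) - E))) \<partial>N i) \<le> ennreal (exp (l * (g x - E))) * ennreal (exp (l\<^sup>2 * c\<^sup>2 / 2))"
    if x: "x \<in> space (PiM I N)" for x
  proof -
    \<comment> \<open>A reference value for coordinate \<open>i\<close>: changing that coordinate
      keeps \<open>f\<close> within \<open>c\<close> of the value at \<open>y0\<close>, which gives
      the interval for Hoeffding's lemma.\<close>
    obtain y0 where y0: "y0 \<in> space (N i)" using Ni.not_empty by blast
    interpret ib: interval_bounded_random_variable "N i" "\<lambda>y. f (x(i := y))" "f (x(i := y0)) - c" "f (x(i := y0)) + c"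
    proof unfold_locales
      show "(\<lambda>y. f (x(i := y))) \<in> borel_measurable (N i)" by (rule m1[OF x])
      show "AE y in N i. f (x(i := y)) \<in> {f (x(i := y0)) - c..f (x(i := y0)) + c}"
      proof (intro AE_I2)
        fix y assume y: "y \<in> space (N i)"
        have "\<bar>f (x(i := y0)) - f ((x(i := y0))(i := y))\<bar> \<le> c"
          by (rule insert.prems(3)[OF upd[OF x y0] insertI1 y])
        then have "\<bar>f (x(i := y0)) - f (x(i := y))\<bar> \<le> c" by (simp only: fun_upd_upd)
        then show "f (x(i := y)) \<in> {f (x(i := y0)) - c..f (x(i := y0)) + c}" by (auto simp: abs_le_iff)
      qed
    qed
    have "(\<integral>\<^sup>+y. ennreal (exp (l * (f (x(i := y)) - E))) \<partial>N i)
      = (\<integral>\<^sup>+y. ennreal (exp (l * (g x - E))) * ennreal (exp (l * (f (x(i := y)) - g x))) \<partial>N i)"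
      by (intro nn_integral_cong) (simp add: ennreal_mult[symmetric] exp_add[symmetric] algebra_simps)
    also have "\<dots> = ennreal (exp (l * (g x - E))) * (\<integral>\<^sup>+y. ennreal (exp (l * (f (x(i := y)) - g x))) \<partial>N i)"
      using m1[OF x] by (intro nn_integral_cmult) simp
    also have "\<dots> \<le> ennreal (exp (l * (g x - E))) * ennreal (exp (l\<^sup>2 * c\<^sup>2 / 2))"
    proof (intro mult_left_mono)
      have "(\<integral>\<^sup>+y. ennreal (exp (l * (f (x(i := y)) - g x))) \<partial>N i)
        \<le> ennreal (exp (l\<^sup>2 * (f (x(i := y0)) + c - (f (x(i := y0)) - c))\<^sup>2 / 8))"
        unfolding g_def by (rule ib.Hoeffdings_lemma_nn_integral[OF l])
      also have "l\<^sup>2 * (f (x(i := y0)) + c - (f (x(i := y0)) - c))\<^sup>2 / 8 = l\<^sup>2 * c\<^sup>2 / 2"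
        by (simp add: power2_eq_square)
      finally show "(\<integral>\<^sup>+y. ennreal (exp (l * (f (x(i := y)) - g x))) \<partial>N i) \<le> ennreal (exp (l\<^sup>2 * c\<^sup>2 / 2))" .
    qed simp
    finally show ?thesis .
  qed
  have "(\<integral>\<^sup>+x. ennreal (exp (l * (f x - E))) \<partial>PiM (insert i I) N)
    = (\<integral>\<^sup>+x. \<integral>\<^sup>+y. ennreal (exp (l * (f (x(i := y)) - E))) \<partial>N i \<partial>PiM I N)"
    using insert.hyps by (intro product_nn_integral_insert) auto
  also have "\<dots> \<le> (\<integral>\<^sup>+x. ennreal (exp (l * (g x - E))) * ennreal (exp (l\<^sup>2 * c\<^sup>2 / 2)) \<partial>PiM I N)"
    by (intro nn_integral_mono inner)
  also have "\<dots> = (\<integral>\<^sup>+x. ennreal (exp (l * (g x - E))) \<partial>PiM I N) * ennreal (exp (l\<^sup>2 * c\<^sup>2 / 2))"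
    by (intro nn_integral_multc) simp
  also have "\<dots> \<le> ennreal (exp (l\<^sup>2 * c\<^sup>2 / 2 * real (card I))) * ennreal (exp (l\<^sup>2 * c\<^sup>2 / 2))"
    unfolding E_def by (intro mult_right_mono insert.IH g gB gd) auto
  also have "\<dots> = ennreal (exp (l\<^sup>2 * c\<^sup>2 / 2 * real (card (insert i I))))"
    using insert.hyps by (simp add: ennreal_mult[symmetric] exp_add[symmetric] algebra_simps)
  finally show ?case unfolding Ef E_def .
qed

lemma mcdiarmid_upper:
  fixes N :: "'i \<Rightarrow> 'b measure" and f :: "('i \<Rightarrow> 'b) \<Rightarrow> real" and c e B :: real
  assumes N: "\<And>i. prob_space (N i)" and e: "e > 0" and c: "0 < c"
    and I: "finite I" "I \<noteq> {}" and f [measurable]: "f \<in> borel_measurable (PiM I N)"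
    and bd: "\<And>x. x \<in> space (PiM I N) \<Longrightarrow> \<bar>f x\<bar> \<le> B"
    and diff: "\<And>x i z. x \<in> space (PiM I N) \<Longrightarrow> i \<in> I \<Longrightarrow> z \<in> space (N i) \<Longrightarrow> \<bar>f x - f (x(i := z))\<bar> \<le> c"
  shows "measure (PiM I N) {x \<in> space (PiM I N). e \<le> f x - (\<integral>u. f u \<partial>PiM I N)}
    \<le> exp (- (e\<^sup>2 / (2 * c\<^sup>2 * card I)))"
proof -
  interpret P: prob_space "PiM I N" by (intro prob_space_PiM N)
  define E where "E = (\<integral>u. f u \<partial>PiM I N)"
  have m: "real (card I) > 0" using I by (simp add: card_gt_0_iff)
  \<comment> \<open>The minimizer of the Chernoff exponent
    \<open>- l * e + l^2 * c^2 / 2 * card I\<close>.\<close>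
  define l where "l = e / (c\<^sup>2 * card I)"
  have l: "l > 0" using e c m by (simp add: l_def)
  have "emeasure (PiM I N) {x \<in> space (PiM I N). e \<le> f x - E}
    = emeasure (PiM I N) {x \<in> space (PiM I N). 1 \<le> ennreal (exp (- l * e)) * ennreal (exp (l * (f x - E)))}"
  proof (intro arg_cong[where f = "emeasure (PiM I N)"] Collect_cong conj_cong refl)
    fix x
    have "e \<le> f x - E \<longleftrightarrow> l * e \<le> l * (f x - E)" using l by simp
    also have "\<dots> \<longleftrightarrow> 1 \<le> exp (- l * e + l * (f x - E))" by (simp add: one_le_exp_iff)
    also have "\<dots> \<longleftrightarrow> 1 \<le> ennreal (exp (- l * e)) * ennreal (exp (l * (f x - E)))"
      by (simp add: ennreal_mult[symmetric] exp_add[symmetric])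
    finally show "e \<le> f x - E \<longleftrightarrow> 1 \<le> ennreal (exp (- l * e)) * ennreal (exp (l * (f x - E)))" .
  qed
  also have "\<dots> \<le> ennreal (exp (- l * e)) * (\<integral>\<^sup>+x. ennreal (exp (l * (f x - E))) * indicator (space (PiM I N)) x \<partial>PiM I N)"
    by (intro nn_integral_Markov_inequality) auto
  also have "(\<integral>\<^sup>+x. ennreal (exp (l * (f x - E))) * indicator (space (PiM I N)) x \<partial>PiM I N)
    = (\<integral>\<^sup>+x. ennreal (exp (l * (f x - E))) \<partial>PiM I N)"
    by (intro nn_integral_cong) auto
  also have "ennreal (exp (- l * e)) * \<dots> \<le> ennreal (exp (- l * e)) * ennreal (exp (l\<^sup>2 * c\<^sup>2 / 2 * card I))"
    unfolding E_def by (intro mult_left_mono mcdiarmid_mgf[OF N l _ I(1) f bd diff]) (use c in auto)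
  also have "\<dots> = ennreal (exp (- l * e + l\<^sup>2 * c\<^sup>2 / 2 * card I))"
    by (simp add: ennreal_mult[symmetric] exp_add[symmetric])
  also have "- l * e + l\<^sup>2 * c\<^sup>2 / 2 * card I = - (e\<^sup>2 / (2 * c\<^sup>2 * card I))"
    using c m by (simp add: l_def field_simps power2_eq_square)
  finally show ?thesis unfolding E_def[symmetric] P.emeasure_eq_measure by (simp add: ennreal_le_iff)
qed

lemma mcdiarmid:
  fixes N :: "'i \<Rightarrow> 'b measure" and f :: "('i \<Rightarrow> 'b) \<Rightarrow> real" and c e B :: real
  assumes N: "\<And>i. prob_space (N i)" and e: "e > 0" and c: "0 < c"
    and I: "finite I" "I \<noteq> {}" and f [measurable]: "f \<in> borel_measurable (PiM I N)"
    and bd: "\<And>x. x \<in> space (PiM I N) \<Longrightarrow> \<bar>f x\<bar> \<le> B"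
    and diff: "\<And>x i z. x \<in> space (PiM I N) \<Longrightarrow> i \<in> I \<Longrightarrow> z \<in> space (N i) \<Longrightarrow> \<bar>f x - f (x(i := z))\<bar> \<le> c"
  shows "measure (PiM I N) {x \<in> space (PiM I N). e \<le> \<bar>f x - (\<integral>u. f u \<partial>PiM I N)\<bar>}
    \<le> 2 * exp (- (e\<^sup>2 / (2 * c\<^sup>2 * card I)))"
proof -
  interpret P: prob_space "PiM I N" by (intro prob_space_PiM N)
  define E where "E = (\<integral>u. f u \<partial>PiM I N)"
  have E': "(\<integral>u. - f u \<partial>PiM I N) = - E" by (simp add: E_def)
  have "measure (PiM I N) {x \<in> space (PiM I N). e \<le> \<bar>f x - E\<bar>}
    \<le> measure (PiM I N) ({x \<in> space (PiM I N). e \<le> f x - E} \<union> {x \<in> space (PiM I N). e \<le> - f x - (- E)})"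
    by (intro P.finite_measure_mono) (auto simp: abs_if split: if_splits)
  also have "\<dots> \<le> measure (PiM I N) {x \<in> space (PiM I N). e \<le> f x - E}
      + measure (PiM I N) {x \<in> space (PiM I N). e \<le> - f x - (- E)}"
    by (intro measure_Un_le) auto
  also have "\<dots> \<le> exp (- (e\<^sup>2 / (2 * c\<^sup>2 * card I))) + exp (- (e\<^sup>2 / (2 * c\<^sup>2 * card I)))"
  proof (intro add_mono)
    show "measure (PiM I N) {x \<in> space (PiM I N). e \<le> f x - E} \<le> exp (- (e\<^sup>2 / (2 * c\<^sup>2 * card I)))"
      unfolding E_def by (rule mcdiarmid_upper[OF N e c I f bd diff])
    show "measure (PiM I N) {x \<in> space (PiM I N). e \<le> - f x - (- E)} \<le> exp (- (e\<^sup>2 / (2 * c\<^sup>2 * card I)))"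
      unfolding E'[symmetric]
    proof (rule mcdiarmid_upper[OF N e c I, where B = B])
      show "\<bar>- f x\<bar> \<le> B" if "x \<in> space (PiM I N)" for x using bd[OF that] by simp
      show "\<bar>- f x - - f (x(i := z))\<bar> \<le> c" if "x \<in> space (PiM I N)" "i \<in> I" "z \<in> space (N i)" for x i z
        using diff[OF that] by linarith
    qed (use f in simp)
  qed
  finally show ?thesis by (simp add: E_def)
qed

section \<open>Moments of Gaussian vectors\<close>

locale gaussian_vector = prob_space M for M :: "'a measure" +
  fixes p :: nat and Psi :: "real mat" and X :: "'a \<Rightarrow> nat \<Rightarrow> real"
  assumes X: "mvnormal M p Psi X" and Psi: "pos_def_mat p Psi"
begin

definition lf :: "(nat \<Rightarrow> real) \<Rightarrow> 'a \<Rightarrow> real" where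
  "lf a \<omega> = (\<Sum>i<p. a i * X \<omega> i)"

definition cv :: "(nat \<Rightarrow> real) \<Rightarrow> (nat \<Rightarrow> real) \<Rightarrow> real" where
  "cv a b = (\<Sum>i<p. \<Sum>j<p. a i * Psi $$ (i, j) * b j)"

lemma Psi_sym: "i < p \<Longrightarrow> j < p \<Longrightarrow> Psi $$ (i, j) = Psi $$ (j, i)"
  using Psi unfolding pos_def_mat_def by (metis carrier_matD index_transpose_mat(1))

lemma lf_moments:
  shows lf_moment_2: "has_bochner_integral M (\<lambda>\<omega>. (lf a \<omega>)^2) (cv a a)"
    and lf_moment_4: "has_bochner_integral M (\<lambda>\<omega>. (lf a \<omega>)^4) (3 * (cv a a)^2)"
proof -
  have "has_bochner_integral M (\<lambda>\<omega>. (lf a \<omega>)^2) (cv a a) \<and> has_bochner_integral M (\<lambda>\<omega>. (lf a \<omega>)^4) (3 * (cv a a)^2)"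
  \<comment> \<open>\<open>mvnormal\<close> speaks only of nonzero coefficient vectors; the zero
    form is treated separately, as polarization may produce it.\<close>
  proof (cases "\<exists>i<p. a i \<noteq> 0")
    case False
    then have "lf a = (\<lambda>_. 0)" "cv a a = 0" by (auto simp: lf_def cv_def)
    then show ?thesis using has_bochner_integral_zero by simp
  next
    case True
    have D: "distributed M lborel (lf a) (\<lambda>x. ennreal (normal_density 0 (sqrt (cv a a)) x))"
      using X True unfolding mvnormal_def lf_def[abs_def] cv_def by blast
    have "vec p a \<noteq> 0\<^sub>v p" using True by (auto simp: vec_eq_iff)
    then have "0 < vec p a \<bullet> (Psi *\<^sub>v vec p a)" using Psi by (auto simp: pos_def_mat_def)
    also have "vec p a \<bullet> (Psi *\<^sub>v vec p a) = cv a a"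
      using Psi unfolding pos_def_mat_def
      by (auto simp: cv_def scalar_prod_def atLeast0LessThan sum_distrib_left mult_ac)
    finally have c: "cv a a > 0" .
    then have s: "0 < sqrt (cv a a)" by simp
    have *: "has_bochner_integral M (\<lambda>\<omega>. (lf a \<omega>)^(2 * k)) (fact (2 * k) / ((2 / (sqrt (cv a a))\<^sup>2)^k * fact k))" for k
    proof -
      note nm = normal_moment_even[OF s, of 0 k]
      have "integrable M (\<lambda>\<omega>. (lf a \<omega>)^(2 * k))"
        using distributed_integrable[OF D, of "\<lambda>x. x^(2 * k)"] nm by (auto simp: has_bochner_integral_iff)
      moreover have "(\<integral>\<omega>. (lf a \<omega>)^(2 * k) \<partial>M) = fact (2 * k) / ((2 / (sqrt (cv a a))\<^sup>2)^k * fact k)"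
        using distributed_integral[OF D, of "\<lambda>x. x^(2 * k)"] nm by (auto simp: has_bochner_integral_iff)
      ultimately show ?thesis by (simp add: has_bochner_integral_iff)
    qed
    show ?thesis using *[of 1] *[of 2] c by (simp add: fact_numeral power2_eq_square)
  qed
  then show "has_bochner_integral M (\<lambda>\<omega>. (lf a \<omega>)^2) (cv a a)"
    "has_bochner_integral M (\<lambda>\<omega>. (lf a \<omega>)^4) (3 * (cv a a)^2)" by auto
qed

lemma lf_add: "lf (\<lambda>i. a i + b i) \<omega> = lf a \<omega> + lf b \<omega>"
  and lf_diff: "lf (\<lambda>i. a i - b i) \<omega> = lf a \<omega> - lf b \<omega>"
  by (simp_all add: lf_def sum.distrib sum_subtractf algebra_simps)

lemma cv_commute: "cv a b = cv b a"
  unfolding cv_def by (subst sum.swap) (auto intro!: sum.cong simp: Psi_sym mult_ac)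

lemma cv_add_left: "cv (\<lambda>i. a i + b i) c = cv a c + cv b c"
  and cv_diff_left: "cv (\<lambda>i. a i - b i) c = cv a c - cv b c"
  and cv_add_right: "cv c (\<lambda>i. a i + b i) = cv c a + cv c b"
  and cv_diff_right: "cv c (\<lambda>i. a i - b i) = cv c a - cv c b"
  by (simp_all add: cv_def sum.distrib sum_subtractf algebra_simps)

lemmas cv_bilinear = cv_add_left cv_diff_left cv_add_right cv_diff_right

lemma has_bochner_integral_eqI:
  "has_bochner_integral M f x \<Longrightarrow> (\<And>\<omega>. f \<omega> = g \<omega>) \<Longrightarrow> x = y \<Longrightarrow> has_bochner_integral M g y"
  by (metis ext)

text \<open>The definition of \<open>mvnormal\<close> only gives the laws of single linear forms; all mixed moments come
  from these by polarization.\<close>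

lemma lf_moment_22:
  "has_bochner_integral M (\<lambda>\<omega>. (lf a \<omega>)^2 * (lf b \<omega>)^2) (cv a a * cv b b + 2 * (cv a b)^2)"
proof (rule has_bochner_integral_eqI)
  \<comment> \<open>Polarization of degree four:
    \<open>(u + v)^4 + (u - v)^4 - 2 u^4 - 2 v^4 = 12 u^2 v^2\<close>.\<close>
  show "has_bochner_integral M (\<lambda>\<omega>. ((lf (\<lambda>i. a i + b i) \<omega>)^4 + (lf (\<lambda>i. a i - b i) \<omega>)^4
      - (2 * (lf a \<omega>)^4 + 2 * (lf b \<omega>)^4)) / 12)
    ((3 * (cv (\<lambda>i. a i + b i) (\<lambda>i. a i + b i))^2 + 3 * (cv (\<lambda>i. a i - b i) (\<lambda>i. a i - b i))^2
      - (2 * (3 * (cv a a)^2) + 2 * (3 * (cv b b)^2))) / 12)"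
    by (intro has_bochner_integral_divide_zero has_bochner_integral_diff has_bochner_integral_add
      has_bochner_integral_mult_right lf_moment_4)
  show "((lf (\<lambda>i. a i + b i) \<omega>)^4 + (lf (\<lambda>i. a i - b i) \<omega>)^4 - (2 * (lf a \<omega>)^4 + 2 * (lf b \<omega>)^4)) / 12
    = (lf a \<omega>)^2 * (lf b \<omega>)^2" for \<omega>
    unfolding lf_add lf_diff by (simp add: field_simps power4_eq_xxxx power2_eq_square)
  show "(3 * (cv (\<lambda>i. a i + b i) (\<lambda>i. a i + b i))^2 + 3 * (cv (\<lambda>i. a i - b i) (\<lambda>i. a i - b i))^2
      - (2 * (3 * (cv a a)^2) + 2 * (3 * (cv b b)^2))) / 12 = cv a a * cv b b + 2 * (cv a b)^2"
    unfolding cv_bilinear cv_commute[of b a] by (simp add: field_simps power2_eq_square)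
qed

lemma isserlis_2: "has_bochner_integral M (\<lambda>\<omega>. lf a \<omega> * lf b \<omega>) (cv a b)"
proof (rule has_bochner_integral_eqI)
  show "has_bochner_integral M (\<lambda>\<omega>. ((lf (\<lambda>i. a i + b i) \<omega>)^2 - (lf (\<lambda>i. a i - b i) \<omega>)^2) / 4)
    ((cv (\<lambda>i. a i + b i) (\<lambda>i. a i + b i) - cv (\<lambda>i. a i - b i) (\<lambda>i. a i - b i)) / 4)"
    by (intro has_bochner_integral_divide_zero has_bochner_integral_diff lf_moment_2)
  show "((lf (\<lambda>i. a i + b i) \<omega>)^2 - (lf (\<lambda>i. a i - b i) \<omega>)^2) / 4 = lf a \<omega> * lf b \<omega>" for \<omega>
    unfolding lf_add lf_diff by (simp add: field_simps power2_eq_square)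
  show "(cv (\<lambda>i. a i + b i) (\<lambda>i. a i + b i) - cv (\<lambda>i. a i - b i) (\<lambda>i. a i - b i)) / 4 = cv a b"
    unfolding cv_bilinear cv_commute[of b a] by simp
qed

text \<open>Both products are polarized at once:
  \<open>16 a b c d = ((a + b)^2 - (a - b)^2) ((c + d)^2 - (c - d)^2)\<close>, and each of the four
  resulting terms is a moment given by \<open>lf_moment_22\<close>.\<close>

lemma isserlis_4:
  "has_bochner_integral M (\<lambda>\<omega>. lf a \<omega> * lf b \<omega> * (lf c \<omega> * lf d \<omega>))
    (cv a b * cv c d + cv a c * cv b d + cv a d * cv b c)"
proof (rule has_bochner_integral_eqI)
  let ?p = "\<lambda>i. a i + b i" and ?m = "\<lambda>i. a i - b i" and ?q = "\<lambda>i. c i + d i" and ?n = "\<lambda>i. c i - d i"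
  show "has_bochner_integral M (\<lambda>\<omega>. (((lf ?p \<omega>)^2 * (lf ?q \<omega>)^2 - (lf ?p \<omega>)^2 * (lf ?n \<omega>)^2)
      - ((lf ?m \<omega>)^2 * (lf ?q \<omega>)^2 - (lf ?m \<omega>)^2 * (lf ?n \<omega>)^2)) / 16)
    ((((cv ?p ?p * cv ?q ?q + 2 * (cv ?p ?q)^2) - (cv ?p ?p * cv ?n ?n + 2 * (cv ?p ?n)^2))
      - ((cv ?m ?m * cv ?q ?q + 2 * (cv ?m ?q)^2) - (cv ?m ?m * cv ?n ?n + 2 * (cv ?m ?n)^2))) / 16)"
    by (intro has_bochner_integral_divide_zero has_bochner_integral_diff lf_moment_22)
  show "(((lf ?p \<omega>)^2 * (lf ?q \<omega>)^2 - (lf ?p \<omega>)^2 * (lf ?n \<omega>)^2)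
      - ((lf ?m \<omega>)^2 * (lf ?q \<omega>)^2 - (lf ?m \<omega>)^2 * (lf ?n \<omega>)^2)) / 16
    = lf a \<omega> * lf b \<omega> * (lf c \<omega> * lf d \<omega>)" for \<omega>
    unfolding lf_add lf_diff by (simp add: field_simps power2_eq_square)
  show "(((cv ?p ?p * cv ?q ?q + 2 * (cv ?p ?q)^2) - (cv ?p ?p * cv ?n ?n + 2 * (cv ?p ?n)^2))
      - ((cv ?m ?m * cv ?q ?q + 2 * (cv ?m ?q)^2) - (cv ?m ?m * cv ?n ?n + 2 * (cv ?m ?n)^2))) / 16
    = cv a b * cv c d + cv a c * cv b d + cv a d * cv b c"
    unfolding cv_bilinear cv_commute[of b a] cv_commute[of d c] by (simp add: field_simps power2_eq_square)
qed

lemma lf_unit: "i < p \<Longrightarrow> lf (\<lambda>k. if k = i then 1 else 0) \<omega> = X \<omega> i"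
  by (simp add: lf_def if_distrib[of "\<lambda>x. x * _"] cong: if_cong)

lemma cv_unit: "i < p \<Longrightarrow> j < p \<Longrightarrow> cv (\<lambda>k. if k = i then 1 else 0) (\<lambda>k. if k = j then 1 else 0) = Psi $$ (i, j)"
  by (simp add: cv_def if_distrib[of "\<lambda>x. x * _"] if_distrib[of "\<lambda>x. _ * x"] cong: if_cong)

lemma coord_moment_2: "i < p \<Longrightarrow> j < p \<Longrightarrow> has_bochner_integral M (\<lambda>\<omega>. X \<omega> i * X \<omega> j) (Psi $$ (i, j))"
  using isserlis_2[of "\<lambda>k. if k = i then 1 else 0" "\<lambda>k. if k = j then 1 else 0"] by (simp add: lf_unit cv_unit)

lemma coord_covariance:
  assumes "i < p" "j < p" "k < p" "l < p"
  shows "has_bochner_integral M (\<lambda>\<omega>. (X \<omega> i * X \<omega> j - Psi $$ (i, j)) * (X \<omega> k * X \<omega> l - Psi $$ (k, l)))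
    (Psi $$ (i, k) * Psi $$ (j, l) + Psi $$ (i, l) * Psi $$ (j, k))"
proof (rule has_bochner_integral_eqI)
  have "has_bochner_integral M (\<lambda>\<omega>. X \<omega> i * X \<omega> j * (X \<omega> k * X \<omega> l))
    (Psi $$ (i, j) * Psi $$ (k, l) + Psi $$ (i, k) * Psi $$ (j, l) + Psi $$ (i, l) * Psi $$ (j, k))"
    using isserlis_4[of "\<lambda>u. if u = i then 1 else 0" "\<lambda>u. if u = j then 1 else 0"
      "\<lambda>u. if u = k then 1 else 0" "\<lambda>u. if u = l then 1 else 0"] assms by (simp add: lf_unit cv_unit)
  moreover have "has_bochner_integral M (\<lambda>\<omega>. c) c" for c :: real
    by (simp add: has_bochner_integral_iff prob_space)
  ultimately show "has_bochner_integral M (\<lambda>\<omega>. X \<omega> i * X \<omega> j * (X \<omega> k * X \<omega> l)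
      - Psi $$ (k, l) * (X \<omega> i * X \<omega> j) - Psi $$ (i, j) * (X \<omega> k * X \<omega> l) + Psi $$ (i, j) * Psi $$ (k, l))
    (Psi $$ (i, j) * Psi $$ (k, l) + Psi $$ (i, k) * Psi $$ (j, l) + Psi $$ (i, l) * Psi $$ (j, k)
      - Psi $$ (k, l) * Psi $$ (i, j) - Psi $$ (i, j) * Psi $$ (k, l) + Psi $$ (i, j) * Psi $$ (k, l))"
    using assms by (intro has_bochner_integral_add has_bochner_integral_diff has_bochner_integral_mult_right coord_moment_2)
qed (simp_all add: algebra_simps)

text \<open>The quadratic form \<open>X . B X\<close> minus its mean. \<open>B\<close> is not
  assumed symmetric because it will be the product \<open>V * T\<close>.\<close>

definition qf :: "(nat \<Rightarrow> nat \<Rightarrow> real) \<Rightarrow> 'a \<Rightarrow> real" where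
  "qf B \<omega> = (\<Sum>i<p. \<Sum>j<p. B i j * (X \<omega> i * X \<omega> j - Psi $$ (i, j)))"

lemma qf_mean: "has_bochner_integral M (qf B) 0"
proof -
  have "has_bochner_integral M (\<lambda>\<omega>. \<Sum>i<p. \<Sum>j<p. B i j * (X \<omega> i * X \<omega> j - Psi $$ (i, j)))
    (\<Sum>i<p. \<Sum>j<p. B i j * (Psi $$ (i, j) - Psi $$ (i, j)))"
    by (intro has_bochner_integral_sum has_bochner_integral_mult_right has_bochner_integral_diff coord_moment_2)
      (auto simp: has_bochner_integral_iff prob_space)
  then show ?thesis by (simp add: qf_def[abs_def])
qed

lemma qf_variance:
  "has_bochner_integral M (\<lambda>\<omega>. (qf B \<omega>)\<^sup>2)
    (\<Sum>i<p. \<Sum>j<p. \<Sum>k<p. \<Sum>l<p. B i j * B k l * (Psi $$ (i, k) * Psi $$ (j, l) + Psi $$ (i, l) * Psi $$ (j, k)))"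
proof (rule has_bochner_integral_eqI)
  show "has_bochner_integral M (\<lambda>\<omega>. \<Sum>i<p. \<Sum>j<p. \<Sum>k<p. \<Sum>l<p. B i j * B k l *
      ((X \<omega> i * X \<omega> j - Psi $$ (i, j)) * (X \<omega> k * X \<omega> l - Psi $$ (k, l))))
    (\<Sum>i<p. \<Sum>j<p. \<Sum>k<p. \<Sum>l<p. B i j * B k l * (Psi $$ (i, k) * Psi $$ (j, l) + Psi $$ (i, l) * Psi $$ (j, k)))"
    by (intro has_bochner_integral_sum has_bochner_integral_mult_right coord_covariance) auto
  show "(\<Sum>i<p. \<Sum>j<p. \<Sum>k<p. \<Sum>l<p. B i j * B k l *
      ((X \<omega> i * X \<omega> j - Psi $$ (i, j)) * (X \<omega> k * X \<omega> l - Psi $$ (k, l)))) = (qf B \<omega>)\<^sup>2" for \<omega>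
    unfolding qf_def power2_eq_square sum_distrib_right sum_distrib_left by (simp add: mult_ac)
qed simp

end

lemma sum_swap3: "(\<Sum>i\<in>A. \<Sum>j\<in>B. \<Sum>k\<in>C. f i j k) = (\<Sum>k\<in>C. \<Sum>j\<in>B. \<Sum>i\<in>A. f i j k)"
  for f :: "'a \<Rightarrow> 'b \<Rightarrow> 'c \<Rightarrow> 'd::comm_monoid_add"
proof -
  have "(\<Sum>i\<in>A. \<Sum>j\<in>B. \<Sum>k\<in>C. f i j k) = (\<Sum>j\<in>B. \<Sum>i\<in>A. \<Sum>k\<in>C. f i j k)" by (rule sum.swap)
  also have "\<dots> = (\<Sum>j\<in>B. \<Sum>k\<in>C. \<Sum>i\<in>A. f i j k)" by (intro sum.cong refl sum.swap)
  also have "\<dots> = (\<Sum>k\<in>C. \<Sum>j\<in>B. \<Sum>i\<in>A. f i j k)" by (rule sum.swap)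
  finally show ?thesis .
qed

text \<open>The two pairings are the entrywise scalar products of \<open>S B\<close> with
  \<open>B S\<close> and with its own transpose. As multiplication by \<open>S\<close> scales the
  Frobenius norm by at most \<open>s\<close>, \<open>2 u v \<le> u^2 + v^2\<close> bounds each of
  them by \<open>s^2\<close> times the squared norm of \<open>B\<close>.\<close>

lemma wick_sum_le:
  fixes S B :: "nat \<Rightarrow> nat \<Rightarrow> real"
  assumes sym: "\<And>i j. i < p \<Longrightarrow> j < p \<Longrightarrow> S i j = S j i"
    and S: "\<And>z. (\<Sum>i<p. (\<Sum>k<p. S i k * z k)\<^sup>2) \<le> s\<^sup>2 * (\<Sum>k<p. (z k)\<^sup>2)"
  shows "(\<Sum>i<p. \<Sum>j<p. \<Sum>k<p. \<Sum>l<p. B i j * B k l * (S i k * S j l + S i l * S j k))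
    \<le> 2 * s\<^sup>2 * (\<Sum>i<p. \<Sum>j<p. (B i j)\<^sup>2)"
proof -
  define F where "F = (\<Sum>i<p. \<Sum>j<p. (B i j)\<^sup>2)"
  define C where "C k j = (\<Sum>i<p. S k i * B i j)" for k j
  define D where "D k j = (\<Sum>l<p. S j l * B k l)" for k j
  have C: "(\<Sum>k<p. \<Sum>j<p. (C k j)\<^sup>2) \<le> s\<^sup>2 * F"
  proof -
    have "(\<Sum>k<p. \<Sum>j<p. (C k j)\<^sup>2) = (\<Sum>j<p. \<Sum>k<p. (C k j)\<^sup>2)" by (rule sum.swap)
    also have "\<dots> \<le> (\<Sum>j<p. s\<^sup>2 * (\<Sum>i<p. (B i j)\<^sup>2))" unfolding C_def by (intro sum_mono S)
    also have "\<dots> = s\<^sup>2 * F" unfolding F_def sum_distrib_left[symmetric] by (subst sum.swap) simp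
    finally show ?thesis .
  qed
  have D: "(\<Sum>k<p. \<Sum>j<p. (D k j)\<^sup>2) \<le> s\<^sup>2 * F"
  proof -
    have "(\<Sum>k<p. \<Sum>j<p. (D k j)\<^sup>2) \<le> (\<Sum>k<p. s\<^sup>2 * (\<Sum>l<p. (B k l)\<^sup>2))" unfolding D_def by (intro sum_mono S)
    then show ?thesis unfolding F_def sum_distrib_left .
  qed
  have young: "u * v \<le> (u\<^sup>2 + v\<^sup>2) / 2" for u v :: real using sum_squares_bound[of u v] by simp
  have "(\<Sum>i<p. \<Sum>j<p. \<Sum>k<p. \<Sum>l<p. B i j * B k l * (S i k * S j l))
      = (\<Sum>k<p. \<Sum>j<p. \<Sum>i<p. \<Sum>l<p. B i j * B k l * (S i k * S j l))" by (rule sum_swap3)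
  also have "\<dots> = (\<Sum>k<p. \<Sum>j<p. C k j * D k j)"
    unfolding C_def D_def sum_product by (intro sum.cong refl) (use sym in auto)
  also have "\<dots> \<le> (\<Sum>k<p. \<Sum>j<p. ((C k j)\<^sup>2 + (D k j)\<^sup>2) / 2)" by (intro sum_mono young)
  also have "\<dots> \<le> s\<^sup>2 * F"
    using C D by (simp add: sum.distrib add_divide_distrib sum_divide_distrib[symmetric])
  finally have 1: "(\<Sum>i<p. \<Sum>j<p. \<Sum>k<p. \<Sum>l<p. B i j * B k l * (S i k * S j l)) \<le> s\<^sup>2 * F" .
  have "(\<Sum>i<p. \<Sum>j<p. \<Sum>k<p. \<Sum>l<p. B i j * B k l * (S i l * S j k))
      = (\<Sum>j<p. \<Sum>i<p. \<Sum>k<p. \<Sum>l<p. B i j * B k l * (S i l * S j k))" by (rule sum.swap)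
  also have "\<dots> = (\<Sum>j<p. \<Sum>l<p. \<Sum>k<p. \<Sum>i<p. B i j * B k l * (S i l * S j k))"
    by (intro sum.cong refl sum_swap3)
  also have "\<dots> = (\<Sum>j<p. \<Sum>l<p. C j l * C l j)"
    unfolding C_def sum_product by (intro sum.cong refl) (use sym in auto)
  also have "\<dots> \<le> (\<Sum>j<p. \<Sum>l<p. ((C j l)\<^sup>2 + (C l j)\<^sup>2) / 2)" by (intro sum_mono young)
  also have "\<dots> \<le> s\<^sup>2 * F"
    using C sum.swap[of "\<lambda>j l. (C j l)\<^sup>2" "{..<p}" "{..<p}"]
    by (simp add: sum.distrib add_divide_distrib sum_divide_distrib[symmetric])
  finally have 2: "(\<Sum>i<p. \<Sum>j<p. \<Sum>k<p. \<Sum>l<p. B i j * B k l * (S i l * S j k)) \<le> s\<^sup>2 * F" .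
  show ?thesis using 1 2 unfolding F_def[symmetric] by (simp add: distrib_left sum.distrib)
qed

section \<open>Concentration of the gap\<close>

lemma measurable_det:
  fixes A :: "'a \<Rightarrow> real mat"
  assumes A: "\<And>x. A x \<in> carrier_mat n n"
    and m: "\<And>i j. i < n \<Longrightarrow> j < n \<Longrightarrow> (\<lambda>x. A x $$ (i, j)) \<in> borel_measurable M"
  shows "(\<lambda>x. det (A x)) \<in> borel_measurable M"
  unfolding det_def'[OF A]
proof (intro borel_measurable_sum borel_measurable_times borel_measurable_prod)
  fix s i assume "s \<in> {q. q permutes {0..<n}}" "i \<in> {0..<n}"
  then show "(\<lambda>x. A x $$ (i, s i)) \<in> borel_measurable M" by (intro m) (auto dest: permutes_in_image[of s "{0..<n}" i])
qed simp

lemma measurable_adj_mat: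
  fixes A :: "'a \<Rightarrow> real mat"
  assumes A: "\<And>x. A x \<in> carrier_mat n n"
    and m: "\<And>i j. i < n \<Longrightarrow> j < n \<Longrightarrow> (\<lambda>x. A x $$ (i, j)) \<in> borel_measurable M"
    and ij: "i < n" "j < n"
  shows "(\<lambda>x. adj_mat (A x) $$ (i, j)) \<in> borel_measurable M"
proof -
  have dims: "dim_row (A x) = n" "dim_col (A x) = n" for x using A[of x] by auto
  have "(\<lambda>x. det (mat_delete (A x) j i)) \<in> borel_measurable M"
  proof (rule measurable_det[where n = "n - 1"])
    show "mat_delete (A x) j i \<in> carrier_mat (n - 1) (n - 1)" for x by (simp add: mat_delete_def dims)
    show "(\<lambda>x. mat_delete (A x) j i $$ (k, l)) \<in> borel_measurable M" if "k < n - 1" "l < n - 1" for k l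
      using that by (auto simp: mat_delete_def dims intro!: m)
  qed
  then show ?thesis using ij by (simp add: adj_mat_def dims cofactor_def)
qed

text \<open>Positivity of the shift keeps the determinant nonzero everywhere, so the inverse is the
  adjugate over the determinant, both polynomial in the entries.\<close>

lemma measurable_resolvent:
  assumes I: "finite I" and a: "a > 0"
    and m: "\<And>i j. i < p \<Longrightarrow> j \<in> I \<Longrightarrow> (\<lambda>x. f x j i) \<in> borel_measurable M"
    and ik: "i < p" "k < p"
  shows "(\<lambda>x. resolvent p (gram p I (f x)) a $$ (i, k)) \<in> borel_measurable M"
proof -
  define A where "A x = gram p I (f x) + a \<cdot>\<^sub>m 1\<^sub>m p" for x
  have A: "A x \<in> carrier_mat p p" for x by (simp add: A_def)
  have mA: "(\<lambda>x. A x $$ (i, j)) \<in> borel_measurable M" if "i < p" "j < p" for i j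
    using that by (auto simp: A_def gram_def intro!: borel_measurable_add borel_measurable_sum borel_measurable_times m)
  have "resolvent p (gram p I (f x)) a $$ (i, k) = (1 / det (A x)) * adj_mat (A x) $$ (i, k)" for x
    unfolding resolvent_def A_def[symmetric]
    using minv_adj[OF A, of x] psd_shift_det[OF gram_psd[OF I] a, of p "f x"] adj_mat(1)[OF A, of x] ik
    by (simp add: A_def[symmetric])
  then show ?thesis
    using measurable_det[OF A mA] measurable_adj_mat[OF A mA ik] by simp
qed

lemma mtrace_mult_sum:
  assumes "A \<in> carrier_mat p q" "B \<in> carrier_mat q p"
  shows "mtrace (A * B) = (\<Sum>i<p. \<Sum>k<q. A $$ (i, k) * B $$ (k, i))"
  using assms by (simp add: mtrace_def scalar_prod_def atLeast0LessThan)

lemma measurable_mtrace_resolvent: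
  assumes I: "finite I" and a: "a > 0" and T: "T \<in> carrier_mat p p"
    and m: "\<And>i j. i < p \<Longrightarrow> j \<in> I \<Longrightarrow> (\<lambda>x. f x j i) \<in> borel_measurable M"
  shows "(\<lambda>x. mtrace (resolvent p (gram p I (f x)) a * T)) \<in> borel_measurable M"
    and "(\<lambda>x. mtrace (resolvent p (gram p I (f x)) a)) \<in> borel_measurable M"
proof -
  have R: "resolvent p (gram p I (f x)) a \<in> carrier_mat p p" for x
  proof -
    interpret psd_resolvent p "gram p I (f x)" a by unfold_locales (use gram_psd[OF I] a in auto)
    show ?thesis by (rule R_carrier)
  qed
  show "(\<lambda>x. mtrace (resolvent p (gram p I (f x)) a * T)) \<in> borel_measurable M"
    unfolding mtrace_mult_sum[OF R T]
    by (intro borel_measurable_sum borel_measurable_times measurable_resolvent[OF I a m]) auto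
  show "(\<lambda>x. mtrace (resolvent p (gram p I (f x)) a)) \<in> borel_measurable M"
    unfolding mtrace_def carrier_matD(1)[OF R]
    by (intro borel_measurable_sum measurable_resolvent[OF I a m]) auto
qed

lemma measurable_stein_gap:
  assumes I: "finite I" and a: "a > 0" and T: "T \<in> carrier_mat p p"
    and m: "\<And>i j. i < p \<Longrightarrow> j \<in> I \<Longrightarrow> (\<lambda>x. f x j i) \<in> borel_measurable M"
  shows "(\<lambda>x. stein_gap p r T (gram p I (f x)) a) \<in> borel_measurable M"
  using measurable_mtrace_resolvent[OF I a T m] by (simp add: stein_gap_def)

text \<open>Column \<open>j\<close> is coordinate \<open>j\<close> of the product space
  \<open>PiM I N\<close>, so independence of \<open>y j\<close> and \<open>V' j\<close> takes the
  form of Fubini's theorem and McDiarmid's inequality applies directly.\<close>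

locale gaussian_sample =
  fixes N :: "nat \<Rightarrow> (nat \<Rightarrow> real) measure" and p :: nat and Psi :: "real mat"
    and tau :: "nat \<Rightarrow> real" and c1 c2 :: real
  assumes N: "\<And>j. prob_space (N j)" and normal: "\<And>j. mvnormal (N j) p Psi (\<lambda>x. x)"
    and Psi: "pos_def_mat p Psi" and ev: "eigenvalues_of p Psi tau"
    and c1: "0 < c1" and c12: "c1 \<le> c2" and tau: "\<And>j. j < p \<Longrightarrow> tau j \<in> {c1..c2}"
begin

abbreviation "T \<equiv> minv Psi"

lemma Psi_carrier: "Psi \<in> carrier_mat p p" and Psi_transpose: "transpose_mat Psi = Psi"
  using Psi by (auto simp: pos_def_mat_def)

lemma T_carrier: "T \<in> carrier_mat p p" and T_right: "Psi * T = 1\<^sub>m p" and T_left: "T * Psi = 1\<^sub>m p"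
  using minv_nonsingular(2-4)[OF Psi_carrier pos_def_det[OF Psi]] by auto

lemma T_transpose: "transpose_mat T = T"
  by (rule minv_transpose[OF Psi_carrier pos_def_det[OF Psi] Psi_transpose])

lemma Psi_psd: "psd p Psi"
  unfolding psd_def
proof (intro conjI ballI Psi_carrier Psi_transpose)
  fix v :: "real vec" assume v: "v \<in> carrier_vec p"
  have "0 \<le> c1 * (v \<bullet> v)" using c1 sprod_self_nonneg[of v] by simp
  also have "\<dots> \<le> v \<bullet> (Psi *\<^sub>v v)" by (rule quadratic_form_bounds(1)[OF ev Psi_transpose tau v])
  finally show "0 \<le> v \<bullet> (Psi *\<^sub>v v)" .
qed

lemma T_norm:
  assumes v: "v \<in> carrier_vec p"
  shows "(T *\<^sub>v v) \<bullet> (T *\<^sub>v v) \<le> (1 / c1)\<^sup>2 * (v \<bullet> v)"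
  by (rule inverse_norm_bound[OF Psi_carrier c1 _ T_carrier T_right v])
    (rule quadratic_form_bounds(1)[OF ev Psi_transpose tau])

sublocale norm_bounded p T "1 / c1"
  by unfold_locales (use T_carrier T_transpose T_norm c1 in auto)

lemma Psi_norm: "(\<Sum>i<p. (\<Sum>k<p. Psi $$ (i, k) * z k)\<^sup>2) \<le> c2\<^sup>2 * (\<Sum>k<p. (z k)\<^sup>2)"
proof -
  have "(Psi *\<^sub>v vec p z) \<bullet> (Psi *\<^sub>v vec p z) \<le> c2\<^sup>2 * (vec p z \<bullet> vec p z)"
    by (rule operator_norm_bound[OF Psi_psd])
      (use quadratic_form_bounds(2)[OF ev Psi_transpose tau] in auto)
  then show ?thesis using Psi_carrier
    by (simp add: scalar_prod_def atLeast0LessThan power2_eq_square)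
qed

lemma coord_measurable: "j \<in> I \<Longrightarrow> i < p \<Longrightarrow> (\<lambda>x. x j i) \<in> borel_measurable (PiM I N)"
proof -
  assume j: "j \<in> I" and i: "i < p"
  have "(\<lambda>x. x) \<in> measurable (N j) (PiM {..<p} (\<lambda>_. borel))" using normal[of j] by (simp add: mvnormal_def)
  then have "(\<lambda>x. x j) \<in> measurable (PiM I N) (PiM {..<p} (\<lambda>_. borel))"
    using measurable_compose[OF measurable_component_singleton[OF j, of N]] by blast
  then show ?thesis using measurable_compose[OF _ measurable_component_singleton[of i "{..<p}" "\<lambda>_. borel"]] i by simp
qed

lemma gaussian: "gaussian_vector (N j) p Psi (\<lambda>x. x)"
  using N[of j] normal[of j] Psi by (simp add: gaussian_vector_def gaussian_vector_axioms_def)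

text \<open>The weight \<open>T = minv Psi\<close> makes the mean of the quadratic form exactly
  \<open>mtrace V\<close>, since \<open>V * T * Psi = V\<close>; its variance is at most
  \<open>2 c2^2\<close> times the squared Frobenius norm of \<open>V * T\<close>.\<close>

lemma single_residual_l1:
  assumes I: "finite I" and a: "a > 0" and p: "p > 0"
  shows "(\<integral>\<^sup>+y. ennreal \<bar>mtrace (resolvent p (gram p I x) a)
        - (resolvent p (gram p I x) a *\<^sub>v vec p y) \<bullet> (T *\<^sub>v vec p y)\<bar> \<partial>N j)
    \<le> ennreal (sqrt (2 * p) * c2 / (a * c1))"
proof -
  interpret W: psd_resolvent p "gram p I x" a by unfold_locales (use gram_psd[OF I] a in auto)
  interpret G: gaussian_vector "N j" p Psi "\<lambda>x. x" by (rule gaussian)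
  define V where "V = W.R"
  have V: "V \<in> carrier_mat p p" by (simp add: V_def)
  have VT: "V * T \<in> carrier_mat p p" unfolding V_def by (rule W.R_mult[OF T_carrier])
  define B where "B i k = (V * T) $$ (i, k)" for i k
  \<comment> \<open>The square of \<open>s\<close> is \<open>2 c2^2 p / (a c1)^2\<close>, the bound
    on the second moment that comes out of the Wick sum and \<open>frob\<close> below.\<close>
  define s where "s = sqrt (2 * p) * c2 / (a * c1)"
  have s: "s > 0" using p c1 c12 a by (simp add: s_def)
  have tr: "mtrace V = (\<Sum>i<p. \<Sum>k<p. B i k * Psi $$ (i, k))"
  proof -
    have "V = V * (T * Psi)" using V by (simp add: T_left)
    also have "\<dots> = (V * T) * Psi" by (rule assoc_mult_mat[OF V T_carrier Psi_carrier, symmetric])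
    finally have "mtrace V = mtrace ((V * T) * Psi)" by simp
    also have "\<dots> = (\<Sum>i<p. \<Sum>k<p. B i k * Psi $$ (k, i))"
      unfolding B_def by (rule mtrace_mult_sum[OF VT Psi_carrier])
    also have "\<dots> = (\<Sum>i<p. \<Sum>k<p. B i k * Psi $$ (i, k))"
      by (intro sum.cong refl arg_cong2[where f = "(*)"] G.Psi_sym) auto
    finally show ?thesis .
  qed
  have quad: "(V *\<^sub>v vec p y) \<bullet> (T *\<^sub>v vec p y) = (\<Sum>i<p. \<Sum>k<p. B i k * (y i * y k))" for y
  proof -
    have Ty: "T *\<^sub>v vec p y \<in> carrier_vec p" using T_carrier by simp
    have "(V *\<^sub>v vec p y) \<bullet> (T *\<^sub>v vec p y) = vec p y \<bullet> (V *\<^sub>v (T *\<^sub>v vec p y))"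
      unfolding V_def by (rule sym_sprod[OF W.R_carrier W.R_sym _ Ty, symmetric]) simp
    also have "V *\<^sub>v (T *\<^sub>v vec p y) = (V * T) *\<^sub>v vec p y"
      by (rule assoc_mult_mat_vec[OF V T_carrier, symmetric]) simp
    also have "vec p y \<bullet> ((V * T) *\<^sub>v vec p y) = (\<Sum>i<p. y i * (\<Sum>k<p. (V * T) $$ (i, k) * y k))"
      using carrier_matD[OF VT] by (simp add: scalar_prod_def atLeast0LessThan del: index_mult_mat(1))
    finally show ?thesis unfolding B_def[symmetric] by (simp add: sum_distrib_left mult_ac)
  qed
  have resid: "\<bar>mtrace V - (V *\<^sub>v vec p y) \<bullet> (T *\<^sub>v vec p y)\<bar> = \<bar>G.qf B y\<bar>" for y
    unfolding tr quad G.qf_def by (simp add: sum_subtractf right_diff_distrib abs_minus_commute)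
  \<comment> \<open>Column by column: \<open>|V (T e)| \<le> |T e| / a \<le> 1 / (a c1)\<close> for
    each basis vector \<open>e\<close>.\<close>
  have frob: "(\<Sum>i<p. \<Sum>k<p. (B i k)\<^sup>2) \<le> p * (1 / (a * c1))\<^sup>2"
  proof -
    have "(\<Sum>i<p. (B i k)\<^sup>2) \<le> (1 / (a * c1))\<^sup>2" if k: "k < p" for k
    proof -
      define e :: "real vec" where "e = unit_vec p k"
      have e: "e \<in> carrier_vec p" "e \<bullet> e = 1" using k by (auto simp: e_def)
      have Te: "T *\<^sub>v e \<in> carrier_vec p" using T_carrier e by simp
      have "(V * T) *\<^sub>v e = col (V * T) k"
        using carrier_matD[OF VT] k by (intro eq_vecI) (auto simp: e_def simp del: index_mult_mat(1))
      then have "(\<Sum>i<p. (B i k)\<^sup>2) = ((V * T) *\<^sub>v e) \<bullet> ((V * T) *\<^sub>v e)"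
        using carrier_matD[OF VT] k
        by (simp add: scalar_prod_def atLeast0LessThan B_def power2_eq_square del: index_mult_mat(1))
      also have "(V * T) *\<^sub>v e = V *\<^sub>v (T *\<^sub>v e)" by (rule assoc_mult_mat_vec[OF V T_carrier e(1)])
      also have "(V *\<^sub>v (T *\<^sub>v e)) \<bullet> (V *\<^sub>v (T *\<^sub>v e)) \<le> (1 / a)\<^sup>2 * ((T *\<^sub>v e) \<bullet> (T *\<^sub>v e))"
        unfolding V_def by (rule W.R_norm[OF Te])
      also have "\<dots> \<le> (1 / a)\<^sup>2 * ((1 / c1)\<^sup>2 * (e \<bullet> e))" by (intro mult_left_mono T_norm e) simp
      finally show ?thesis using e by (simp add: power_divide power_mult_distrib)
    qed
    then have "(\<Sum>k<p. \<Sum>i<p. (B i k)\<^sup>2) \<le> (\<Sum>k<p. (1 / (a * c1))\<^sup>2)" by (intro sum_mono) auto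
    then show ?thesis by (subst sum.swap) simp
  qed
  have "(\<integral>\<^sup>+y. ennreal ((G.qf B y)\<^sup>2) \<partial>N j) \<le> ennreal (2 * c2\<^sup>2 * (\<Sum>i<p. \<Sum>k<p. (B i k)\<^sup>2))"
  proof -
    have "(\<integral>\<^sup>+y. ennreal ((G.qf B y)\<^sup>2) \<partial>N j) = ennreal (\<Sum>i<p. \<Sum>k<p. \<Sum>u<p. \<Sum>l<p. B i k * B u l *
        (Psi $$ (i, u) * Psi $$ (k, l) + Psi $$ (i, l) * Psi $$ (k, u)))"
      using G.qf_variance[of B] nn_integral_eq_integral[of "N j" "\<lambda>y. (G.qf B y)\<^sup>2"]
      by (simp add: has_bochner_integral_iff)
    also have "\<dots> \<le> ennreal (2 * c2\<^sup>2 * (\<Sum>i<p. \<Sum>k<p. (B i k)\<^sup>2))"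
      by (intro ennreal_leI wick_sum_le Psi_norm G.Psi_sym)
    finally show ?thesis .
  qed
  also have "\<dots> \<le> ennreal (s\<^sup>2)"
  proof (intro ennreal_leI)
    have "2 * c2\<^sup>2 * (\<Sum>i<p. \<Sum>k<p. (B i k)\<^sup>2) \<le> 2 * c2\<^sup>2 * (p * (1 / (a * c1))\<^sup>2)"
      by (intro mult_left_mono frob) simp
    also have "\<dots> = s\<^sup>2" by (simp add: s_def power_divide power_mult_distrib)
    finally show "2 * c2\<^sup>2 * (\<Sum>i<p. \<Sum>k<p. (B i k)\<^sup>2) \<le> s\<^sup>2" .
  qed
  finally have sq: "(\<integral>\<^sup>+y. ennreal ((G.qf B y)\<^sup>2) \<partial>N j) \<le> ennreal (s\<^sup>2)" .
  have qm: "G.qf B \<in> borel_measurable (N j)"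
    using G.qf_mean by (auto simp: has_bochner_integral_iff dest: borel_measurable_integrable)
  have "(\<integral>\<^sup>+y. ennreal \<bar>G.qf B y\<bar> \<partial>N j) \<le> (\<integral>\<^sup>+y. ennreal (1 / (2 * s)) * ennreal ((G.qf B y)\<^sup>2) + ennreal (s / 2) \<partial>N j)"
  proof (intro nn_integral_mono)
    fix y
    \<comment> \<open>Young's inequality with weight \<open>s\<close> passes from second to first
      moments: when the second moment is at most \<open>s^2\<close>, the two terms integrate to at
      most \<open>s / 2\<close> each.\<close>
    have "2 * (\<bar>G.qf B y\<bar> * s) \<le> (G.qf B y)\<^sup>2 + s\<^sup>2"
      using sum_squares_bound[of "\<bar>G.qf B y\<bar>" s] by (simp add: mult.assoc)
    then have "\<bar>G.qf B y\<bar> \<le> 1 / (2 * s) * (G.qf B y)\<^sup>2 + s / 2"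
      using s by (simp add: field_simps power2_eq_square)
    then have "ennreal \<bar>G.qf B y\<bar> \<le> ennreal (1 / (2 * s) * (G.qf B y)\<^sup>2 + s / 2)" by (rule ennreal_leI)
    also have "\<dots> = ennreal (1 / (2 * s)) * ennreal ((G.qf B y)\<^sup>2) + ennreal (s / 2)"
      using s by (simp add: ennreal_mult[symmetric] ennreal_plus[symmetric] del: ennreal_plus)
    finally show "ennreal \<bar>G.qf B y\<bar> \<le> ennreal (1 / (2 * s)) * ennreal ((G.qf B y)\<^sup>2) + ennreal (s / 2)" .
  qed
  also have "\<dots> = ennreal (1 / (2 * s)) * (\<integral>\<^sup>+y. ennreal ((G.qf B y)\<^sup>2) \<partial>N j) + ennreal (s / 2)"
    using qm by (simp add: nn_integral_add nn_integral_cmult G.emeasure_space_1)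
  also have "\<dots> \<le> ennreal (1 / (2 * s)) * ennreal (s\<^sup>2) + ennreal (s / 2)"
    by (intro add_right_mono mult_left_mono sq) simp
  also have "\<dots> = ennreal (1 / (2 * s) * s\<^sup>2 + s / 2)"
    using s by (simp add: ennreal_mult[symmetric] ennreal_plus[symmetric] del: ennreal_plus)
  also have "1 / (2 * s) * s\<^sup>2 + s / 2 = s" using s by (simp add: power2_eq_square)
  finally show ?thesis unfolding V_def[symmetric] resid s_def .
qed

lemma measurable_residual:
  assumes I: "finite I" "j \<in> I" and a: "a > 0"
  shows "(\<lambda>x. mtrace (resolvent p (gram p (I - {j}) x) a)
        - (resolvent p (gram p (I - {j}) x) a *\<^sub>v vec p (x j)) \<bullet> (T *\<^sub>v vec p (x j))) \<in> borel_measurable (PiM I N)"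
proof -
  have I': "finite (I - {j})" using I by simp
  have R: "resolvent p (gram p (I - {j}) x) a \<in> carrier_mat p p" for x
  proof -
    interpret psd_resolvent p "gram p (I - {j}) x" a by unfold_locales (use gram_psd[OF I'] a in auto)
    show ?thesis by (rule R_carrier)
  qed
  have quad: "(resolvent p (gram p (I - {j}) x) a *\<^sub>v vec p (x j)) \<bullet> (T *\<^sub>v vec p (x j))
    = (\<Sum>i<p. (\<Sum>k<p. resolvent p (gram p (I - {j}) x) a $$ (i, k) * x j k) * (\<Sum>k<p. T $$ (i, k) * x j k))" for x
    using T_carrier carrier_matD[OF R] by (simp add: scalar_prod_def atLeast0LessThan)
  note mr = measurable_resolvent[OF I' a, of p "\<lambda>x. x"] measurable_mtrace_resolvent(2)[OF I' a T_carrier, of "\<lambda>x. x"]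
  show ?thesis unfolding quad
    by (intro borel_measurable_diff borel_measurable_sum borel_measurable_times mr borel_measurable_const coord_measurable)
      (use I in auto)
qed

lemma stein_gap_expectation:
  assumes I: "finite I" and a: "a > 0" and p: "p > 0"
  shows "\<bar>\<integral>x. stein_gap p (card I) T (gram p I x) a \<partial>PiM I N\<bar> \<le> card I / a + card I * (sqrt (2 * p) * c2 / (a * c1))"
proof -
  interpret product_sigma_finite N by (simp add: N prob_space_imp_sigma_finite product_sigma_finite.intro)
  interpret P: prob_space "PiM I N" by (intro prob_space_PiM N)
  define s where "s = sqrt (2 * p) * c2 / (a * c1)"
  have s: "s \<ge> 0" using c1 c12 a by (simp add: s_def)
  define Z where "Z j x = \<bar>mtrace (resolvent p (gram p (I - {j}) x) a)
        - (resolvent p (gram p (I - {j}) x) a *\<^sub>v vec p (x j)) \<bullet> (T *\<^sub>v vec p (x j))\<bar>" for j x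
  have Zm: "Z j \<in> borel_measurable (PiM I N)" if "j \<in> I" for j
    unfolding Z_def using measurable_residual[OF I that a] by (intro borel_measurable_abs)
  have EZ: "(\<integral>\<^sup>+x. ennreal (Z j x) \<partial>PiM I N) \<le> ennreal s" if j: "j \<in> I" for j
  proof -
    define J where "J = I - {j}"
    have J: "finite J" "j \<notin> J" "I = insert j J" using I j by (auto simp: J_def)
    interpret PJ: prob_space "PiM J N" by (intro prob_space_PiM N)
    have "(\<integral>\<^sup>+x. ennreal (Z j x) \<partial>PiM I N) = (\<integral>\<^sup>+x. (\<integral>\<^sup>+y. ennreal (Z j (x(j := y))) \<partial>N j) \<partial>PiM J N)"
      unfolding J(3) by (rule product_nn_integral_insert[OF J(1,2)]) (use Zm[OF j] J(3) in simp)
    also have "\<dots> = (\<integral>\<^sup>+x. (\<integral>\<^sup>+y. ennreal \<bar>mtrace (resolvent p (gram p J x) a)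
        - (resolvent p (gram p J x) a *\<^sub>v vec p y) \<bullet> (T *\<^sub>v vec p y)\<bar> \<partial>N j) \<partial>PiM J N)"
    proof (intro nn_integral_cong)
      fix x y
      have "gram p J (x(j := y)) = gram p J x" using J(2) by (intro gram_cong) auto
      then show "ennreal (Z j (x(j := y))) = ennreal \<bar>mtrace (resolvent p (gram p J x) a)
        - (resolvent p (gram p J x) a *\<^sub>v vec p y) \<bullet> (T *\<^sub>v vec p y)\<bar>" by (simp add: Z_def J_def)
    qed
    also have "\<dots> \<le> (\<integral>\<^sup>+x. ennreal s \<partial>PiM J N)"
      unfolding s_def by (intro nn_integral_mono single_residual_l1 J a p)
    finally show ?thesis by (simp add: PJ.emeasure_space_1)
  qed
  \<comment> \<open>In the case split below, a non-integrable function has Bochner integral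
    \<open>0\<close>, which makes the bound trivial.\<close>
  have "ennreal \<bar>\<integral>x. stein_gap p (card I) T (gram p I x) a \<partial>PiM I N\<bar>
    \<le> (\<integral>\<^sup>+x. ennreal \<bar>stein_gap p (card I) T (gram p I x) a\<bar> \<partial>PiM I N)"
    using integral_norm_bound_ennreal[of "PiM I N" "\<lambda>x. stein_gap p (card I) T (gram p I x) a"]
    by (cases "integrable (PiM I N) (\<lambda>x. stein_gap p (card I) T (gram p I x) a)")
      (auto simp: not_integrable_integral_eq)
  also have "\<dots> \<le> (\<integral>\<^sup>+x. ennreal (card I / a) + (\<Sum>j\<in>I. ennreal (Z j x)) \<partial>PiM I N)"
  proof (intro nn_integral_mono)
    fix x
    have "ennreal \<bar>stein_gap p (card I) T (gram p I x) a\<bar> \<le> ennreal (card I / a + (\<Sum>j\<in>I. Z j x))"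
      unfolding Z_def by (intro ennreal_leI stein_gap_leave_one_out I a)
    also have "\<dots> = ennreal (card I / a) + (\<Sum>j\<in>I. ennreal (Z j x))"
      using a by (simp add: ennreal_plus sum_nonneg Z_def sum_ennreal)
    finally show "ennreal \<bar>stein_gap p (card I) T (gram p I x) a\<bar> \<le> ennreal (card I / a) + (\<Sum>j\<in>I. ennreal (Z j x))" .
  qed
  also have "\<dots> = ennreal (card I / a) + (\<Sum>j\<in>I. (\<integral>\<^sup>+x. ennreal (Z j x) \<partial>PiM I N))"
    using Zm by (simp add: nn_integral_add nn_integral_sum P.emeasure_space_1)
  also have "\<dots> \<le> ennreal (card I / a) + (\<Sum>j\<in>I. ennreal s)"
    by (intro add_left_mono sum_mono EZ)
  also have "\<dots> = ennreal (card I / a + card I * s)"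
    using a s by (simp add: ennreal_plus ennreal_mult ennreal_of_nat_eq_real_of_nat)
  finally show ?thesis
    unfolding s_def[symmetric] using a s by (subst (asm) ennreal_le_iff) auto
qed

text \<open>Both samples share the Gram matrix without column \<open>j\<close>; passing through it
  uses the rank-one bound twice.\<close>

lemma stein_gap_replace_column:
  assumes I: "finite I" and j: "j \<in> I" and a: "a > 0"
  shows "\<bar>stein_gap p r T (gram p I x) a - stein_gap p r T (gram p I (x(j := z))) a\<bar>
    \<le> 2 * ((\<bar>r - real p\<bar> + 2 * real p) / a + 1 / c1)"
proof -
  have J: "finite (I - {j})" using I by simp
  have 1: "gram p I x = gram p (I - {j}) x + outer p (vec p (x j))" by (rule gram_remove[OF I j])
  have "gram p (I - {j}) (x(j := z)) = gram p (I - {j}) x" by (intro gram_cong) auto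
  then have 2: "gram p I (x(j := z)) = gram p (I - {j}) x + outer p (vec p z)"
    using gram_remove[OF I j, of p "x(j := z)"] by simp
  define h where "h = (\<bar>r - real p\<bar> + 2 * real p) / a + 1 / c1"
  have "\<bar>stein_gap p r T (gram p (I - {j}) x) a - stein_gap p r T (gram p (I - {j}) x + outer p (vec p y)) a\<bar> \<le> h" for y
    unfolding h_def by (rule stein_gap_rank_one[OF gram_psd[OF J] a]) simp
  from this[of "x j"] this[of z] show ?thesis unfolding 1 2 h_def[symmetric] by linarith
qed

text \<open>The mean has size at most \<open>e\<close>, so a value of size at least
  \<open>2 * e\<close> deviates from it by at least \<open>e\<close>. The parameter \<open>c\<close>
  leaves room for a bounded-difference constant that does not depend on \<open>n\<close>.\<close>

lemma stein_gap_tail: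
  fixes a c e :: real
  assumes I: "finite I" "I \<noteq> {}" and a: "a > 0" and p: "p > 0" and e: "e > 0"
    and mean: "card I / a + card I * (sqrt (2 * p) * c2 / (a * c1)) \<le> e"
    and c: "2 * ((\<bar>real (card I) - real p\<bar> + 2 * real p) / a + 1 / c1) \<le> c"
  shows "measure (PiM I N) {x \<in> space (PiM I N). 2 * e \<le> \<bar>stein_gap p (card I) T (gram p I x) a\<bar>}
    \<le> 2 * exp (- (e\<^sup>2 / (2 * c\<^sup>2 * card I)))"
proof -
  interpret P: prob_space "PiM I N" by (intro prob_space_PiM N)
  define F where "F x = stein_gap p (card I) T (gram p I x) a" for x
  have Fm [measurable]: "F \<in> borel_measurable (PiM I N)"
    unfolding F_def by (rule measurable_stein_gap[OF I(1) a T_carrier]) (auto intro: coord_measurable)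
  have c0: "c > 0"
  proof -
    have "0 < 2 * ((\<bar>real (card I) - real p\<bar> + 2 * real p) / a + 1 / c1)"
      using a c1 by (simp add: add_nonneg_pos)
    then show ?thesis using c by linarith
  qed
  define E where "E = (\<integral>u. F u \<partial>PiM I N)"
  have E: "\<bar>E\<bar> \<le> e" using stein_gap_expectation[OF I(1) a p] mean by (simp add: E_def F_def)
  have "measure (PiM I N) {x \<in> space (PiM I N). 2 * e \<le> \<bar>F x\<bar>}
    \<le> measure (PiM I N) {x \<in> space (PiM I N). e \<le> \<bar>F x - E\<bar>}"
    using E by (intro P.finite_measure_mono) auto
  also have "\<dots> \<le> 2 * exp (- (e\<^sup>2 / (2 * c\<^sup>2 * card I)))"
    unfolding E_def
  proof (rule mcdiarmid[OF N e c0 I Fm])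
    show "\<bar>F x\<bar> \<le> \<bar>real (card I) - real p\<bar> * (p / a) + p\<^sup>2 / a + \<bar>mtrace T\<bar> + p * (1 / c1)" for x
      unfolding F_def by (rule stein_gap_bounded[OF I(1) a])
    show "\<bar>F x - F (x(i := z))\<bar> \<le> c" if "i \<in> I" for x i z
      using stein_gap_replace_column[OF I(1) that a] c unfolding F_def by (meson order_trans)
  qed
  finally show ?thesis by (simp add: F_def)
qed

end

section \<open>From the product model to the given random matrices\<close>

lemma mvnormal_distr:
  assumes "mvnormal M p Psi X"
  shows "mvnormal (distr M (PiM {..<p} (\<lambda>_. borel)) X) p Psi (\<lambda>x. x)"
proof -
  let ?B = "PiM {..<p} (\<lambda>_. borel :: real measure)"
  have X [measurable]: "X \<in> measurable M ?B" using assms by (simp add: mvnormal_def)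
  have "distributed (distr M ?B X) lborel (\<lambda>x. \<Sum>i<p. a i * x i) f"
    if "distributed M lborel (\<lambda>\<omega>. \<Sum>i<p. a i * X \<omega> i) f" for a :: "nat \<Rightarrow> real" and f
  proof -
    have L [measurable]: "(\<lambda>x. \<Sum>i<p. a i * x i) \<in> measurable ?B lborel" by measurable
    show ?thesis using that distr_distr[OF L X] by (simp add: distributed_def comp_def)
  qed
  then show ?thesis using assms by (simp add: mvnormal_def)
qed

text \<open>Independence and zero means kill the cross terms of the squared sum; the rest is
  Chebyshev's inequality. It is meant for \<open>tr W\<close>, where second moments suffice.\<close>

lemma (in prob_space) indep_sum_tail:
  fixes Z :: "'i \<Rightarrow> 'a \<Rightarrow> real" and v :: "'i \<Rightarrow> real" and u t :: real
  assumes I: "finite I" and ind: "indep_vars (\<lambda>_. borel) Z I"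
    and mean: "\<And>j. j \<in> I \<Longrightarrow> has_bochner_integral M (Z j) 0"
    and sq: "\<And>j. j \<in> I \<Longrightarrow> has_bochner_integral M (\<lambda>\<omega>. (Z j \<omega>)\<^sup>2) (v j)"
    and v: "\<And>j. j \<in> I \<Longrightarrow> v j \<le> u" and t: "t > 0"
  shows "prob {\<omega> \<in> space M. t \<le> \<bar>\<Sum>j\<in>I. Z j \<omega>\<bar>} \<le> card I * u / t\<^sup>2"
proof -
  have prod: "has_bochner_integral M (\<lambda>\<omega>. Z j \<omega> * Z k \<omega>) (if j = k then v j else 0)"
    if jk: "j \<in> I" "k \<in> I" for j k
  proof (cases "j = k")
    case True
    then show ?thesis using sq[OF jk(1)] by (simp add: power2_eq_square)
  next
    case False
    have ind': "indep_vars (\<lambda>_. borel) Z {j, k}" by (rule indep_vars_subset[OF ind]) (use jk in auto)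
    have int: "integrable M (Z i)" if "i \<in> {j, k}" for i
      using mean jk that by (auto simp: has_bochner_integral_iff)
    have "(\<integral>\<omega>. (\<Prod>i\<in>{j, k}. Z i \<omega>) \<partial>M) = (\<Prod>i\<in>{j, k}. \<integral>\<omega>. Z i \<omega> \<partial>M)"
      by (rule indep_vars_lebesgue_integral[OF _ ind' int]) simp
    moreover have "integrable M (\<lambda>\<omega>. \<Prod>i\<in>{j, k}. Z i \<omega>)"
      by (rule indep_vars_integrable[OF _ ind' int]) simp
    moreover have "(\<integral>\<omega>. Z j \<omega> \<partial>M) = 0" using mean[OF jk(1)] by (simp add: has_bochner_integral_iff)
    ultimately show ?thesis using False by (simp add: has_bochner_integral_iff)
  qed
  define S where "S \<omega> = (\<Sum>j\<in>I. Z j \<omega>)" for \<omega>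
  have "has_bochner_integral M (\<lambda>\<omega>. \<Sum>j\<in>I. \<Sum>k\<in>I. Z j \<omega> * Z k \<omega>) (\<Sum>j\<in>I. \<Sum>k\<in>I. if j = k then v j else 0)"
    by (intro has_bochner_integral_sum prod)
  also have "(\<lambda>\<omega>. \<Sum>j\<in>I. \<Sum>k\<in>I. Z j \<omega> * Z k \<omega>) = (\<lambda>\<omega>. (S \<omega>)\<^sup>2)"
    by (simp add: S_def power2_eq_square sum_product)
  also have "(\<Sum>j\<in>I. \<Sum>k\<in>I. if j = k then v j else 0) = (\<Sum>j\<in>I. v j)"
    using I by (intro sum.cong refl) simp
  finally have S2: "has_bochner_integral M (\<lambda>\<omega>. (S \<omega>)\<^sup>2) (\<Sum>j\<in>I. v j)" .
  have S1: "has_bochner_integral M S 0"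
    using has_bochner_integral_sum[of I M Z "\<lambda>_. 0"] mean by (simp add: S_def[abs_def])
  have rv: "random_variable borel S" and ES: "expectation S = 0"
    using S1 by (auto simp: has_bochner_integral_iff)
  have "prob {\<omega> \<in> space M. t \<le> \<bar>S \<omega> - expectation S\<bar>} \<le> variance S / t\<^sup>2"
    by (rule Chebyshev_inequality[OF rv _ t]) (use S2 in \<open>simp add: has_bochner_integral_iff\<close>)
  also have "variance S = (\<Sum>j\<in>I. v j)" using S2 by (simp add: ES has_bochner_integral_iff)
  also have "(\<Sum>j\<in>I. v j) / t\<^sup>2 \<le> card I * u / t\<^sup>2"
    using sum_bounded_above[of I v u] v by (intro divide_right_mono) auto
  finally show ?thesis unfolding ES by (simp add: S_def)
qed

context prob_space
begin

context
  fixes p m :: nat and Psi :: "real mat" and Y :: "'a \<Rightarrow> real mat" and tau :: "nat \<Rightarrow> real" and c1 c2 :: real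
  assumes Y: "iid_normal_columns M p m Psi Y" and m: "m > 0" and p: "p > 0"
    and Psi: "pos_def_mat p Psi" and ev: "eigenvalues_of p Psi tau"
    and c1: "0 < c1" and c12: "c1 \<le> c2" and tau: "\<And>j. j < p \<Longrightarrow> tau j \<in> {c1..c2}"
begin

abbreviation (input) "B \<equiv> PiM {..<p} (\<lambda>_. borel :: real measure)"

definition column :: "nat \<Rightarrow> 'a \<Rightarrow> nat \<Rightarrow> real" where
  "column j \<omega> = restrict (\<lambda>i. Y \<omega> $$ (i, j)) {..<p}"

text \<open>Indices \<open>j \<ge> m\<close> get a dummy law, since \<open>PiM\<close> facts want a probability measure at every index.\<close>

definition law :: "nat \<Rightarrow> (nat \<Rightarrow> real) measure" where
  "law j = distr M B (column (if j < m then j else 0))"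

lemma column_normal: "j < m \<Longrightarrow> mvnormal M p Psi (column j)"
  using Y by (simp add: iid_normal_columns_def column_def[abs_def])

lemma column_measurable: "j < m \<Longrightarrow> column j \<in> measurable M B"
  using column_normal by (simp add: mvnormal_def)

lemma column_indep: "indep_vars (\<lambda>_. B) column {..<m}"
  using Y by (simp add: iid_normal_columns_def column_def[abs_def])

lemma sample: "gaussian_sample law p Psi tau c1 c2"
proof (rule gaussian_sample.intro[OF _ _ Psi ev c1 c12 tau])
  show "prob_space (law j)" for j
    unfolding law_def using column_measurable m by (intro prob_space_distr) auto
  show "mvnormal (law j) p Psi (\<lambda>x. x)" for j
    unfolding law_def using column_normal m by (intro mvnormal_distr) auto
qed

interpretation gaussian_sample law p Psi tau c1 c2 by (rule sample)

text \<open>Independence of the columns says that their joint law is a product, which lets tail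
  bounds on \<open>PiM {..<m} law\<close> be pulled back to \<open>M\<close>.\<close>

lemma joint_law: "distr M (PiM {..<m} (\<lambda>_. B)) (\<lambda>\<omega>. \<lambda>j\<in>{..<m}. column j \<omega>) = PiM {..<m} law"
proof -
  have "distr M (PiM {..<m} (\<lambda>_. B)) (\<lambda>\<omega>. \<lambda>j\<in>{..<m}. column j \<omega>) = PiM {..<m} (\<lambda>j. distr M B (column j))"
    using column_indep column_measurable m by (subst indep_vars_iff_distr_eq_PiM'[symmetric]) auto
  also have "\<dots> = PiM {..<m} law" by (intro PiM_cong) (auto simp: law_def)
  finally show ?thesis .
qed

lemma gram_columns:
  assumes w: "\<omega> \<in> space M"
  shows "gram p {..<m} (\<lambda>j\<in>{..<m}. column j \<omega>) = Y \<omega> * transpose_mat (Y \<omega>)"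
    and "gram p {..<m} (\<lambda>j. column j \<omega>) = Y \<omega> * transpose_mat (Y \<omega>)"
proof -
  have "Y \<omega> \<in> carrier_mat p m" using Y w by (simp add: iid_normal_columns_def)
  then show "gram p {..<m} (\<lambda>j\<in>{..<m}. column j \<omega>) = Y \<omega> * transpose_mat (Y \<omega>)"
    "gram p {..<m} (\<lambda>j. column j \<omega>) = Y \<omega> * transpose_mat (Y \<omega>)"
    by (auto intro!: eq_matI simp: gram_def column_def scalar_prod_def atLeast0LessThan)
qed

lemma sample_stein_gap_tail:
  fixes a c e :: real
  defines "A \<equiv> {\<omega> \<in> space M. 2 * e \<le> \<bar>stein_gap p m (minv Psi) (Y \<omega> * transpose_mat (Y \<omega>)) a\<bar>}"
  assumes a: "a > 0" and e: "e > 0"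
    and mean: "m / a + m * (sqrt (2 * p) * c2 / (a * c1)) \<le> e"
    and c: "2 * ((\<bar>real m - real p\<bar> + 2 * real p) / a + 1 / c1) \<le> c"
  shows "A \<in> events" "prob A \<le> 2 * exp (- (e\<^sup>2 / (2 * c\<^sup>2 * m)))"
proof -
  let ?C = "\<lambda>\<omega>. \<lambda>j\<in>{..<m}. column j \<omega>"
  define E where "E = {x \<in> space (PiM {..<m} law). 2 * e \<le> \<bar>stein_gap p m (minv Psi) (gram p {..<m} x) a\<bar>}"
  have C: "?C \<in> measurable M (PiM {..<m} (\<lambda>_. B))"
    by (intro measurable_restrict column_measurable) auto
  have sets: "sets (PiM {..<m} law) = sets (PiM {..<m} (\<lambda>_. B))"
    by (intro sets_PiM_cong) (auto simp: law_def)
  have sp: "space (PiM {..<m} law) = space (PiM {..<m} (\<lambda>_. B))" using sets by (rule sets_eq_imp_space_eq)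
  have "(\<lambda>x. stein_gap p m (minv Psi) (gram p {..<m} x) a) \<in> borel_measurable (PiM {..<m} law)"
    by (rule measurable_stein_gap[OF _ a T_carrier]) (auto intro: coord_measurable)
  then have E: "E \<in> sets (PiM {..<m} law)" unfolding E_def by measurable
  have AE: "A = ?C -` E \<inter> space M"
    using measurable_space[OF C] by (auto simp: A_def E_def gram_columns sp)
  show "A \<in> events" unfolding AE using measurable_sets[OF C] E sets by simp
  have "prob A = measure (PiM {..<m} law) E"
    unfolding AE joint_law[symmetric] using C E sets by (intro measure_distr[symmetric]) auto
  also have "\<dots> \<le> 2 * exp (- (e\<^sup>2 / (2 * c\<^sup>2 * m)))"
    using stein_gap_tail[of "{..<m}" a e c] a p e mean c m by (simp add: E_def lessThan_empty_iff)
  finally show "prob A \<le> 2 * exp (- (e\<^sup>2 / (2 * c\<^sup>2 * m)))" .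
qed

text \<open>\<open>tr W\<close> is \<open>m * tr Psi\<close> plus a sum of independent centred
  quadratic forms with identity coefficients, each of variance at most \<open>2 * c2^2 * p\<close>,
  and \<open>tr Psi \<le> p * c2\<close>. For \<open>t = n * p\<close> with \<open>p\<close> of
  order \<open>n\<close> the bound is \<open>O(1/n^2)\<close>, hence summable.\<close>

lemma sample_trace_tail:
  fixes t :: real
  defines "A \<equiv> {\<omega> \<in> space M. real m * (real p * c2) + t \<le> mtrace (Y \<omega> * transpose_mat (Y \<omega>))}"
  assumes t: "t > 0"
  shows "A \<in> events" "prob A \<le> m * (2 * c2\<^sup>2 * p) / t\<^sup>2"
proof -
  define Z where "Z j \<omega> = (\<Sum>i<p. \<Sum>k<p. (if i = k then 1 else 0) * (column j \<omega> i * column j \<omega> k - Psi $$ (i, k)))" for j \<omega>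
  have G: "gaussian_vector M p Psi (column j)" if "j < m" for j
    using column_normal[OF that] Psi prob_space_axioms by (simp add: gaussian_vector_def gaussian_vector_axioms_def)
  have Zqf: "Z j = gaussian_vector.qf p Psi (column j) (\<lambda>i k. if i = k then 1 else 0)" if "j < m" for j
    using gaussian_vector.qf_def[OF G[OF that]] by (simp add: Z_def fun_eq_iff)
  define v :: real where "v = (\<Sum>i<p. \<Sum>j<p. \<Sum>k<p. \<Sum>l<p. (if i = j then 1 else 0) * (if k = l then 1 else 0) *
     (Psi $$ (i, k) * Psi $$ (j, l) + Psi $$ (i, l) * Psi $$ (j, k)))"
  have psym: "Psi $$ (i, j) = Psi $$ (j, i)" if "i < p" "j < p" for i j
    using gaussian_vector.Psi_sym[OF G[OF m]] that .
  have "v \<le> 2 * c2\<^sup>2 * (\<Sum>i<p. \<Sum>j<p. (if i = j then 1 else 0)\<^sup>2)"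
    unfolding v_def by (rule wick_sum_le[where S = "\<lambda>i j. Psi $$ (i, j)"]) (use psym Psi_norm in auto)
  also have "(\<Sum>i<p. \<Sum>j<p. (if i = j then 1 else 0 :: real)\<^sup>2) = p"
    by (simp add: if_distrib[of "\<lambda>x. x\<^sup>2"] cong: if_cong)
  finally have v: "v \<le> 2 * c2\<^sup>2 * p" .
  have ind: "indep_vars (\<lambda>_. borel) Z {..<m}"
    unfolding Z_def[abs_def]
    by (rule indep_vars_compose2[OF column_indep, where Y = "\<lambda>_ x. \<Sum>i<p. \<Sum>k<p. (if i = k then 1 else 0) * (x i * x k - Psi $$ (i, k))"])
      measurable
  have trPsi: "mtrace Psi \<le> p * c2"
  proof -
    have "unit_vec p i \<bullet> (Psi *\<^sub>v unit_vec p i) \<le> c2" if "i < p" for i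
      using quadratic_form_bounds(2)[OF ev Psi_transpose tau, of "unit_vec p i"] that by simp
    then have "(\<Sum>i<p. unit_vec p i \<bullet> (Psi *\<^sub>v unit_vec p i)) \<le> (\<Sum>i<p. c2)" by (intro sum_mono) auto
    then show ?thesis unfolding mtrace_unit[OF Psi_carrier] by simp
  qed
  have tr: "mtrace (Y \<omega> * transpose_mat (Y \<omega>)) = real m * mtrace Psi + (\<Sum>j<m. Z j \<omega>)" if w: "\<omega> \<in> space M" for \<omega>
  proof -
    have "Z j \<omega> = vec p (column j \<omega>) \<bullet> vec p (column j \<omega>) - mtrace Psi" for j
      using Psi_carrier
      by (simp add: Z_def if_distrib[of "\<lambda>x. x * _"] sum_subtractf scalar_prod_def mtrace_def atLeast0LessThan cong: if_cong)
    then show ?thesis unfolding gram_columns(2)[OF w, symmetric] mtrace_gram by (simp add: sum_subtractf)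
  qed
  have Zm [measurable]: "Z j \<in> borel_measurable M" if "j < m" for j
    using ind that by (auto simp: indep_vars_def)
  have "A = {\<omega> \<in> space M. real m * (real p * c2) + t \<le> real m * mtrace Psi + (\<Sum>j<m. Z j \<omega>)}"
    unfolding A_def using tr by auto
  also have "\<dots> \<in> events" by measurable
  finally show "A \<in> events" .
  have "prob A \<le> prob {\<omega> \<in> space M. t \<le> \<bar>\<Sum>j<m. Z j \<omega>\<bar>}"
  proof (rule finite_measure_mono)
    have "real m * mtrace Psi \<le> real m * (real p * c2)" using trPsi by (intro mult_left_mono) auto
    then show "A \<subseteq> {\<omega> \<in> space M. t \<le> \<bar>\<Sum>j<m. Z j \<omega>\<bar>}" using tr by (auto simp: A_def)
    show "{\<omega> \<in> space M. t \<le> \<bar>\<Sum>j<m. Z j \<omega>\<bar>} \<in> events" by measurable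
  qed
  also have "\<dots> \<le> card {..<m} * (2 * c2\<^sup>2 * p) / t\<^sup>2"
  proof (rule indep_sum_tail[OF _ ind _ _ v t])
    show "has_bochner_integral M (Z j) 0" "has_bochner_integral M (\<lambda>\<omega>. (Z j \<omega>)\<^sup>2) v" if "j \<in> {..<m}" for j
      using gaussian_vector.qf_mean[OF G[of j]] gaussian_vector.qf_variance[OF G[of j]] Zqf[of j] that
      by (auto simp: v_def)
  qed simp
  finally show "prob A \<le> m * (2 * c2\<^sup>2 * p) / t\<^sup>2" by simp
qed

end

end

section \<open>Almost sure convergence\<close>

text \<open>Measurability and the bound are assumed only for large \<open>n\<close>; earlier events
  are replaced by the empty set, which leaves the eventual statement unchanged.\<close>

lemma (in prob_space) borel_cantelli_eventually_bound:
  assumes "\<forall>\<^sub>F n in sequentially. A n \<in> events \<and> prob (A n) \<le> b n" and "summable b"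
  shows "AE \<omega> in M. \<forall>\<^sub>F n in sequentially. \<omega> \<notin> A n"
proof -
  obtain n0 where n0: "\<And>n. n \<ge> n0 \<Longrightarrow> A n \<in> events \<and> prob (A n) \<le> b n"
    using assms(1) by (auto simp: eventually_sequentially)
  define A' where "A' n = (if n \<ge> n0 then A n else {})" for n
  have "AE \<omega> in M. \<forall>\<^sub>F n in sequentially. \<omega> \<in> space M - A' n"
  proof (rule borel_cantelli_AE1)
    show "A' n \<in> events" for n using n0 by (simp add: A'_def)
    show "summable (\<lambda>n. prob (A' n))"
      by (rule summable_comparison_test_ev[OF _ assms(2)])
        (use n0 in \<open>auto simp: A'_def eventually_sequentially intro!: exI[of _ n0]\<close>)
  qed (simp add: less_top[symmetric])
  then show ?thesis
  proof eventually_elim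
    case (elim \<omega>)
    then show ?case using eventually_ge_at_top[of n0] by eventually_elim (auto simp: A'_def)
  qed
qed

theorem theorem4:
  fixes M :: "'a measure"
    and p :: "nat \<Rightarrow> nat"
    and Psi :: "nat \<Rightarrow> real mat"
    and Y :: "nat \<Rightarrow> 'a \<Rightarrow> real mat"
    and g :: "nat \<Rightarrow> real mat \<Rightarrow> real"
    and tau :: "nat \<Rightarrow> nat \<Rightarrow> real"
    and H :: "real measure"
    and c0 c1 c2 gamma alpha :: real
  defines "W \<equiv> \<lambda>n \<omega>. Y n \<omega> * transpose_mat (Y n \<omega>)"
  defines "ahat \<equiv> \<lambda>n \<omega>. g n (W n \<omega>)"
  defines "V \<equiv> \<lambda>n \<omega>. minv (W n \<omega> + ahat n \<omega> \<cdot>\<^sub>m 1\<^sub>m (p n))"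
  defines "aS \<equiv> \<lambda>n \<omega>.
     ((real n - real (p n) - 1) * mtrace (V n \<omega>) + ahat n \<omega> * (mtrace (V n \<omega>))\<^sup>2)
       / mtrace (V n \<omega> * V n \<omega> * W n \<omega>) - (2 * c0 + 1)"
  defines "astar \<equiv> \<lambda>n \<omega>.
     (mtrace (minv (Psi n)) - ahat n \<omega> * mtrace (V n \<omega> * minv (Psi n)))
       / mtrace (V n \<omega> * V n \<omega> * W n \<omega>)"
  assumes M: "prob_space M"
    and p_pos: "\<And>n. p n > 0"
    and Psi_pd: "\<And>n. pos_def_mat (p n) (Psi n)"
    and Y_distr: "\<And>n. iid_normal_columns M (p n) (n - 1) (Psi n) (Y n)"
    and ahat_nonneg: "\<And>n \<omega>. \<omega> \<in> space M \<Longrightarrow> ahat n \<omega> \<ge> 0"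
    and c0: "c0 \<ge> 0"
    and A1: "(\<lambda>n. real n / real (p n)) \<longlonglongrightarrow> gamma" "0 < gamma" "gamma \<noteq> 1"
    and A2_eig: "\<And>n. eigenvalues_of (p n) (Psi n) (tau n)"
    and A2_bounds: "0 < c1" "c1 \<le> c2" "\<And>n j. j < p n \<Longrightarrow> tau n j \<in> {c1..c2}"
    and A2_esd: "real_distribution H"
      "weak_conv (\<lambda>n t. real (card {j. j < p n \<and> tau n j \<le> t}) / real (p n)) (cdf H)"
    and A3: "AE \<omega> in M. (\<lambda>n. ahat n \<omega> / real n) \<longlonglongrightarrow> alpha" "alpha > 0"
  shows "AE \<omega> in M. (\<lambda>n. \<bar>aS n \<omega> - astar n \<omega>\<bar> / real n) \<longlonglongrightarrow> 0"
proof -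
  interpret prob_space M by (rule M)
  have alpha: "alpha > 0" by (rule A3(2))
  define t where "t = 1 / c1"
  have t: "t > 0" using A2_bounds by (simp add: t_def)
  define G where "G n \<omega> a = stein_gap (p n) (real (n - 1)) (minv (Psi n)) (W n \<omega>) a" for n \<omega> a

  \<comment> \<open>\<open>p / n\<close> tends to \<open>1 / gamma\<close>; half and twice this
    limit bracket it eventually.\<close>
  define k K where "k = 1 / (2 * gamma)" and "K = 2 / gamma"
  have kK: "k > 0" "K > 0" using A1(2) by (simp_all add: k_def K_def)
  have ratio: "\<forall>\<^sub>F n in sequentially. k * real n \<le> p n \<and> p n \<le> K * real n"
  proof -
    have "(\<lambda>n. inverse (real n / real (p n))) \<longlonglongrightarrow> inverse gamma"
      using A1 by (intro tendsto_inverse) auto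
    then have lim: "(\<lambda>n. real (p n) / real n) \<longlonglongrightarrow> 1 / gamma" by (simp add: inverse_eq_divide)
    have "k < 1 / gamma" "1 / gamma < K" using A1(2) by (simp_all add: k_def K_def field_simps)
    then have "\<forall>\<^sub>F n in sequentially. k < real (p n) / real n" "\<forall>\<^sub>F n in sequentially. real (p n) / real n < K"
      using lim by (auto intro: order_tendstoD)
    then show ?thesis using eventually_gt_at_top[of 0]
      by eventually_elim (auto simp: field_simps)
  qed

  have AE_gap: "AE \<omega> in M. \<forall>\<^sub>F n in sequentially. \<bar>G n \<omega> (real n * alpha)\<bar> < e * real n" if e: "e > 0" for e
  proof -
    \<comment> \<open>\<open>C\<close> bounds the effect of replacing one column at shift
      \<open>n * alpha\<close>, using \<open>|m - p| + 2 p \<le> (1 + 3 K) n\<close>;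
      \<open>b\<close> below is made so that the mean is at most
      \<open>1 / alpha + b * sqrt n\<close>.\<close>
    define C where "C = 2 * ((1 + 3 * K) / alpha + 1 / c1)"
    have C: "C > 0" using kK alpha A2_bounds by (auto simp: C_def intro!: mult_pos_pos add_pos_pos)
    define b where "b = sqrt (2 * K) * c2 / (alpha * c1)"
    have b: "b \<ge> 0" using kK alpha A2_bounds by (auto simp: b_def)
    \<comment> \<open>McDiarmid at level \<open>e n / 2\<close> has exponent
      \<open>(e n / 2)^2 / (2 C^2 (n - 1))\<close>, which is at least
      \<open>n e^2 / (8 C^2)\<close>: the tail is geometric in \<open>n\<close>.\<close>
    define r where "r = exp (- (e\<^sup>2 / (8 * C\<^sup>2)))"
    have r: "0 \<le> r" "r < 1" using e C by (auto simp: r_def)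
    define A where "A n = {\<omega> \<in> space M. 2 * (e * real n / 2) \<le> \<bar>G n \<omega> (real n * alpha)\<bar>}" for n
    have "(\<lambda>n. 1 / alpha / real n + b / sqrt (real n)) \<longlonglongrightarrow> 0" by real_asymp
    then have "\<forall>\<^sub>F n in sequentially. 1 / alpha / real n + b / sqrt (real n) < e / 2"
      using e by (intro order_tendstoD) auto
    then have "\<forall>\<^sub>F n in sequentially. A n \<in> events \<and> prob (A n) \<le> 2 * r ^ n"
      using ratio eventually_ge_at_top[of 2]
    proof eventually_elim
      case (elim n)
      have n: "n \<ge> 2" and m: "n - 1 > 0" "real (n - 1) \<le> real n" "real (n - 1) > 0" using elim by auto
      have a: "real n * alpha > 0" using n alpha by simp
      have mean: "real (n - 1) / (real n * alpha) + real (n - 1) * (sqrt (2 * p n) * c2 / (real n * alpha * c1)) \<le> e * real n / 2"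
      proof -
        have "real (n - 1) / (real n * alpha) \<le> real n / (real n * alpha)"
          using a m by (intro divide_right_mono) auto
        also have "\<dots> = 1 / alpha" using n by simp
        finally have 1: "real (n - 1) / (real n * alpha) \<le> 1 / alpha" .
        have "sqrt (2 * p n) \<le> sqrt (2 * K) * sqrt (real n)"
          unfolding real_sqrt_mult[symmetric] using elim(2) by (intro real_sqrt_le_mono) auto
        then have "real (n - 1) * (sqrt (2 * p n) * c2 / (real n * alpha * c1))
          \<le> real n * ((sqrt (2 * K) * sqrt (real n)) * c2 / (real n * alpha * c1))"
          using m a A2_bounds kK by (intro mult_mono divide_right_mono mult_right_mono) auto
        also have "\<dots> = b * sqrt (real n)" using n by (simp add: b_def)
        finally have 2: "real (n - 1) * (sqrt (2 * p n) * c2 / (real n * alpha * c1)) \<le> b * sqrt (real n)" .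
        have "real n * (1 / alpha / real n + b / sqrt (real n)) = 1 / alpha + b * (real n / sqrt (real n))"
          using n by (simp add: distrib_left)
        also have "real n / sqrt (real n) = sqrt (real n)" by (rule real_div_sqrt) simp
        finally have "1 / alpha + b * sqrt (real n) \<le> real n * (e / 2)"
          using elim(1) mult_left_mono[of "1 / alpha / real n + b / sqrt (real n)" "e / 2" "real n"] by simp
        moreover have "real n * (e / 2) = e * real n / 2" by simp
        ultimately show ?thesis using 1 2 by linarith
      qed
      have c: "2 * ((\<bar>real (n - 1) - real (p n)\<bar> + 2 * real (p n)) / (real n * alpha) + 1 / c1) \<le> C"
      proof -
        have "\<bar>real (n - 1) - real (p n)\<bar> + 2 * real (p n) \<le> (1 + 3 * K) * real n"
          using elim(2) m by (auto simp: algebra_simps abs_le_iff)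
        then have "(\<bar>real (n - 1) - real (p n)\<bar> + 2 * real (p n)) / (real n * alpha) \<le> (1 + 3 * K) * real n / (real n * alpha)"
          using a by (intro divide_right_mono) auto
        also have "\<dots> = (1 + 3 * K) / alpha" using n by simp
        finally show ?thesis unfolding C_def by (intro mult_left_mono add_right_mono) auto
      qed
      note tail = sample_stein_gap_tail[OF Y_distr m(1) p_pos Psi_pd A2_eig A2_bounds(1,2) A2_bounds(3) a _ mean c]
      have e': "e * real n / 2 > 0" using e n by simp
      have "prob (A n) \<le> 2 * exp (- ((e * real n / 2)\<^sup>2 / (2 * C\<^sup>2 * real (n - 1))))"
        unfolding A_def G_def W_def using tail(2)[OF _ e'] by simp
      also have "\<dots> \<le> 2 * r ^ n"
      proof -
        have "real n * (e\<^sup>2 / (8 * C\<^sup>2)) = (e * real n / 2)\<^sup>2 / (2 * C\<^sup>2 * real n)"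
          using n C by (simp add: field_simps power2_eq_square)
        also have "\<dots> \<le> (e * real n / 2)\<^sup>2 / (2 * C\<^sup>2 * real (n - 1))"
          using m n C by (intro divide_left_mono mult_left_mono mult_pos_pos) auto
        finally have "exp (- ((e * real n / 2)\<^sup>2 / (2 * C\<^sup>2 * real (n - 1)))) \<le> exp (real n * (- (e\<^sup>2 / (8 * C\<^sup>2))))"
          by (simp only: exp_le_cancel_iff mult_minus_right neg_le_iff_le)
        then show ?thesis unfolding r_def exp_of_nat_mult[symmetric] by (intro mult_left_mono) auto
      qed
      finally show ?case using tail(1)[OF _ e'] by (simp add: A_def G_def W_def)
    qed
    then have "AE \<omega> in M. \<forall>\<^sub>F n in sequentially. \<omega> \<notin> A n"
      by (rule borel_cantelli_eventually_bound) (use r in \<open>simp add: summable_geometric\<close>)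
    with AE_space show ?thesis
    proof eventually_elim
      case (elim \<omega>)
      from elim(2) show ?case by eventually_elim (use elim(1) in \<open>auto simp: A_def not_le\<close>)
    qed
  qed

  \<comment> \<open>The mean bound \<open>m p c2\<close> plus the allowed deviation
    \<open>n p\<close> is at most \<open>K (c2 + 1) n^2\<close>.\<close>
  define L where "L = K * (c2 + 1)"
  have L: "L > 0" using kK A2_bounds by (simp add: L_def)
  have AE_trace: "AE \<omega> in M. \<forall>\<^sub>F n in sequentially. mtrace (W n \<omega>) < L * (real n)\<^sup>2"
  proof -
    define A where "A n = {\<omega> \<in> space M. real (n - 1) * (p n * c2) + real n * p n \<le> mtrace (W n \<omega>)}" for n
    define b where "b n = 2 * c2\<^sup>2 / k * (1 / (real n)\<^sup>2)" for n
    have "\<forall>\<^sub>F n in sequentially. A n \<in> events \<and> prob (A n) \<le> b n"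
      using ratio eventually_ge_at_top[of 2]
    proof eventually_elim
      case (elim n)
      have n: "n \<ge> 2" and m: "n - 1 > 0" "real (n - 1) \<le> real n" using elim by auto
      have pn: "real (p n) > 0" using p_pos by simp
      have t': "real n * real (p n) > 0" using n pn by simp
      note tail = sample_trace_tail[OF Y_distr m(1) p_pos Psi_pd A2_eig A2_bounds(1,2) A2_bounds(3) t']
      have "prob (A n) \<le> real (n - 1) * (2 * c2\<^sup>2 * p n) / (real n * p n)\<^sup>2"
        unfolding A_def W_def using tail(2) by simp
      also have "\<dots> \<le> real n * (2 * c2\<^sup>2 * p n) / (real n * p n)\<^sup>2"
        using m by (intro divide_right_mono mult_right_mono) auto
      also have "\<dots> = 2 * c2\<^sup>2 / (real n * p n)"
        using n pn by (simp add: power2_eq_square field_simps)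
      also have "\<dots> \<le> 2 * c2\<^sup>2 / (real n * (k * real n))"
        using n pn kK elim(1) by (intro divide_left_mono mult_left_mono mult_pos_pos) auto
      also have "\<dots> = b n" by (simp add: b_def power2_eq_square)
      finally show ?case using tail(1) by (simp add: A_def W_def)
    qed
    moreover have "summable b"
      unfolding b_def using inverse_power_summable[of 2, where 'a = real]
      by (intro summable_mult) (simp add: inverse_eq_divide power_divide)
    ultimately have "AE \<omega> in M. \<forall>\<^sub>F n in sequentially. \<omega> \<notin> A n"
      by (rule borel_cantelli_eventually_bound)
    with AE_space show ?thesis
    proof eventually_elim
      case (elim \<omega>)
      from elim(2) ratio show ?case
      proof eventually_elim
        case (elim n)
        have "mtrace (W n \<omega>) < real (n - 1) * (p n * c2) + real n * p n"
          using elim(1) \<open>\<omega> \<in> space M\<close> by (auto simp: A_def)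
        also have "\<dots> \<le> real n * ((K * real n) * c2) + real n * (K * real n)"
          using elim(2) A2_bounds by (intro add_mono mult_mono mult_left_mono mult_right_mono) auto
        also have "\<dots> = L * (real n)\<^sup>2" by (simp add: L_def power2_eq_square algebra_simps)
        finally show ?case .
      qed
    qed
  qed

  \<comment> \<open>The null set in \<open>AE_gap\<close> depends on \<open>e\<close>; restricting
    to the values \<open>1 / (i + 1)\<close> leaves a countable union.\<close>
  have AE_gap_all: "AE \<omega> in M. \<forall>i::nat. \<forall>\<^sub>F n in sequentially. \<bar>G n \<omega> (real n * alpha)\<bar> < 1 / real (Suc i) * real n"
    unfolding AE_all_countable by (intro allI AE_gap) simp

  \<comment> \<open>From here on a single sample path is fixed and the argument is
    deterministic.\<close>
  from AE_space A3(1) AE_trace AE_gap_all show ?thesis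
  proof eventually_elim
    case (elim \<omega>)
    \<comment> \<open>\<open>gram\<close> takes the column index first, matrices take it
      second.\<close>
    define x where "x n j i = Y n \<omega> $$ (i, j)" for n j i
    have W: "W n \<omega> = gram (p n) {..<n - 1} (x n)" for n
      unfolding W_def x_def[abs_def] using Y_distr[of n] elim(1)
      by (auto intro!: eq_matI simp: iid_normal_columns_def gram_def scalar_prod_def atLeast0LessThan)
    have nb: "norm_bounded (p n) (minv (Psi n)) t" for n
    proof -
      have pd: "Psi n \<in> carrier_mat (p n) (p n)" "transpose_mat (Psi n) = Psi n"
        using Psi_pd[of n] by (auto simp: pos_def_mat_def)
      note inv = minv_nonsingular(2-4)[OF pd(1) pos_def_det[OF Psi_pd]]
      show ?thesis
      proof
        show "transpose_mat (minv (Psi n)) = minv (Psi n)"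
          by (rule minv_transpose[OF pd(1) pos_def_det[OF Psi_pd] pd(2)])
        show "scalar_prod (minv (Psi n) *\<^sub>v v) (minv (Psi n) *\<^sub>v v) \<le> t\<^sup>2 * scalar_prod v v" if "v \<in> carrier_vec (p n)" for v
          unfolding t_def
          by (rule inverse_norm_bound[OF pd(1) A2_bounds(1) _ inv(1,2) that])
            (rule quadratic_form_bounds(1)[OF A2_eig pd(2) A2_bounds(3)])
      qed (use inv t in auto)
    qed
    define a where "a n = ahat n \<omega>" for n
    define D where "D n = mtrace (V n \<omega> * V n \<omega> * W n \<omega>)" for n
    have V: "V n \<omega> = resolvent (p n) (W n \<omega>) (a n)" for n by (simp add: V_def resolvent_def a_def)
    have a_lim: "(\<lambda>n. a n / real n) \<longlonglongrightarrow> alpha" using elim(2) by (simp add: a_def)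
    \<comment> \<open>Besides the order of magnitude this gives positivity of the shift for large
      \<open>n\<close>, on which the resolvent bounds rely.\<close>
    have a_bd: "\<forall>\<^sub>F n in sequentially. alpha / 2 * real n \<le> a n \<and> a n \<le> 2 * alpha * real n"
    proof -
      have "\<forall>\<^sub>F n in sequentially. alpha / 2 < a n / real n" "\<forall>\<^sub>F n in sequentially. a n / real n < 2 * alpha"
        using alpha by (auto intro: order_tendstoD[OF a_lim] simp del: less_divide_eq_numeral1 divide_less_eq_numeral1)
      then show ?thesis using eventually_gt_at_top[of 0] by eventually_elim (auto simp: field_simps)
    qed
    have gap0: "(\<lambda>n. G n \<omega> (real n * alpha) / real n) \<longlonglongrightarrow> 0"
    proof (rule tendstoI)
      fix e :: real assume "e > 0"
      then obtain i where i: "1 / real (Suc i) < e" using nat_approx_posE by blast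
      from elim(4)[rule_format, of i] eventually_gt_at_top[of 0]
      show "\<forall>\<^sub>F n in sequentially. dist (G n \<omega> (real n * alpha) / real n) 0 < e"
      proof eventually_elim
        case (elim n)
        then have "\<bar>G n \<omega> (real n * alpha)\<bar> / real n < 1 / real (Suc i)" by (simp add: divide_less_eq)
        then show ?case using i elim by simp
      qed
    qed
    \<comment> \<open>The Lipschitz bracket with \<open>d = alpha n / 2\<close>,
      \<open>p \<le> K n\<close> and \<open>|m - p| \<le> (1 + K) n\<close>, in which all powers of
      \<open>n\<close> cancel.\<close>
    define l where "l = (1 + K) * K / (alpha / 2)\<^sup>2 + 3 * K\<^sup>2 / (alpha / 2)\<^sup>2 + 2 * K * t / (alpha / 2)"
    have gap: "(\<lambda>n. G n \<omega> (a n) / real n) \<longlonglongrightarrow> 0"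
    proof -
      have "(\<lambda>n. \<bar>a n / real n - alpha\<bar> * l) \<longlonglongrightarrow> \<bar>alpha - alpha\<bar> * l"
        by (intro tendsto_intros a_lim)
      then have lim: "(\<lambda>n. \<bar>a n / real n - alpha\<bar> * l) \<longlonglongrightarrow> 0" by simp
      have "(\<lambda>n. G n \<omega> (a n) / real n - G n \<omega> (real n * alpha) / real n) \<longlonglongrightarrow> 0"
      proof (rule Lim_null_comparison[OF _ lim])
        show "\<forall>\<^sub>F n in sequentially. norm (G n \<omega> (a n) / real n - G n \<omega> (real n * alpha) / real n)
          \<le> \<bar>a n / real n - alpha\<bar> * l"
          using ratio a_bd eventually_gt_at_top[of 0]
        proof eventually_elim
          case (elim n)
          interpret norm_bounded "p n" "minv (Psi n)" t by (rule nb)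
          define d where "d = alpha / 2 * real n"
          have n: "real n > 0" using elim by simp
          have d: "d > 0" using alpha n by (simp add: d_def)
          have "\<bar>G n \<omega> (a n) - G n \<omega> (real n * alpha)\<bar> \<le> \<bar>a n - real n * alpha\<bar> *
            (\<bar>real (n - 1) - real (p n)\<bar> * real (p n) / d\<^sup>2 + 3 * (real (p n))\<^sup>2 / d\<^sup>2 + 2 * real (p n) * t / d)"
            unfolding G_def W using elim alpha d
            by (intro stein_gap_lipschitz gram_psd) (auto simp: d_def)
          also have "\<dots> \<le> \<bar>a n - real n * alpha\<bar> *
            (((1 + K) * real n) * (K * real n) / d\<^sup>2 + 3 * (K * real n)\<^sup>2 / d\<^sup>2 + 2 * (K * real n) * t / d)"
          proof (intro mult_left_mono add_mono divide_right_mono mult_mono power_mono)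
            have "real (n - 1) \<le> real n" by simp
            moreover have "0 \<le> K * real n" using kK by simp
            ultimately show "\<bar>real (n - 1) - real (p n)\<bar> \<le> (1 + K) * real n"
              using elim(1) unfolding abs_le_iff distrib_right by linarith
          qed (use elim kK t d in auto)
          also have "((1 + K) * real n) * (K * real n) / d\<^sup>2 = (1 + K) * K / (alpha / 2)\<^sup>2"
            using n alpha by (simp add: d_def power2_eq_square field_simps)
          also have "3 * (K * real n)\<^sup>2 / d\<^sup>2 = 3 * K\<^sup>2 / (alpha / 2)\<^sup>2"
            using n alpha by (simp add: d_def power2_eq_square field_simps)
          also have "2 * (K * real n) * t / d = 2 * K * t / (alpha / 2)"
            using n alpha by (simp add: d_def field_simps)
          finally have "\<bar>G n \<omega> (a n) - G n \<omega> (real n * alpha)\<bar> / real n \<le> \<bar>a n - real n * alpha\<bar> * l / real n"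
            unfolding l_def[symmetric] by (intro divide_right_mono) auto
          also have "\<bar>a n - real n * alpha\<bar> * l / real n = \<bar>a n / real n - alpha\<bar> * l"
          proof -
            have "a n / real n - alpha = (a n - real n * alpha) / real n" using n by (simp add: field_simps)
            then show ?thesis by simp
          qed
          finally show ?case by (simp add: diff_divide_distrib[symmetric])
        qed
      qed
      from tendsto_add[OF this gap0] show ?thesis by simp
    qed

    \<comment> \<open>\<open>q\<close> bounds \<open>(m + p) / a + t\<close>. Since
      \<open>m p / a \<ge> k n / (4 alpha)\<close> and the gap uses up at most half of that,
      \<open>S q \<ge> k n / (8 alpha)\<close>, that is \<open>S \<ge> s n\<close>; with
      \<open>S^2 = D tr W\<close> and \<open>tr W < L n^2\<close> this leaves
      \<open>D \<ge> s^2 / L\<close>.\<close>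
    define q where "q = (1 + K) * (2 / alpha) + t"
    define s where "s = k / (8 * alpha) / q"
    define \<delta> where "\<delta> = s\<^sup>2 / L"
    have q: "q > 0" using kK alpha t by (auto simp: q_def intro!: add_pos_pos)
    have s: "s > 0" using kK alpha q by (simp add: s_def)
    have \<delta>: "\<delta> > 0" using s L by (simp add: \<delta>_def)
    have "\<forall>\<^sub>F n in sequentially. \<bar>G n \<omega> (a n) / real n\<bar> < k / (8 * alpha)"
      using tendstoD[OF gap, of "k / (8 * alpha)"] kK alpha by (simp add: dist_real_def)
    with ratio a_bd elim(3) eventually_ge_at_top[of 2]
    have D_low: "\<forall>\<^sub>F n in sequentially. \<delta> \<le> D n"
    proof eventually_elim
      case (elim n)
      interpret norm_bounded "p n" "minv (Psi n)" t by (rule nb)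
      have n: "real n > 0" "real (n - 1) \<ge> real n / 2" "real (n - 1) \<le> real n" using elim by auto
      have an: "a n > 0"
      proof -
        have "0 < alpha / 2 * real n" using alpha n by simp
        then show ?thesis using elim(2) by linarith
      qed
      define S where "S = sqrt (D n * mtrace (W n \<omega>))"
      have D0: "0 \<le> D n" unfolding D_def V W by (rule loss_curvature_lower(2)) (use an in auto)
      have tr0: "0 \<le> mtrace (W n \<omega>)" unfolding W mtrace_gram by (intro sum_nonneg sprod_self_nonneg)
      have S0: "0 \<le> S" using D0 tr0 by (simp add: S_def)
      have "real (n - 1) * real (p n) / a n \<le> \<bar>G n \<omega> (a n)\<bar> + S * ((real (n - 1) + real (p n)) / a n + t)"
        using loss_curvature_lower(1)[of "{..<n - 1}" "a n" "x n"] an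
        by (simp add: S_def D_def V W G_def)
      also have "\<dots> \<le> k / (8 * alpha) * real n + S * q"
      proof (intro add_mono mult_left_mono S0)
        show "\<bar>G n \<omega> (a n)\<bar> \<le> k / (8 * alpha) * real n"
          using elim(5) n(1) by (simp add: divide_less_eq less_imp_le)
        have "(real (n - 1) + real (p n)) / a n \<le> ((1 + K) * real n) / (alpha / 2 * real n)"
          using elim(1,2) n alpha kK an by (intro frac_le) (auto simp: distrib_right)
        also have "\<dots> = (1 + K) * (2 / alpha)" using n(1) alpha by simp
        finally show "(real (n - 1) + real (p n)) / a n + t \<le> q" by (simp add: q_def)
      qed
      finally have up: "real (n - 1) * real (p n) / a n \<le> k / (8 * alpha) * real n + S * q" .
      have "(real n / 2) * (k * real n) / (2 * alpha * real n) \<le> real (n - 1) * real (p n) / a n"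
        using elim(1,2) n alpha kK an by (intro frac_le mult_mono) auto
      moreover have "(real n / 2) * (k * real n) / (2 * alpha * real n) = 2 * (k / (8 * alpha) * real n)"
        using n(1) alpha by (simp add: field_simps)
      ultimately have "k / (8 * alpha) * real n \<le> S * q" using up by linarith
      then have "k / (8 * alpha) * real n / q \<le> S" using q by (simp only: pos_divide_le_eq)
      then have "s * real n \<le> S" by (simp add: s_def)
      then have "(s * real n)\<^sup>2 \<le> S\<^sup>2" using s n by (intro power_mono) auto
      also have "S\<^sup>2 = D n * mtrace (W n \<omega>)" using D0 tr0 by (simp add: S_def)
      also have "\<dots> \<le> D n * (L * (real n)\<^sup>2)" using elim(3) D0 by (intro mult_left_mono) auto
      finally have "s\<^sup>2 * (real n)\<^sup>2 \<le> (D n * L) * (real n)\<^sup>2" by (simp add: power_mult_distrib mult_ac)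
      then have "s\<^sup>2 \<le> D n * L" using n(1) by simp
      then show ?case using L by (simp add: \<delta>_def divide_le_eq)
    qed
    have lim: "(\<lambda>n. \<bar>G n \<omega> (a n) / real n\<bar> / \<delta> + (2 * c0 + 1) / real n) \<longlonglongrightarrow> 0"
    proof -
      have "(\<lambda>n. (2 * c0 + 1) / real n) \<longlonglongrightarrow> 0" by real_asymp
      moreover have "(\<lambda>n. \<bar>G n \<omega> (a n) / real n\<bar> / \<delta>) \<longlonglongrightarrow> \<bar>0\<bar> / \<delta>"
        using \<delta> by (intro tendsto_intros gap) auto
      ultimately show ?thesis using tendsto_add by fastforce
    qed
    show ?case
    proof (rule Lim_null_comparison[OF _ lim])
      show "\<forall>\<^sub>F n in sequentially. norm (\<bar>aS n \<omega> - astar n \<omega>\<bar> / real n)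
        \<le> \<bar>G n \<omega> (a n) / real n\<bar> / \<delta> + (2 * c0 + 1) / real n"
        using D_low eventually_ge_at_top[of 2]
      proof eventually_elim
        case (elim n)
        have n: "real n > 0" "real (n - 1) = real n - 1" using elim by auto
        have Dn: "D n > 0" using elim \<delta> by linarith
        \<comment> \<open>The coefficient \<open>n - p - 1\<close> is \<open>m - p\<close> for the
          \<open>m = n - 1\<close> columns; \<open>n \<ge> 2\<close> makes the natural subtraction
          exact.\<close>
        have n': "real n - real (p n) - 1 = real (n - 1) - real (p n)" using n(2) by linarith
        have eq: "aS n \<omega> - astar n \<omega> = G n \<omega> (a n) / D n - (2 * c0 + 1)"
          unfolding aS_def n' by (simp add: astar_def D_def[symmetric] G_def stein_gap_def V[symmetric] a_def[symmetric]
            diff_divide_distrib[symmetric] algebra_simps)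
        have "\<bar>aS n \<omega> - astar n \<omega>\<bar> \<le> \<bar>G n \<omega> (a n)\<bar> / D n + (2 * c0 + 1)"
          unfolding eq using c0 Dn abs_triangle_ineq4[of "G n \<omega> (a n) / D n" "2 * c0 + 1"] by simp
        also have "\<bar>G n \<omega> (a n)\<bar> / D n \<le> \<bar>G n \<omega> (a n)\<bar> / \<delta>"
          using elim \<delta> Dn by (intro divide_left_mono) auto
        finally have "\<bar>aS n \<omega> - astar n \<omega>\<bar> / real n \<le> (\<bar>G n \<omega> (a n)\<bar> / \<delta> + (2 * c0 + 1)) / real n"
          by (intro divide_right_mono) auto
        then show ?case by (simp add: add_divide_distrib mult.commute)
      qed
    qed
  qed
qed

end
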